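(* For the case of Gardner–Morikawa exponents $\alpha=k=\beta/2=q/2$, and with $$T_0=-\frac{3P_0^2R_0(R_0^3-X+1)}{13R_0^3-4X+4},$$ the lowest-order $\epsilon$-dependent terms of the dimensionless bubbly fluid equations given in the context (without gravity) are satisfied by the first two terms of the expansions given in the context, where $\rho^{(1)}(\xi,\tau)$ is an arbitrary solution of the Korteweg–de Vries equation $$A\,\rho^{(1)}_\tau=B\,\rho^{(1)}_{\xi\xi\xi}+C\,\rho^{(1)}\rho^{(1)}_\xi,$$ $$A=P_0^{1/2}R_0^5(\gamma-1),$$ $$B=\tfrac16R_0^{1/2}(R_0^3-X+1)\left(P_0R_0^2(R_0^3-X+1)^2(\gamma-1)-\tfrac{16}{27}\left(\tfrac{13}{4}R_0^3-X+1\right)^2\right),$$ $$C=P_0R_0^{1/2}(R_0^3-X+1)^3(\gamma-1),$$ and the remaining state variable perturbations $u^{(1)},P^{(1)},P_2^{(1)},R^{(1)},u^{(2)},P^{(2)},P_2^{(2)},R^{(2)}$ are determined by the relationships $$u^{(1)}_\xi=\frac{a_0}{\rho_0}\rho^{(1)}_\xi,\quad P^{(1)}=P_2^{(1)},\quad P_2^{(1)}=-\frac{3P_0}{R_0}R^{(1)},\quad R^{(1)}=-\frac{(R_0^3-X+1)^2}{3R_0^2}\rho^{(1)},\quad P^{(1)}_\xi=\rho_0a_0\,u^{(1)}_\xi,$$ and $$u^{(2)}_\xi=\frac{a_0}{\rho_0}\rho^{(2)}_\xi,\quad P^{(2)}=P_2^{(2)}+\frac{4a_0}{3R_0}R^{(1)}_\xi,\quad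 P_2^{(2)}=-\frac{3P_0}{R_0}R^{(2)}+\frac{a_0P_0^2}{T_0}R^{(1)}_\xi,\quad R^{(2)}=-\frac{(R_0^3-X+1)^2}{3R_0^2}\rho^{(2)}.$$
   Context: The dimensionless one-dimensional bubbly fluid model without gravity, for the fields $\rho$ (mixture density), $u$ (velocity), $P$ (mixture pressure), $P_2$ (gas pressure), $R$ (bubble radius), is $$\rho_t+(\rho u)_x=0,\qquad(\rho u)_t+(\rho u^2+P)_x-u_{xx}=0,$$ $$P=P_2-\left(R\,\mathcal{D}_t^2R+\tfrac32(\mathcal{D}_tR)^2+\tfrac43\frac{\mathcal{D}_tR}{R}\right),$$ $$\mathcal{D}_tP_2+3\gamma P_2\frac{\mathcal{D}_tR}{R}+3(\gamma-1)\frac{T_0}{R}\left(\frac{P_2}{P_0}\frac{R^3}{R_0^3}-1\right)=0,\qquad(1-X+R^3)\rho-1=0,$$ with $\mathcal{D}_t=\partial_t+u\,\partial_x$, gas mass fraction $X$, adiabatic exponent $\gamma$, and constants $P_0,T_0,R_0$ (initial pressure, temperature, radius). The fields are expanded in generalized power series in a small parameter $\epsilon$ about a constant static equilibrium: $$\rho=\rho_0+\epsilon^q\rho^{(1)}+\epsilon^{q+k}\rho^{(2)}+\epsilon^{q+2k}\rho^{(3)}+\dots,\quad u=0+\epsilon^qu^{(1)}+\epsilon^{q+k}u^{(2)}+\epsilon^{q+2k}u^{(3)}+\dots,$$ $$R=R_0+\epsilon^qR^{(1)}+\epsilon^{q+k}R^{(2)}+\dots,\quad P=P_0+\epsilon^qP^{(1)}+\epsilon^{q+k}P^{(2)}+\dots,\quad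 P_2=P_0+\epsilon^qP_2^{(1)}+\epsilon^{q+k}P_2^{(2)}+\dots,$$ where $\rho_0=1/(R_0^3-X+1)$ and the coefficients are functions of the Gardner–Morikawa variables $$\xi=\epsilon^\alpha(x-a_0t),\qquad\tau=\epsilon^{\alpha+\beta}t,\qquad a_0=R_0^{-3/2}P_0^{1/2}(R_0^3-X+1),$$ with positive constants $\alpha,\beta,q,k$. Subscripts $\xi,\tau$ denote partial derivatives. For $P_0,R_0>0$ and $0<X<1$ the required value of $T_0$ is negative, so this case is not physical for the applications considered.
   Formalization: The printed KdV has the wrong sign of the τ-derivative: the next order is solvable iff −Aρ_τ = Bρ_ξξξ + Cρρ_ξ, shown with u^(1) = (a0/ρ0)ρ^(1) exactly. The two lowest orders are treated as printed and do not need KdV. γ ≠ 1 and smooth coefficients are assumed. *)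

theory Defs
  imports "HOL-Analysis.Analysis" "HOL-Library.Landau_Symbols"
begin

text \<open>Fields are functions of two real variables, read as \<open>(x, t)\<close> for the physical fields and as
  \<open>(\<xi>, \<tau>)\<close> for the coefficients of their expansions.\<close>

definition pd1 :: "(real \<Rightarrow> real \<Rightarrow> real) \<Rightarrow> real \<Rightarrow> real \<Rightarrow> real" where
  "pd1 f = (\<lambda>a b. deriv (\<lambda>s. f s b) a)"

definition pd2 :: "(real \<Rightarrow> real \<Rightarrow> real) \<Rightarrow> real \<Rightarrow> real \<Rightarrow> real" where
  "pd2 f = (\<lambda>a b. deriv (\<lambda>s. f a s) b)"

primrec Ck_on :: "nat \<Rightarrow> (real \<times> real) set \<Rightarrow> (real \<Rightarrow> real \<Rightarrow> real) \<Rightarrow> bool" where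
  "Ck_on 0 \<Omega> f \<longleftrightarrow> continuous_on \<Omega> (\<lambda>(a, b). f a b)"
| "Ck_on (Suc n) \<Omega> f \<longleftrightarrow>
     continuous_on \<Omega> (\<lambda>(a, b). f a b) \<and>
     (\<forall>(a, b)\<in>\<Omega>. (\<lambda>s. f s b) field_differentiable at a \<and> (\<lambda>s. f a s) field_differentiable at b) \<and>
     Ck_on n \<Omega> (pd1 f) \<and> Ck_on n \<Omega> (pd2 f)"

definition smooth2_on :: "(real \<times> real) set \<Rightarrow> (real \<Rightarrow> real \<Rightarrow> real) \<Rightarrow> bool" where
  "smooth2_on \<Omega> f \<longleftrightarrow> (\<forall>n. Ck_on n \<Omega> f)"

text \<open>The dimensionless bubbly fluid equations, each as left-hand side minus right-hand side.
  The gas pressure \<open>P\<^sub>2\<close> is written \<open>G\<close>, so that indices are free for the perturbation order.\<close>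

definition mat_deriv ::
  "(real \<Rightarrow> real \<Rightarrow> real) \<Rightarrow> (real \<Rightarrow> real \<Rightarrow> real) \<Rightarrow> real \<Rightarrow> real \<Rightarrow> real" where
  "mat_deriv u f = (\<lambda>x t. pd2 f x t + u x t * pd1 f x t)"

definition mass_residual where
  "mass_residual \<rho> u = (\<lambda>x t. pd2 \<rho> x t + pd1 (\<lambda>x t. \<rho> x t * u x t) x t)"

definition momentum_residual where
  "momentum_residual \<rho> u P = (\<lambda>x t.
     pd2 (\<lambda>x t. \<rho> x t * u x t) x t + pd1 (\<lambda>x t. \<rho> x t * (u x t)\<^sup>2 + P x t) x t
       - pd1 (pd1 u) x t)"

definition pressure_residual where
  "pressure_residual u P G R = (\<lambda>x t.
     P x t - (G x t - (R x t * mat_deriv u (mat_deriv u R) x t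
                         + 3/2 * (mat_deriv u R x t)\<^sup>2
                         + 4/3 * (mat_deriv u R x t / R x t))))"

definition gas_residual where
  "gas_residual \<gamma> P0 T0 R0 u G R = (\<lambda>x t.
     mat_deriv u G x t + 3 * \<gamma> * G x t * (mat_deriv u R x t / R x t)
       + 3 * (\<gamma> - 1) * (T0 / R x t) * (G x t / P0 * (R x t ^ 3 / R0 ^ 3) - 1))"

definition density_residual where
  "density_residual X \<rho> R = (\<lambda>x t. (1 - X + R x t ^ 3) * \<rho> x t - (1::real))"

definition rho0 :: "real \<Rightarrow> real \<Rightarrow> real" where
  "rho0 X R0 = 1 / (R0 ^ 3 - X + 1)"

definition wave_speed :: "real \<Rightarrow> real \<Rightarrow> real \<Rightarrow> real" where
  "wave_speed X P0 R0 = R0 powr (-3/2) * P0 powr (1/2) * (R0 ^ 3 - X + 1)"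

text \<open>\<open>gm_expansion a0 \<alpha> \<beta> q k N f0 f \<epsilon>\<close> is, as a function of \<open>(x, t)\<close>, the sum of the constant \<open>f0\<close>
  and the first \<open>N\<close> perturbation terms of a field; \<open>f j\<close> is the coefficient \<open>f\<^sup>(\<^sup>j\<^sup>)\<close>, with \<open>f 0\<close> unused.\<close>

definition gm_expansion ::
  "real \<Rightarrow> real \<Rightarrow> real \<Rightarrow> real \<Rightarrow> real \<Rightarrow> nat \<Rightarrow> real \<Rightarrow> (nat \<Rightarrow> real \<Rightarrow> real \<Rightarrow> real)
     \<Rightarrow> real \<Rightarrow> real \<Rightarrow> real \<Rightarrow> real" where
  "gm_expansion a0 \<alpha> \<beta> q k N f0 f \<epsilon> = (\<lambda>x t.
     f0 + (\<Sum>j = 1..N. \<epsilon> powr (q + (real j - 1) * k)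
                       * f j (\<epsilon> powr \<alpha> * (x - a0 * t)) (\<epsilon> powr (\<alpha> + \<beta>) * t)))"

text \<open>The value of \<open>F\<close> at the point \<open>(x, t)\<close> whose Gardner--Morikawa variables are \<open>(\<xi>, \<tau>)\<close>.\<close>

definition at_gm ::
  "real \<Rightarrow> real \<Rightarrow> real \<Rightarrow> real \<Rightarrow> (real \<Rightarrow> real \<Rightarrow> real) \<Rightarrow> real \<Rightarrow> real \<Rightarrow> real" where
  "at_gm a0 \<alpha> \<beta> \<epsilon> F \<xi> \<tau> =
     F (\<xi> / \<epsilon> powr \<alpha> + a0 * (\<tau> / \<epsilon> powr (\<alpha> + \<beta>))) (\<tau> / \<epsilon> powr (\<alpha> + \<beta>))"

text \<open>The \<open>n\<close> lowest-order \<open>\<epsilon>\<close>-dependent terms of all five equations vanish when the first \<open>n\<close> terms of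
  the expansions are inserted. The lowest order is \<open>\<epsilon>\<^sup>q\<^sup>+\<^sup>\<alpha>\<close> in the two conservation laws, where every
  term contains a derivative, and \<open>\<epsilon>\<^sup>q\<close> in the other three; successive orders differ by the factor
  \<open>\<epsilon>\<^sup>k\<close>. Coefficients of powers of \<open>\<epsilon>\<close> are taken at fixed \<open>(\<xi>, \<tau>)\<close>.\<close>

definition lowest_orders_satisfied where
  "lowest_orders_satisfied \<gamma> X P0 T0 R0 \<alpha> \<beta> q k n \<Omega> \<rho> u P G R \<longleftrightarrow>
     (let a0 = wave_speed X P0 R0;
          \<rho>e = gm_expansion a0 \<alpha> \<beta> q k n (rho0 X R0) \<rho>;
          ue = gm_expansion a0 \<alpha> \<beta> q k n 0 u;
          Pe = gm_expansion a0 \<alpha> \<beta> q k n P0 P;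
          Ge = gm_expansion a0 \<alpha> \<beta> q k n P0 G;
          Re = gm_expansion a0 \<alpha> \<beta> q k n R0 R;
          vanish = (\<lambda>p F \<xi> \<tau>. (\<lambda>\<epsilon>. at_gm a0 \<alpha> \<beta> \<epsilon> (F \<epsilon>) \<xi> \<tau>)
                       \<in> o[at_right 0](\<lambda>\<epsilon>. \<epsilon> powr (p + (real n - 1) * k)))
      in \<forall>(\<xi>, \<tau>)\<in>\<Omega>.
           vanish (q + \<alpha>) (\<lambda>\<epsilon>. mass_residual (\<rho>e \<epsilon>) (ue \<epsilon>)) \<xi> \<tau> \<and>
           vanish (q + \<alpha>) (\<lambda>\<epsilon>. momentum_residual (\<rho>e \<epsilon>) (ue \<epsilon>) (Pe \<epsilon>)) \<xi> \<tau> \<and>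
           vanish q (\<lambda>\<epsilon>. pressure_residual (ue \<epsilon>) (Pe \<epsilon>) (Ge \<epsilon>) (Re \<epsilon>)) \<xi> \<tau> \<and>
           vanish q (\<lambda>\<epsilon>. gas_residual \<gamma> P0 T0 R0 (ue \<epsilon>) (Ge \<epsilon>) (Re \<epsilon>)) \<xi> \<tau> \<and>
           vanish q (\<lambda>\<epsilon>. density_residual X (\<rho>e \<epsilon>) (Re \<epsilon>)) \<xi> \<tau>)"

definition first_order_relations where
  "first_order_relations X P0 R0 \<Omega> \<rho> u P G R \<longleftrightarrow>
     (let a0 = wave_speed X P0 R0; \<rho>0 = rho0 X R0 in
      \<forall>(\<xi>, \<tau>)\<in>\<Omega>.
        pd1 (u (1::nat)) \<xi> \<tau> = a0 / \<rho>0 * pd1 (\<rho> (1::nat)) \<xi> \<tau> \<and>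
        P (1::nat) \<xi> \<tau> = G 1 \<xi> \<tau> \<and>
        G (1::nat) \<xi> \<tau> = - (3 * P0 / R0) * R 1 \<xi> \<tau> \<and>
        R (1::nat) \<xi> \<tau> = - ((R0 ^ 3 - X + 1)\<^sup>2 / (3 * R0\<^sup>2)) * \<rho> 1 \<xi> \<tau> \<and>
        pd1 (P 1) \<xi> \<tau> = \<rho>0 * a0 * pd1 (u 1) \<xi> \<tau>)"

definition second_order_relations where
  "second_order_relations X P0 T0 R0 \<Omega> \<rho> u P G R \<longleftrightarrow>
     (let a0 = wave_speed X P0 R0; \<rho>0 = rho0 X R0 in
      \<forall>(\<xi>, \<tau>)\<in>\<Omega>.
        pd1 (u (2::nat)) \<xi> \<tau> = a0 / \<rho>0 * pd1 (\<rho> (2::nat)) \<xi> \<tau> \<and>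
        P (2::nat) \<xi> \<tau> = G 2 \<xi> \<tau> + 4 * a0 / (3 * R0) * pd1 (R 1) \<xi> \<tau> \<and>
        G (2::nat) \<xi> \<tau> = - (3 * P0 / R0) * R 2 \<xi> \<tau> + a0 * P0\<^sup>2 / T0 * pd1 (R 1) \<xi> \<tau> \<and>
        R (2::nat) \<xi> \<tau> = - ((R0 ^ 3 - X + 1)\<^sup>2 / (3 * R0\<^sup>2)) * \<rho> 2 \<xi> \<tau>)"

text \<open>Inserting the relations into the next order of the two conservation laws and eliminating the third
  coefficients gives \<open>A f\<^sub>\<tau> + B f\<^sub>\<xi>\<^sub>\<xi>\<^sub>\<xi> + C f f\<^sub>\<xi> = 0\<close>, because \<open>\<xi> = \<epsilon>\<^sup>\<alpha> (x - a\<^sub>0 t)\<close> with \<open>a\<^sub>0 > 0\<close> follows a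
  right-going wave. In the orientation below this is \<open>kdv_solution (- A) B C\<close>;
  \<open>kdv_solution A B C\<close> has the opposite sign of the time derivative.\<close>

definition kdv_solution ::
  "real \<Rightarrow> real \<Rightarrow> real \<Rightarrow> (real \<times> real) set \<Rightarrow> (real \<Rightarrow> real \<Rightarrow> real) \<Rightarrow> bool" where
  "kdv_solution A B C \<Omega> f \<longleftrightarrow>
     (\<forall>(\<xi>, \<tau>)\<in>\<Omega>. A * pd2 f \<xi> \<tau> = B * pd1 (pd1 (pd1 f)) \<xi> \<tau> + C * f \<xi> \<tau> * pd1 f \<xi> \<tau>)"

end

theory Submission
  imports Defs
begin

text \<open>For these exponents everything is a power series in \<open>e = \<epsilon>\<^sup>k\<close>: the perturbations start at \<open>e\<^sup>2\<close>,
  \<open>\<partial>\<^sub>x = e \<partial>\<^sub>\<xi>\<close> and \<open>\<partial>\<^sub>t = e\<^sup>3 \<partial>\<^sub>\<tau> - a\<^sub>0 e \<partial>\<^sub>\<xi>\<close>. At a fixed point \<open>(\<xi>, \<tau>)\<close> each residual, after multiplication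
  by \<open>R\<close> where \<open>R\<close> occurs in a denominator, is therefore a polynomial in \<open>e\<close>, and it is \<open>o(e\<^sup>m)\<close> iff its
  coefficients up to order \<open>m\<close> vanish. The first two orders are equivalent to the stated relations; the
  viscous term of the momentum equation is consistent with them precisely because of the value of \<open>T\<^sub>0\<close>.
  At the third order the pressure, gas and density equations express \<open>P\<^sup>(\<^sup>3\<^sup>)\<close> through \<open>\<rho>\<^sup>(\<^sup>3\<^sup>)\<close>, \<open>\<rho>\<^sup>(\<^sup>2\<^sup>)\<^sub>\<xi>\<close>,
  \<open>\<rho>\<^sup>(\<^sup>1\<^sup>)\<^sub>\<xi>\<^sub>\<xi>\<close> and \<open>(\<rho>\<^sup>(\<^sup>1\<^sup>))\<^sup>2\<close>, and adding \<open>a\<^sub>0\<close> times the mass equation to the momentum equation eliminates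
  \<open>u\<^sup>(\<^sup>3\<^sup>)\<close>, \<open>\<rho>\<^sup>(\<^sup>3\<^sup>)\<close> and \<open>\<rho>\<^sup>(\<^sup>2\<^sup>)\<close>, which leaves a multiple of the KdV equation.\<close>

section \<open>Smooth functions of two variables\<close>

text \<open>The linear operator on the newest coefficients is the same at every order, and it is
  singular because \<open>a\<close> is the speed of linear waves. Once the pressure, gas and density
  equations express the newest \<open>P\<close> as \<open>a\<^sup>2\<close> times the newest \<rho>
  plus known terms, the momentum equation acts on the new unknowns as \<open>- a\<close> times the
  mass equation does. Weighting mass with \<open>a\<close> and momentum with 1 therefore removes the
  new unknowns and leaves a solvability condition on the earlier ones. At the second order this
  condition is a constant times the second \<xi>-derivative of the first density coefficient, and
  the value of \<open>T0\<close> makes the constant zero. At the third order it is the KdV equation;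
  there the same cancellation recurs and disposes of the second density coefficient. The condition
  is also sufficient, because the third density coefficient stays free and the others can then be
  written down explicitly.\<close>

lemma Ck_on_SucD:
  assumes "Ck_on (Suc n) \<Omega> f" and "(a, b) \<in> \<Omega>"
  shows "((\<lambda>s. f s b) has_field_derivative pd1 f a b) (at a)"
    and "((\<lambda>s. f a s) has_field_derivative pd2 f a b) (at b)"
  using assms by (auto simp: pd1_def pd2_def DERIV_deriv_iff_field_differentiable)

lemma smooth2_on_has_pd1:
  assumes "smooth2_on \<Omega> f" and "(a, b) \<in> \<Omega>"
  shows "((\<lambda>s. f s b) has_field_derivative pd1 f a b) (at a)"
  using Ck_on_SucD(1)[of 0] assms unfolding smooth2_on_def by blast

lemma smooth2_on_has_pd2:
  assumes "smooth2_on \<Omega> f" and "(a, b) \<in> \<Omega>"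
  shows "((\<lambda>s. f a s) has_field_derivative pd2 f a b) (at b)"
  using Ck_on_SucD(2)[of 0] assms unfolding smooth2_on_def by blast

lemma eventually_open_fst:
  assumes "open (\<Omega> :: (real \<times> real) set)" and "(a, b) \<in> \<Omega>"
  shows "\<forall>\<^sub>F s in nhds a. (s, b) \<in> \<Omega>"
proof -
  have "open ((\<lambda>s. (s, b)) -` \<Omega>)"
    using assms(1) by (intro open_vimage continuous_intros)
  then show ?thesis
    using eventually_nhds_in_open[of "(\<lambda>s. (s, b)) -` \<Omega>" a] assms(2) by simp
qed

lemma eventually_open_snd:
  assumes "open (\<Omega> :: (real \<times> real) set)" and "(a, b) \<in> \<Omega>"
  shows "\<forall>\<^sub>F s in nhds b. (a, s) \<in> \<Omega>"
proof -
  have "open ((\<lambda>s. (a, s)) -` \<Omega>)"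
    using assms(1) by (intro open_vimage continuous_intros)
  then show ?thesis
    using eventually_nhds_in_open[of "(\<lambda>s. (a, s)) -` \<Omega>" b] assms(2) by simp
qed

lemma pd1_cong_on:
  assumes "open \<Omega>" and "\<And>\<xi> \<tau>. (\<xi>, \<tau>) \<in> \<Omega> \<Longrightarrow> f \<xi> \<tau> = g \<xi> \<tau>" and "(a, b) \<in> \<Omega>"
  shows "pd1 f a b = pd1 g a b"
  unfolding pd1_def
  by (intro deriv_cong_ev refl eventually_mono[OF eventually_open_fst[OF assms(1,3)]]) (use assms(2) in auto)

lemma pd2_cong_on:
  assumes "open \<Omega>" and "\<And>\<xi> \<tau>. (\<xi>, \<tau>) \<in> \<Omega> \<Longrightarrow> f \<xi> \<tau> = g \<xi> \<tau>" and "(a, b) \<in> \<Omega>"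
  shows "pd2 f a b = pd2 g a b"
  unfolding pd2_def
  by (intro deriv_cong_ev refl eventually_mono[OF eventually_open_snd[OF assms(1,3)]]) (use assms(2) in auto)

text \<open>\<open>pd1\<close> and \<open>pd2\<close> are total functions with arbitrary values off
  \<Omega>. Openness keeps a neighbourhood of each point on both axes inside \<Omega>, so agreement
  on \<Omega> passes to the partial derivatives there, as the induction requires.\<close>

lemma Ck_on_cong:
  assumes "open \<Omega>" and "\<And>\<xi> \<tau>. (\<xi>, \<tau>) \<in> \<Omega> \<Longrightarrow> f \<xi> \<tau> = g \<xi> \<tau>" and "Ck_on n \<Omega> f"
  shows "Ck_on n \<Omega> g"
  using assms(2,3)
proof (induction n arbitrary: f g)
  case 0
  have "continuous_on \<Omega> (\<lambda>(a, b). f a b) = continuous_on \<Omega> (\<lambda>(a, b). g a b)"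
    by (rule continuous_on_cong) (use 0 in auto)
  with 0 show ?case by simp
next
  case (Suc n)
  have "continuous_on \<Omega> (\<lambda>(a, b). f a b) = continuous_on \<Omega> (\<lambda>(a, b). g a b)"
    by (rule continuous_on_cong) (use Suc.prems in auto)
  moreover have "(\<lambda>s. g s b) field_differentiable at a \<and> (\<lambda>s. g a s) field_differentiable at b"
    if "(a, b) \<in> \<Omega>" for a b
  proof -
    have "((\<lambda>s. g s b) has_field_derivative pd1 f a b) (at a)"
      using Ck_on_SucD(1)[OF Suc.prems(2) that]
      by (rule DERIV_cong_ev[THEN iffD1, rotated -1])
         (use eventually_open_fst[OF assms(1) that] Suc.prems(1) in \<open>auto elim!: eventually_mono\<close>)
    moreover have "((\<lambda>s. g a s) has_field_derivative pd2 f a b) (at b)"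
      using Ck_on_SucD(2)[OF Suc.prems(2) that]
      by (rule DERIV_cong_ev[THEN iffD1, rotated -1])
         (use eventually_open_snd[OF assms(1) that] Suc.prems(1) in \<open>auto elim!: eventually_mono\<close>)
    ultimately show ?thesis
      by (auto simp: field_differentiable_def)
  qed
  moreover have "Ck_on n \<Omega> (pd1 g)"
    by (rule Suc.IH[of "pd1 f"]) (use Suc.prems pd1_cong_on[OF assms(1), of f g] in auto)
  moreover have "Ck_on n \<Omega> (pd2 g)"
    by (rule Suc.IH[of "pd2 f"]) (use Suc.prems pd2_cong_on[OF assms(1), of f g] in auto)
  ultimately show ?case
    using Suc.prems(2) by auto
qed

lemma Ck_on_mono: "Ck_on n \<Omega> f \<Longrightarrow> m \<le> n \<Longrightarrow> Ck_on m \<Omega> f"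
proof (induction n arbitrary: m f)
  case (Suc n)
  then show ?case by (cases m) auto
qed simp

lemma Ck_on_const: "Ck_on n \<Omega> (\<lambda>_ _. c)"
proof (induction n arbitrary: c)
  case (Suc n)
  have "pd1 (\<lambda>_ _. c) = (\<lambda>_ _. 0)" "pd2 (\<lambda>_ _. c) = (\<lambda>_ _. 0)"
    by (auto simp: pd1_def pd2_def)
  with Suc show ?case by auto
qed simp

text \<open>Lets formulas that are correct only on \<Omega> stand in for \<open>pd1 f\<close> and
  \<open>pd2 f\<close>, so that closure under sums and products reduces to the usual differentiation
  rules.\<close>

lemma Ck_on_SucI:
  assumes "open \<Omega>" and "continuous_on \<Omega> (\<lambda>(a, b). f a b)"
    and "\<And>a b. (a, b) \<in> \<Omega> \<Longrightarrow> ((\<lambda>s. f s b) has_field_derivative f1 a b) (at a)"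
    and "\<And>a b. (a, b) \<in> \<Omega> \<Longrightarrow> ((\<lambda>s. f a s) has_field_derivative f2 a b) (at b)"
    and "Ck_on n \<Omega> f1" and "Ck_on n \<Omega> f2"
  shows "Ck_on (Suc n) \<Omega> f"
proof -
  have "Ck_on n \<Omega> (pd1 f)"
    by (rule Ck_on_cong[OF assms(1) _ assms(5)]) (simp add: pd1_def DERIV_imp_deriv[OF assms(3)])
  moreover have "Ck_on n \<Omega> (pd2 f)"
    by (rule Ck_on_cong[OF assms(1) _ assms(6)]) (simp add: pd2_def DERIV_imp_deriv[OF assms(4)])
  moreover have "(\<lambda>s. f s b) field_differentiable at a \<and> (\<lambda>s. f a s) field_differentiable at b"
    if "(a, b) \<in> \<Omega>" for a b
    unfolding field_differentiable_def by (intro conjI exI) (rule assms(3,4)[OF that])+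
  ultimately show ?thesis
    using assms(2) by auto
qed

lemma Ck_on_add:
  assumes "open \<Omega>"
  shows "Ck_on n \<Omega> f \<Longrightarrow> Ck_on n \<Omega> g \<Longrightarrow> Ck_on n \<Omega> (\<lambda>a b. f a b + g a b)"
proof (induction n arbitrary: f g)
  case 0
  then show ?case by (auto simp: case_prod_unfold intro!: continuous_intros)
next
  case (Suc n)
  show ?case
  proof (rule Ck_on_SucI[OF assms, where ?f1.0 = "\<lambda>a b. pd1 f a b + pd1 g a b"
        and ?f2.0 = "\<lambda>a b. pd2 f a b + pd2 g a b"])
    show "continuous_on \<Omega> (\<lambda>(a, b). f a b + g a b)"
      using Suc.prems by (auto simp: case_prod_unfold intro!: continuous_intros)
  qed (use Suc Ck_on_SucD[OF Suc.prems(1)] Ck_on_SucD[OF Suc.prems(2)]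
       in \<open>auto intro!: derivative_eq_intros\<close>)
qed

lemma Ck_on_mult:
  assumes "open \<Omega>"
  shows "Ck_on n \<Omega> f \<Longrightarrow> Ck_on n \<Omega> g \<Longrightarrow> Ck_on n \<Omega> (\<lambda>a b. f a b * g a b)"
proof (induction n arbitrary: f g)
  case 0
  then show ?case by (auto simp: case_prod_unfold intro!: continuous_intros)
next
  case (Suc n)
  \<comment> \<open>The product rule pairs differentiated with undifferentiated factors, so the
    factors themselves are needed at the lower order too.\<close>
  have "Ck_on n \<Omega> f" "Ck_on n \<Omega> g"
    using Ck_on_mono[OF Suc.prems(1), of n] Ck_on_mono[OF Suc.prems(2), of n] by simp_all
  moreover have "Ck_on n \<Omega> (pd1 f)" "Ck_on n \<Omega> (pd1 g)" "Ck_on n \<Omega> (pd2 f)" "Ck_on n \<Omega> (pd2 g)"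
    using Suc.prems by auto
  ultimately have "Ck_on n \<Omega> (\<lambda>a b. pd1 f a b * g a b + pd1 g a b * f a b)"
    "Ck_on n \<Omega> (\<lambda>a b. pd2 f a b * g a b + pd2 g a b * f a b)"
    by (auto intro!: Ck_on_add assms Suc.IH)
  then show ?case
    by (rule Ck_on_SucI[OF assms, rotated 3])
       (use Suc.prems Ck_on_SucD[OF Suc.prems(1)] Ck_on_SucD[OF Suc.prems(2)]
        in \<open>auto simp: case_prod_unfold intro!: derivative_eq_intros continuous_intros\<close>)
qed

lemma smooth2_on_const: "smooth2_on \<Omega> (\<lambda>_ _. c)"
  by (simp add: smooth2_on_def Ck_on_const)

lemma smooth2_on_add:
  "open \<Omega> \<Longrightarrow> smooth2_on \<Omega> f \<Longrightarrow> smooth2_on \<Omega> g \<Longrightarrow> smooth2_on \<Omega> (\<lambda>a b. f a b + g a b)"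
  by (simp add: smooth2_on_def Ck_on_add)

lemma smooth2_on_mult:
  "open \<Omega> \<Longrightarrow> smooth2_on \<Omega> f \<Longrightarrow> smooth2_on \<Omega> g \<Longrightarrow> smooth2_on \<Omega> (\<lambda>a b. f a b * g a b)"
  by (simp add: smooth2_on_def Ck_on_mult)

lemma smooth2_on_diff:
  "open \<Omega> \<Longrightarrow> smooth2_on \<Omega> f \<Longrightarrow> smooth2_on \<Omega> g \<Longrightarrow> smooth2_on \<Omega> (\<lambda>a b. f a b - g a b)"
  using smooth2_on_add[of \<Omega> f "\<lambda>a b. - 1 * g a b"] smooth2_on_mult[of \<Omega> "\<lambda>_ _. - 1" g]
  by (simp add: smooth2_on_const)

lemma smooth2_on_uminus:
  "open \<Omega> \<Longrightarrow> smooth2_on \<Omega> f \<Longrightarrow> smooth2_on \<Omega> (\<lambda>a b. - f a b)"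
  using smooth2_on_mult[of \<Omega> "\<lambda>_ _. - 1" f] by (simp add: smooth2_on_const)

lemma smooth2_on_sum:
  "open \<Omega> \<Longrightarrow> (\<And>j. j \<in> J \<Longrightarrow> smooth2_on \<Omega> (f j)) \<Longrightarrow> smooth2_on \<Omega> (\<lambda>a b. \<Sum>j\<in>J. f j a b)"
  by (induction J rule: infinite_finite_induct)
     (simp_all add: smooth2_on_const smooth2_on_add)

lemma smooth2_on_power:
  "open \<Omega> \<Longrightarrow> smooth2_on \<Omega> f \<Longrightarrow> smooth2_on \<Omega> (\<lambda>a b. f a b ^ n)"
  by (induction n) (simp_all add: smooth2_on_const smooth2_on_mult)

lemma smooth2_on_pd1: "smooth2_on \<Omega> f \<Longrightarrow> smooth2_on \<Omega> (pd1 f)"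
  unfolding smooth2_on_def by (metis Ck_on.simps(2))

lemma smooth2_on_pd2: "smooth2_on \<Omega> f \<Longrightarrow> smooth2_on \<Omega> (pd2 f)"
  unfolding smooth2_on_def by (metis Ck_on.simps(2))

lemmas smooth2_on_intros = smooth2_on_const smooth2_on_add smooth2_on_mult smooth2_on_diff
  smooth2_on_uminus smooth2_on_sum smooth2_on_power smooth2_on_pd1 smooth2_on_pd2

text \<open>Partial derivatives alone give no chain rule; continuity of \<open>pd2 f\<close>
  upgrades them to a total derivative.\<close>

lemma smooth2_on_has_derivative:
  assumes "open \<Omega>" and "smooth2_on \<Omega> f" and "(a, b) \<in> \<Omega>"
  shows "((\<lambda>(s, t). f s t) has_derivative (\<lambda>(s, t). pd1 f a b * s + pd2 f a b * t)) (at (a, b))"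
proof -
  obtain U V where UV: "open U" "open V" "a \<in> U" "b \<in> V" "U \<times> V \<subseteq> \<Omega>"
    using open_prod_elim[OF assms(1,3)] by (metis mem_Sigma_iff)
  \<comment> \<open>A ball is convex, as required of the set in which the second variable
    moves.\<close>
  obtain r where r: "r > 0" "ball b r \<subseteq> V"
    using UV(2,4) by (meson openE)
  let ?W = "ball b r"
  have sub: "U \<times> ?W \<subseteq> \<Omega>" using UV(5) r(2) by blast
  have nb: "(a, b) \<in> U \<times> ?W" "open (U \<times> ?W)" using UV r by (auto intro: open_Times)
  have "((\<lambda>(x, y). f x y) has_derivative
          (\<lambda>(s, t). pd1 f a b * s + blinfun_apply (blinfun_mult_right (pd2 f a b)) t))
          (at (a, b) within U \<times> ?W)"
  proof (rule has_derivative_partialsI)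
    show "((\<lambda>x. f x b) has_derivative (*) (pd1 f a b)) (at a within U)"
      using smooth2_on_has_pd1[OF assms(2,3)]
      by (auto simp: has_field_derivative_def intro: has_derivative_at_withinI)
    show "((\<lambda>y. f x y) has_derivative blinfun_apply (blinfun_mult_right (pd2 f x y))) (at y within ?W)"
      if "x \<in> U" "y \<in> ?W" for x y
    proof -
      have "(x, y) \<in> \<Omega>" using that sub by blast
      from smooth2_on_has_pd2[OF assms(2) this] show ?thesis
        by (auto simp: has_field_derivative_def intro: has_derivative_at_withinI)
    qed
    have "continuous_on \<Omega> (\<lambda>(x, y). pd2 f x y)"
      using smooth2_on_pd2[OF assms(2)] unfolding smooth2_on_def by (metis Ck_on.simps(1))
    then have "continuous (at (a, b)) (\<lambda>(x, y). pd2 f x y)"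
      using assms(1,3) continuous_on_eq_continuous_at by blast
    then have "continuous (at (a, b)) (\<lambda>z. blinfun_mult_right (case z of (x, y) \<Rightarrow> pd2 f x y))"
      by (rule bounded_linear.continuous[OF bounded_linear_blinfun_mult_right])
    then show "continuous (at (a, b) within U \<times> ?W) (\<lambda>(x, y). blinfun_mult_right (pd2 f x y))"
      by (simp add: case_prod_unfold continuous_at_imp_continuous_at_within)
  qed (use r in auto)
  then show ?thesis
    using at_within_open[OF nb] by simp
qed

text \<open>Needed because \<open>t\<close> enters both Gardner--Morikawa variables: a time
  derivative follows a curve on which both arguments of a coefficient change.\<close>

lemma smooth2_on_chain:
  assumes "open \<Omega>" and "smooth2_on \<Omega> f" and "(g s, h s) \<in> \<Omega>"
    and "(g has_field_derivative g') (at s)" and "(h has_field_derivative h') (at s)"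
  shows "((\<lambda>s. f (g s) (h s)) has_field_derivative pd1 f (g s) (h s) * g' + pd2 f (g s) (h s) * h') (at s)"
proof -
  have "((\<lambda>s. (g s, h s)) has_derivative (\<lambda>d. (g' * d, h' * d))) (at s)"
    using assms(4,5) by (auto simp: has_field_derivative_def intro!: has_derivative_Pair)
  from has_derivative_compose[OF this smooth2_on_has_derivative[OF assms(1-3)]]
  have "((\<lambda>s. f (g s) (h s)) has_derivative
      (\<lambda>d. pd1 f (g s) (h s) * (g' * d) + pd2 f (g s) (h s) * (h' * d))) (at s)"
    by simp
  moreover have "(\<lambda>d. pd1 f (g s) (h s) * (g' * d) + pd2 f (g s) (h s) * (h' * d))
      = (*) (pd1 f (g s) (h s) * g' + pd2 f (g s) (h s) * h')"
    by (auto simp: algebra_simps)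
  ultimately show ?thesis
    unfolding has_field_derivative_def by simp
qed

section \<open>Expansions in the small parameter\<close>

text \<open>The argument \<open>e\<close> of \<open>F\<close> is \<open>\<epsilon>\<^sup>k\<close>; then \<open>(e (x - a t), e\<^sup>3 t)\<close> are the Gardner--Morikawa variables.\<close>

definition expands ::
  "(real \<times> real) set \<Rightarrow> real \<Rightarrow> (real \<Rightarrow> real \<Rightarrow> real \<Rightarrow> real) \<Rightarrow> (nat \<Rightarrow> real \<Rightarrow> real \<Rightarrow> real) \<Rightarrow> bool"
  where
  "expands \<Omega> a F c \<longleftrightarrow>
     (\<forall>i. smooth2_on \<Omega> (c i)) \<and>
     (\<exists>N. (\<forall>i>N. c i = (\<lambda>_ _. 0)) \<and>
        (\<forall>e>0. \<forall>x t. (e * (x - a * t), e ^ 3 * t) \<in> \<Omega> \<longrightarrow>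
           F e x t = (\<Sum>i\<le>N. c i (e * (x - a * t)) (e ^ 3 * t) * e ^ i)))"

text \<open>Multiplication of a series by \<open>e ^ m\<close>. A \<xi>-derivative brings one factor
  \<open>e\<close> and a \<tau>-derivative three, so derivatives act on coefficient sequences as a
  partial derivative followed by a shift.\<close>

definition shift_coeffs :: "nat \<Rightarrow> (nat \<Rightarrow> real \<Rightarrow> real \<Rightarrow> real) \<Rightarrow> nat \<Rightarrow> real \<Rightarrow> real \<Rightarrow> real" where
  "shift_coeffs m c i = (if i < m then (\<lambda>_ _. 0) else c (i - m))"

definition cauchy_coeffs ::
  "(nat \<Rightarrow> real \<Rightarrow> real \<Rightarrow> real) \<Rightarrow> (nat \<Rightarrow> real \<Rightarrow> real \<Rightarrow> real) \<Rightarrow> nat \<Rightarrow> real \<Rightarrow> real \<Rightarrow> real" where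
  "cauchy_coeffs c d i = (\<lambda>\<xi> \<tau>. \<Sum>j\<le>i. c j \<xi> \<tau> * d (i - j) \<xi> \<tau>)"

definition const_coeffs :: "real \<Rightarrow> nat \<Rightarrow> real \<Rightarrow> real \<Rightarrow> real" where
  "const_coeffs r i = (\<lambda>_ _. if i = 0 then r else 0)"

definition dx_coeffs :: "(nat \<Rightarrow> real \<Rightarrow> real \<Rightarrow> real) \<Rightarrow> nat \<Rightarrow> real \<Rightarrow> real \<Rightarrow> real" where
  "dx_coeffs c = shift_coeffs 1 (\<lambda>i. pd1 (c i))"

definition dt_coeffs :: "real \<Rightarrow> (nat \<Rightarrow> real \<Rightarrow> real \<Rightarrow> real) \<Rightarrow> nat \<Rightarrow> real \<Rightarrow> real \<Rightarrow> real" where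
  "dt_coeffs a c i = (\<lambda>\<xi> \<tau>. shift_coeffs 3 (\<lambda>i. pd2 (c i)) i \<xi> \<tau> - a * dx_coeffs c i \<xi> \<tau>)"

definition mat_coeffs where
  "mat_coeffs a u c i = (\<lambda>\<xi> \<tau>. dt_coeffs a c i \<xi> \<tau> + cauchy_coeffs u (dx_coeffs c) i \<xi> \<tau>)"

text \<open>Since q = 2k, perturbation number \<open>j\<close> carries \<open>e ^ (j + 1)\<close>:
  index 1 is empty and a later index \<open>i\<close> holds \<open>f (i - 1)\<close>.\<close>

definition field_coeffs :: "nat \<Rightarrow> real \<Rightarrow> (nat \<Rightarrow> real \<Rightarrow> real \<Rightarrow> real) \<Rightarrow> nat \<Rightarrow> real \<Rightarrow> real \<Rightarrow> real" where
  "field_coeffs N f0 f i =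
     (if i = 0 then (\<lambda>_ _. f0) else if i = 1 \<or> i > Suc N then (\<lambda>_ _. 0) else f (i - 1))"

lemma expandsI:
  assumes "\<And>i. smooth2_on \<Omega> (c i)" and "\<And>i. i > N \<Longrightarrow> c i = (\<lambda>_ _. 0)"
    and "\<And>e x t. e > 0 \<Longrightarrow> (e * (x - a * t), e ^ 3 * t) \<in> \<Omega> \<Longrightarrow>
           F e x t = (\<Sum>i\<le>N. c i (e * (x - a * t)) (e ^ 3 * t) * e ^ i)"
  shows "expands \<Omega> a F c"
  unfolding expands_def
  by (intro conjI allI impI exI[of _ N]) (rule assms; assumption)+

text \<open>The cutoff \<open>M\<close> is free from \<open>N\<close> on, because two expansions
  must be brought to a common length before they are added.\<close>

lemma expandsE:
  assumes "expands \<Omega> a F c"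
  obtains N where "\<And>i. i > N \<Longrightarrow> c i = (\<lambda>_ _. 0)"
    and "\<And>e x t M. e > 0 \<Longrightarrow> (e * (x - a * t), e ^ 3 * t) \<in> \<Omega> \<Longrightarrow> M \<ge> N \<Longrightarrow>
           F e x t = (\<Sum>i\<le>M. c i (e * (x - a * t)) (e ^ 3 * t) * e ^ i)"
proof -
  from assms obtain N where z: "\<forall>i>N. c i = (\<lambda>_ _. 0)"
    and eq: "\<forall>e>0. \<forall>x t. (e * (x - a * t), e ^ 3 * t) \<in> \<Omega> \<longrightarrow>
       F e x t = (\<Sum>i\<le>N. c i (e * (x - a * t)) (e ^ 3 * t) * e ^ i)"
    unfolding expands_def by (elim conjE exE)
  show ?thesis
  proof (rule that[of N])
    fix e x t :: real and M
    assume "e > 0" "(e * (x - a * t), e ^ 3 * t) \<in> \<Omega>" and M: "M \<ge> N"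
    then have "F e x t = (\<Sum>i\<le>N. c i (e * (x - a * t)) (e ^ 3 * t) * e ^ i)"
      using eq by simp
    also have "\<dots> = (\<Sum>i\<le>M. c i (e * (x - a * t)) (e ^ 3 * t) * e ^ i)"
      by (rule sum.mono_neutral_left) (use M z in auto)
    finally show "F e x t = (\<Sum>i\<le>M. c i (e * (x - a * t)) (e ^ 3 * t) * e ^ i)" .
  qed (use z in simp)
qed

lemma expands_smooth: "expands \<Omega> a F c \<Longrightarrow> smooth2_on \<Omega> (c i)"
  by (simp add: expands_def)

lemma expands_const: "expands \<Omega> a (\<lambda>_ _ _. r) (const_coeffs r)"
  by (rule expandsI[where N = 0]) (auto simp: const_coeffs_def smooth2_on_const)

lemma expands_add:
  assumes "open \<Omega>" and F: "expands \<Omega> a F c" and G: "expands \<Omega> a G d"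
  shows "expands \<Omega> a (\<lambda>e x t. F e x t + G e x t) (\<lambda>i \<xi> \<tau>. c i \<xi> \<tau> + d i \<xi> \<tau>)"
proof -
  obtain N where N: "\<And>i. i > N \<Longrightarrow> c i = (\<lambda>_ _. 0)"
    "\<And>e x t M. e > 0 \<Longrightarrow> (e * (x - a * t), e ^ 3 * t) \<in> \<Omega> \<Longrightarrow> M \<ge> N \<Longrightarrow>
           F e x t = (\<Sum>i\<le>M. c i (e * (x - a * t)) (e ^ 3 * t) * e ^ i)"
    using F by (rule expandsE) blast
  obtain K where K: "\<And>i. i > K \<Longrightarrow> d i = (\<lambda>_ _. 0)"
    "\<And>e x t M. e > 0 \<Longrightarrow> (e * (x - a * t), e ^ 3 * t) \<in> \<Omega> \<Longrightarrow> M \<ge> K \<Longrightarrow>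
           G e x t = (\<Sum>i\<le>M. d i (e * (x - a * t)) (e ^ 3 * t) * e ^ i)"
    using G by (rule expandsE) blast
  show ?thesis
  proof (rule expandsI[where N = "max N K"])
    show "smooth2_on \<Omega> (\<lambda>\<xi> \<tau>. c i \<xi> \<tau> + d i \<xi> \<tau>)" for i
      by (intro smooth2_on_add assms(1) expands_smooth[OF F] expands_smooth[OF G])
    show "F e x t + G e x t = (\<Sum>i\<le>max N K. (c i (e * (x - a * t)) (e ^ 3 * t)
            + d i (e * (x - a * t)) (e ^ 3 * t)) * e ^ i)"
      if "e > 0" "(e * (x - a * t), e ^ 3 * t) \<in> \<Omega>" for e x t
      using N(2)[OF that, of "max N K"] K(2)[OF that, of "max N K"]
      by (simp add: sum.distrib distrib_right)
  qed (use N(1) K(1) in auto)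
qed

lemma expands_mult:
  assumes "open \<Omega>" and F: "expands \<Omega> a F c" and G: "expands \<Omega> a G d"
  shows "expands \<Omega> a (\<lambda>e x t. F e x t * G e x t) (cauchy_coeffs c d)"
proof -
  obtain N where N: "\<And>i. i > N \<Longrightarrow> c i = (\<lambda>_ _. 0)"
    "\<And>e x t M. e > 0 \<Longrightarrow> (e * (x - a * t), e ^ 3 * t) \<in> \<Omega> \<Longrightarrow> M \<ge> N \<Longrightarrow>
           F e x t = (\<Sum>i\<le>M. c i (e * (x - a * t)) (e ^ 3 * t) * e ^ i)"
    using F by (rule expandsE) blast
  obtain K where K: "\<And>i. i > K \<Longrightarrow> d i = (\<lambda>_ _. 0)"
    "\<And>e x t M. e > 0 \<Longrightarrow> (e * (x - a * t), e ^ 3 * t) \<in> \<Omega> \<Longrightarrow> M \<ge> K \<Longrightarrow>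
           G e x t = (\<Sum>i\<le>M. d i (e * (x - a * t)) (e ^ 3 * t) * e ^ i)"
    using G by (rule expandsE) blast
  show ?thesis
  proof (rule expandsI[where N = "N + K"])
    show "smooth2_on \<Omega> (cauchy_coeffs c d i)" for i
      unfolding cauchy_coeffs_def
      by (intro smooth2_on_sum smooth2_on_mult assms(1) expands_smooth[OF F] expands_smooth[OF G])
    show "cauchy_coeffs c d i = (\<lambda>_ _. 0)" if "i > N + K" for i
    proof -
      have "c j = (\<lambda>_ _. 0) \<or> d (i - j) = (\<lambda>_ _. 0)" for j
        using that N(1)[of j] K(1)[of "i - j"] by linarith
      then have z: "c j \<xi> \<tau> * d (i - j) \<xi> \<tau> = 0" for j \<xi> \<tau>
        by (metis mult_eq_0_iff)
      show ?thesis
        unfolding cauchy_coeffs_def by (intro ext sum.neutral ballI z)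
    qed
    show "F e x t * G e x t
        = (\<Sum>i\<le>N + K. cauchy_coeffs c d i (e * (x - a * t)) (e ^ 3 * t) * e ^ i)"
      if "e > 0" "(e * (x - a * t), e ^ 3 * t) \<in> \<Omega>" for e x t
      unfolding N(2)[OF that order_refl] K(2)[OF that order_refl] cauchy_coeffs_def
      by (rule polynomial_product) (use N(1) K(1) in auto)
  qed
qed

lemma expands_cmult:
  assumes "open \<Omega>" and F: "expands \<Omega> a F c"
  shows "expands \<Omega> a (\<lambda>e x t. r * F e x t) (\<lambda>i \<xi> \<tau>. r * c i \<xi> \<tau>)"
proof -
  obtain N where N: "\<And>i. i > N \<Longrightarrow> c i = (\<lambda>_ _. 0)"
    "\<And>e x t M. e > 0 \<Longrightarrow> (e * (x - a * t), e ^ 3 * t) \<in> \<Omega> \<Longrightarrow> M \<ge> N \<Longrightarrow>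
           F e x t = (\<Sum>i\<le>M. c i (e * (x - a * t)) (e ^ 3 * t) * e ^ i)"
    using F by (rule expandsE) blast
  show ?thesis
  proof (rule expandsI[where N = N])
    show "smooth2_on \<Omega> (\<lambda>\<xi> \<tau>. r * c i \<xi> \<tau>)" for i
      by (intro smooth2_on_mult smooth2_on_const assms(1) expands_smooth[OF F])
    show "r * F e x t = (\<Sum>i\<le>N. r * c i (e * (x - a * t)) (e ^ 3 * t) * e ^ i)"
      if "e > 0" "(e * (x - a * t), e ^ 3 * t) \<in> \<Omega>" for e x t
      unfolding N(2)[OF that order_refl] by (simp add: sum_distrib_left mult.assoc)
  qed (use N(1) in simp)
qed

lemma expands_diff:
  assumes "open \<Omega>" and "expands \<Omega> a F c" and "expands \<Omega> a G d"
  shows "expands \<Omega> a (\<lambda>e x t. F e x t - G e x t) (\<lambda>i \<xi> \<tau>. c i \<xi> \<tau> - d i \<xi> \<tau>)"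
  using expands_add[OF assms(1,2) expands_cmult[OF assms(1,3), of "- 1"]] by simp

lemma sum_shift_coeffs:
  "(\<Sum>i\<le>N + m. shift_coeffs m c i \<xi> \<tau> * e ^ i) = e ^ m * (\<Sum>i\<le>N. c i \<xi> \<tau> * e ^ i)"
proof -
  have "(\<Sum>i\<le>N + m. shift_coeffs m c i \<xi> \<tau> * e ^ i) = (\<Sum>i = 0 + m..N + m. shift_coeffs m c i \<xi> \<tau> * e ^ i)"
    by (rule sum.mono_neutral_right) (auto simp: shift_coeffs_def)
  also have "\<dots> = (\<Sum>i\<le>N. shift_coeffs m c (i + m) \<xi> \<tau> * e ^ (i + m))"
    unfolding sum.shift_bounds_cl_nat_ivl by (simp add: atLeast0AtMost)
  finally show ?thesis
    by (simp add: shift_coeffs_def power_add sum_distrib_left mult_ac)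
qed

lemma pd1_const [simp]: "pd1 (\<lambda>_ _. r) = (\<lambda>_ _. 0)"
  by (auto simp: pd1_def)

lemma pd2_const [simp]: "pd2 (\<lambda>_ _. r) = (\<lambda>_ _. 0)"
  by (auto simp: pd2_def)

text \<open>The preimage of \<open>\<Omega>\<close> in the physical \<open>(x, t)\<close> plane is open, so derivatives only see the
  region where the expansion holds.\<close>

lemma eventually_gm_preimage:
  fixes g h :: "real \<Rightarrow> real"
  assumes "open (\<Omega> :: (real \<times> real) set)" and "continuous_on UNIV g" and "continuous_on UNIV h"
    and "(g s, h s) \<in> \<Omega>"
  shows "\<forall>\<^sub>F s in nhds s. (g s, h s) \<in> \<Omega>"
proof -
  have "open ((\<lambda>s. (g s, h s)) -` \<Omega>)"
    using assms(1-3) by (intro open_vimage continuous_intros) auto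
  then show ?thesis
    using eventually_nhds_in_open[of "(\<lambda>s. (g s, h s)) -` \<Omega>" s] assms(4) by simp
qed

lemma expands_pd1:
  assumes "open \<Omega>" and F: "expands \<Omega> a F c"
  shows "expands \<Omega> a (\<lambda>e. pd1 (F e)) (dx_coeffs c)"
proof -
  obtain N where N: "\<And>i. i > N \<Longrightarrow> c i = (\<lambda>_ _. 0)"
    "\<And>e x t M. e > 0 \<Longrightarrow> (e * (x - a * t), e ^ 3 * t) \<in> \<Omega> \<Longrightarrow> M \<ge> N \<Longrightarrow>
           F e x t = (\<Sum>i\<le>M. c i (e * (x - a * t)) (e ^ 3 * t) * e ^ i)"
    using F by (rule expandsE) blast
  note sm = expands_smooth[OF F]
  show ?thesis
  proof (rule expandsI[where N = "N + 1"])
    show "smooth2_on \<Omega> (dx_coeffs c i)" for i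
      by (auto simp: dx_coeffs_def shift_coeffs_def intro!: smooth2_on_intros sm)
    show "dx_coeffs c i = (\<lambda>_ _. 0)" if "i > N + 1" for i
      using that N(1)[of "i - 1"] by (auto simp: dx_coeffs_def shift_coeffs_def)
    show "pd1 (F e) x t = (\<Sum>i\<le>N + 1. dx_coeffs c i (e * (x - a * t)) (e ^ 3 * t) * e ^ i)"
      if e: "e > 0" and mem: "(e * (x - a * t), e ^ 3 * t) \<in> \<Omega>" for e x t
    proof -
      have ev: "\<forall>\<^sub>F s in nhds x. (e * (s - a * t), e ^ 3 * t) \<in> \<Omega>"
        by (rule eventually_gm_preimage) (use assms(1) mem in \<open>auto intro!: continuous_intros\<close>)
      have "((\<lambda>s. \<Sum>i\<le>N. c i (e * (s - a * t)) (e ^ 3 * t) * e ^ i) has_field_derivative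
              (\<Sum>i\<le>N. (pd1 (c i) (e * (x - a * t)) (e ^ 3 * t) * e
                         + pd2 (c i) (e * (x - a * t)) (e ^ 3 * t) * 0) * e ^ i)) (at x)"
        by (intro DERIV_sum DERIV_cmult_right smooth2_on_chain[OF assms(1) sm, where g = "\<lambda>s. e * (s - a * t)"] mem)
           (auto intro!: derivative_eq_intros)
      also have "?this \<longleftrightarrow> ((\<lambda>s. F e s t) has_field_derivative
              (\<Sum>i\<le>N. (pd1 (c i) (e * (x - a * t)) (e ^ 3 * t) * e
                         + pd2 (c i) (e * (x - a * t)) (e ^ 3 * t) * 0) * e ^ i)) (at x)"
        by (intro DERIV_cong_ev refl eventually_mono[OF ev]) (use N(2)[OF e, of _ t N] in auto)
      finally show ?thesis
        unfolding dx_coeffs_def sum_shift_coeffs pd1_def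
        by (auto dest!: DERIV_imp_deriv simp: sum_distrib_left mult_ac)
    qed
  qed
qed

lemma expands_pd2:
  assumes "open \<Omega>" and F: "expands \<Omega> a F c"
  shows "expands \<Omega> a (\<lambda>e. pd2 (F e)) (dt_coeffs a c)"
proof -
  obtain N where N: "\<And>i. i > N \<Longrightarrow> c i = (\<lambda>_ _. 0)"
    "\<And>e x t M. e > 0 \<Longrightarrow> (e * (x - a * t), e ^ 3 * t) \<in> \<Omega> \<Longrightarrow> M \<ge> N \<Longrightarrow>
           F e x t = (\<Sum>i\<le>M. c i (e * (x - a * t)) (e ^ 3 * t) * e ^ i)"
    using F by (rule expandsE) blast
  note sm = expands_smooth[OF F]
  show ?thesis
  proof (rule expandsI[where N = "N + 3"])
    show "smooth2_on \<Omega> (dt_coeffs a c i)" for i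
      by (auto simp: dt_coeffs_def dx_coeffs_def shift_coeffs_def
               intro!: smooth2_on_intros sm assms(1))
    show "dt_coeffs a c i = (\<lambda>_ _. 0)" if "i > N + 3" for i
      using that N(1)[of "i - 1"] N(1)[of "i - 3"]
      by (auto simp: dt_coeffs_def dx_coeffs_def shift_coeffs_def)
    show "pd2 (F e) x t = (\<Sum>i\<le>N + 3. dt_coeffs a c i (e * (x - a * t)) (e ^ 3 * t) * e ^ i)"
      if e: "e > 0" and mem: "(e * (x - a * t), e ^ 3 * t) \<in> \<Omega>" for e x t
    proof -
      let ?D = "\<Sum>i\<le>N. (pd1 (c i) (e * (x - a * t)) (e ^ 3 * t) * (- a * e)
                         + pd2 (c i) (e * (x - a * t)) (e ^ 3 * t) * e ^ 3) * e ^ i"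
      have ev: "\<forall>\<^sub>F s in nhds t. (e * (x - a * s), e ^ 3 * s) \<in> \<Omega>"
        by (rule eventually_gm_preimage) (use assms(1) mem in \<open>auto intro!: continuous_intros\<close>)
      have "((\<lambda>s. \<Sum>i\<le>N. c i (e * (x - a * s)) (e ^ 3 * s) * e ^ i) has_field_derivative ?D) (at t)"
        by (intro DERIV_sum DERIV_cmult_right smooth2_on_chain[OF assms(1) sm,
              where g = "\<lambda>s. e * (x - a * s)" and h = "\<lambda>s. e ^ 3 * s"] mem)
           (auto intro!: derivative_eq_intros)
      also have "?this \<longleftrightarrow> ((\<lambda>s. F e x s) has_field_derivative ?D) (at t)"
        by (intro DERIV_cong_ev refl eventually_mono[OF ev]) (use N(2)[OF e, of x _ N] in auto)
      finally have "pd2 (F e) x t = ?D"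
        by (auto dest!: DERIV_imp_deriv simp: pd2_def)
      also have "\<dots> = e ^ 3 * (\<Sum>i\<le>N. pd2 (c i) (e * (x - a * t)) (e ^ 3 * t) * e ^ i)
          - a * (e ^ 1 * (\<Sum>i\<le>N. pd1 (c i) (e * (x - a * t)) (e ^ 3 * t) * e ^ i))"
        unfolding sum_distrib_left sum_subtractf[symmetric]
        by (rule sum.cong) (simp_all add: algebra_simps)
      \<comment> \<open>Two vanishing terms are appended so that the sum shifted by 1 ends at
        \<open>N + 3\<close>, like the one shifted by 3.\<close>
      also have "(\<Sum>i\<le>N. pd1 (c i) (e * (x - a * t)) (e ^ 3 * t) * e ^ i)
          = (\<Sum>i\<le>N + 2. pd1 (c i) (e * (x - a * t)) (e ^ 3 * t) * e ^ i)"
        by (rule sum.mono_neutral_left) (use N(1) in auto)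
      finally have "pd2 (F e) x t = (\<Sum>i\<le>N + 3. shift_coeffs 3 (\<lambda>i. pd2 (c i)) i (e * (x - a * t)) (e ^ 3 * t) * e ^ i)
          - a * (\<Sum>i\<le>N + 2 + 1. dx_coeffs c i (e * (x - a * t)) (e ^ 3 * t) * e ^ i)"
        unfolding dx_coeffs_def sum_shift_coeffs .
      also have "N + 2 + 1 = N + 3"
        by simp
      finally show ?thesis
        unfolding dt_coeffs_def left_diff_distrib sum_subtractf sum_distrib_left mult.assoc .
    qed
  qed
qed

lemma expands_mat_deriv:
  assumes "open \<Omega>" and "expands \<Omega> a U u" and "expands \<Omega> a F c"
  shows "expands \<Omega> a (\<lambda>e. mat_deriv (U e) (F e)) (mat_coeffs a u c)"
  unfolding mat_deriv_def mat_coeffs_def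
  by (intro expands_add expands_mult expands_pd1 expands_pd2 assms)

lemma expands_field:
  assumes "\<And>j. j \<in> {1..N} \<Longrightarrow> smooth2_on \<Omega> (f j)"
  shows "expands \<Omega> a
    (\<lambda>e x t. f0 + (\<Sum>j = 1..N. e ^ (j + 1) * f j (e * (x - a * t)) (e ^ 3 * t)))
    (field_coeffs N f0 f)"
proof (rule expandsI[where N = "Suc N"])
  show "smooth2_on \<Omega> (field_coeffs N f0 f i)" for i
  proof (cases "i = 0 \<or> i = 1 \<or> i > Suc N")
    case False
    then have "i - 1 \<in> {1..N}" by auto
    with False assms show ?thesis by (simp add: field_coeffs_def)
  qed (auto simp: field_coeffs_def smooth2_on_const)
next
  fix e x t :: real
  have "(\<Sum>i\<le>N. field_coeffs N f0 f (Suc i) \<xi> \<tau> * e ^ Suc i)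
      = (\<Sum>i = 1..N. e ^ (i + 1) * f i \<xi> \<tau>)" for \<xi> \<tau>
    by (rule sum.mono_neutral_cong_right) (auto simp: field_coeffs_def)
  then show "f0 + (\<Sum>j = 1..N. e ^ (j + 1) * f j (e * (x - a * t)) (e ^ 3 * t))
      = (\<Sum>i\<le>Suc N. field_coeffs N f0 f i (e * (x - a * t)) (e ^ 3 * t) * e ^ i)"
    by (subst sum.atMost_Suc_shift) (simp add: field_coeffs_def)
qed (auto simp: field_coeffs_def)

section \<open>Little-o conditions at a fixed point as vanishing coefficients\<close>

lemma expands_at:
  assumes "expands \<Omega> a F c" and "(\<xi>, \<tau>) \<in> \<Omega>"
  obtains N where "\<And>i. i > N \<Longrightarrow> c i \<xi> \<tau> = 0"
    and "\<And>e. e > 0 \<Longrightarrow> F e (\<xi> / e + a * (\<tau> / e ^ 3)) (\<tau> / e ^ 3) = (\<Sum>i\<le>N. c i \<xi> \<tau> * e ^ i)"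
proof -
  obtain N where N: "\<And>i. i > N \<Longrightarrow> c i = (\<lambda>_ _. 0)"
    "\<And>e x t M. e > 0 \<Longrightarrow> (e * (x - a * t), e ^ 3 * t) \<in> \<Omega> \<Longrightarrow> M \<ge> N \<Longrightarrow>
           F e x t = (\<Sum>i\<le>M. c i (e * (x - a * t)) (e ^ 3 * t) * e ^ i)"
    using assms(1) by (rule expandsE) blast
  show ?thesis
  proof (rule that[of N])
    \<comment> \<open>This physical point has the same Gardner--Morikawa variables for every
      \<open>e\<close>, so the coefficients stay fixed while \<open>e\<close> varies and a genuine
      polynomial in \<open>e\<close> results.\<close>
    show "F e (\<xi> / e + a * (\<tau> / e ^ 3)) (\<tau> / e ^ 3) = (\<Sum>i\<le>N. c i \<xi> \<tau> * e ^ i)" if "e > 0" for e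
      using N(2)[of e "\<xi> / e + a * (\<tau> / e ^ 3)" "\<tau> / e ^ 3" N] that assms(2) by simp
  qed (use N(1) in auto)
qed

text \<open>Powers above \<open>m\<close> are negligible, which gives one direction. For the other,
  strong induction isolates a coefficient: the earlier ones vanish and the later terms are
  negligible, so \<open>c i * h x ^ i\<close> is little-o of \<open>h x ^ i\<close>, which a nonzero
  \<open>c i\<close> forbids because \<open>h\<close> is eventually nonzero.\<close>

lemma poly_sum_smallo_iff:
  fixes c :: "nat \<Rightarrow> real" and h :: "'a \<Rightarrow> real"
  assumes "(h \<longlongrightarrow> 0) F" and "\<forall>\<^sub>F x in F. h x > 0" and "F \<noteq> bot" and "\<And>i. i > N \<Longrightarrow> c i = 0"
  shows "(\<lambda>x. \<Sum>i\<le>N. c i * h x ^ i) \<in> o[F](\<lambda>x. h x ^ m) \<longleftrightarrow> (\<forall>i\<le>m. c i = 0)"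
proof
  have h0: "\<forall>\<^sub>F x in F. h x \<noteq> 0"
    using assms(2) by eventually_elim simp
  have pow: "(\<lambda>x. h x ^ i) \<in> o[F](\<lambda>x. h x ^ j)" if "i > j" for i j
  proof (rule smalloI_tendsto)
    have "((\<lambda>x. h x ^ (i - j)) \<longlongrightarrow> 0) F"
      using that by (intro tendsto_null_power assms(1)) simp
    then show "((\<lambda>x. h x ^ i / h x ^ j) \<longlongrightarrow> 0) F"
      by (rule Lim_transform_eventually) (use h0 in eventually_elim, use that in \<open>simp add: power_diff\<close>)
    show "\<forall>\<^sub>F x in F. h x ^ j \<noteq> 0"
      using h0 by eventually_elim simp
  qed
  {
    assume c: "\<forall>i\<le>m. c i = 0"
    show "(\<lambda>x. \<Sum>i\<le>N. c i * h x ^ i) \<in> o[F](\<lambda>x. h x ^ m)"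
    proof (rule big_sum_in_smallo)
      show "(\<lambda>x. c i * h x ^ i) \<in> o[F](\<lambda>x. h x ^ m)" for i
        using c pow[of m i] by (cases "i \<le> m") auto
    qed
  next
    assume o: "(\<lambda>x. \<Sum>i\<le>N. c i * h x ^ i) \<in> o[F](\<lambda>x. h x ^ m)"
    have "c i = 0" if "i \<le> m" for i
      using that
    proof (induction i rule: less_induct)
      case (less i)
      have "(\<lambda>x. h x ^ m) \<in> O[F](\<lambda>x. h x ^ i)"
        using pow[of i m] less.prems by (cases "i = m") (auto intro: landau_o.small_imp_big)
      with o have oi: "(\<lambda>x. \<Sum>j\<le>N. c j * h x ^ j) \<in> o[F](\<lambda>x. h x ^ i)"
        by (rule landau_o.small_big_trans)
      have "(\<lambda>x. \<Sum>j\<in>{..N} - {i}. c j * h x ^ j) \<in> o[F](\<lambda>x. h x ^ i)"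
      proof (rule big_sum_in_smallo)
        show "(\<lambda>x. c j * h x ^ j) \<in> o[F](\<lambda>x. h x ^ i)" if "j \<in> {..N} - {i}" for j
          using less.IH[of j] less.prems pow[of i j] that by (cases "j < i") auto
      qed
      with oi have "(\<lambda>x. (\<Sum>j\<le>N. c j * h x ^ j) - (\<Sum>j\<in>{..N} - {i}. c j * h x ^ j)) \<in> o[F](\<lambda>x. h x ^ i)"
        by (rule sum_in_smallo)
      also have "(\<lambda>x. (\<Sum>j\<le>N. c j * h x ^ j) - (\<Sum>j\<in>{..N} - {i}. c j * h x ^ j)) = (\<lambda>x. c i * h x ^ i)"
        using assms(4)[of i] by (cases "i \<le> N") (auto simp: sum.remove[of _ i])
      finally have ci: "(\<lambda>x. c i * h x ^ i) \<in> o[F](\<lambda>x. h x ^ i)" .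
      show "c i = 0"
      proof (rule ccontr)
        assume "c i \<noteq> 0"
        with ci have "(\<lambda>x. h x ^ i) \<in> o[F](\<lambda>x. h x ^ i)"
          by simp
        then have "\<forall>\<^sub>F x in F. h x ^ i = 0"
          by (simp add: landau_o.small_refl_iff)
        with h0 have "\<forall>\<^sub>F x in F. False"
          by eventually_elim simp
        then show False
          using assms(3) by (simp add: eventually_False)
      qed
    qed
    then show "\<forall>i\<le>m. c i = 0" by blast
  }
qed

lemma powr_k_tendsto_0:
  fixes k :: real
  assumes "k > 0"
  shows "((\<lambda>\<epsilon>::real. \<epsilon> powr k) \<longlongrightarrow> 0) (at_right 0)"
proof (rule tendsto_zero_powrI)
  show "\<forall>\<^sub>F \<epsilon> in at_right 0. (0::real) \<le> \<epsilon>"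
    using eventually_at_right_less[of "0::real"] by eventually_elim simp
qed (use assms in auto)

lemma eventually_powr_gt_0: "\<forall>\<^sub>F \<epsilon> in at_right (0::real). \<epsilon> powr k > 0"
  using eventually_at_right_less[of 0] by eventually_elim simp

lemma powr_gm:
  assumes "\<epsilon> > (0::real)"
  shows "\<epsilon> powr (real m * k) = (\<epsilon> powr k) ^ m"
  using assms by (simp add: powr_realpow[symmetric] powr_powr mult.commute)

lemma at_gm_eq:
  assumes "\<epsilon> > 0"
  shows "at_gm a k (2 * k) \<epsilon> F \<xi> \<tau>
    = F (\<xi> / \<epsilon> powr k + a * (\<tau> / (\<epsilon> powr k) ^ 3)) (\<tau> / (\<epsilon> powr k) ^ 3)"
  using powr_gm[OF assms, of 3 k] by (simp add: at_gm_def)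

lemma at_gm_smallo_iff:
  assumes "expands \<Omega> a F c" and "(\<xi>, \<tau>) \<in> \<Omega>" and "k > 0"
  shows "(\<lambda>\<epsilon>. at_gm a k (2 * k) \<epsilon> (F (\<epsilon> powr k)) \<xi> \<tau>) \<in> o[at_right 0](\<lambda>\<epsilon>. \<epsilon> powr (real m * k))
    \<longleftrightarrow> (\<forall>i\<le>m. c i \<xi> \<tau> = 0)"
proof -
  obtain N where N: "\<And>i. i > N \<Longrightarrow> c i \<xi> \<tau> = 0"
    "\<And>e. e > 0 \<Longrightarrow> F e (\<xi> / e + a * (\<tau> / e ^ 3)) (\<tau> / e ^ 3) = (\<Sum>i\<le>N. c i \<xi> \<tau> * e ^ i)"
    using assms(1,2) by (rule expands_at) blast
  have "(\<lambda>\<epsilon>. at_gm a k (2 * k) \<epsilon> (F (\<epsilon> powr k)) \<xi> \<tau>) \<in> o[at_right 0](\<lambda>\<epsilon>. \<epsilon> powr (real m * k))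
    \<longleftrightarrow> (\<lambda>\<epsilon>. \<Sum>i\<le>N. c i \<xi> \<tau> * (\<epsilon> powr k) ^ i) \<in> o[at_right 0](\<lambda>\<epsilon>. (\<epsilon> powr k) ^ m)"
    by (intro landau_o.small.cong_ex; use eventually_at_right_less[of "0::real"] in eventually_elim)
       (simp_all add: at_gm_eq N(2) powr_gm del: times_divide_eq_right)
  also have "\<dots> \<longleftrightarrow> (\<forall>i\<le>m. c i \<xi> \<tau> = 0)"
    by (intro poly_sum_smallo_iff powr_k_tendsto_0 eventually_powr_gt_0 trivial_limit_at_right_real N(1) assms(3))
  finally show ?thesis .
qed

text \<open>A residual with \<open>R\<close> in a denominator has no finite expansion, but its product with \<open>R\<close> has one,
  and \<open>R\<close> tends to a nonzero limit.\<close>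

lemma at_gm_smallo_mult_iff:
  assumes F: "expands \<Omega> a F c" and D: "expands \<Omega> a D d" and "(\<xi>, \<tau>) \<in> \<Omega>" and "k > 0"
    and "d 0 \<xi> \<tau> \<noteq> 0" and "\<And>e x t. D e x t \<noteq> 0 \<Longrightarrow> F e x t = H e x t * D e x t"
  shows "(\<lambda>\<epsilon>. at_gm a k (2 * k) \<epsilon> (H (\<epsilon> powr k)) \<xi> \<tau>) \<in> o[at_right 0](\<lambda>\<epsilon>. \<epsilon> powr (real m * k))
    \<longleftrightarrow> (\<forall>i\<le>m. c i \<xi> \<tau> = 0)"
proof -
  define y where "y \<epsilon> = at_gm a k (2 * k) \<epsilon> (D (\<epsilon> powr k)) \<xi> \<tau>" for \<epsilon>
  obtain N where N: "\<And>i. i > N \<Longrightarrow> d i \<xi> \<tau> = 0"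
    "\<And>e. e > 0 \<Longrightarrow> D e (\<xi> / e + a * (\<tau> / e ^ 3)) (\<tau> / e ^ 3) = (\<Sum>i\<le>N. d i \<xi> \<tau> * e ^ i)"
    using D assms(3) by (rule expands_at) blast
  have "((\<lambda>\<epsilon>. \<Sum>i\<le>N. d i \<xi> \<tau> * (\<epsilon> powr k) ^ i) \<longlongrightarrow> (\<Sum>i\<le>N. d i \<xi> \<tau> * 0 ^ i)) (at_right 0)"
    by (intro tendsto_intros powr_k_tendsto_0 assms)
  also have "(\<Sum>i\<le>N. d i \<xi> \<tau> * 0 ^ i) = d 0 \<xi> \<tau>"
    by (subst sum.atMost_shift) simp
  finally have lim: "(y \<longlongrightarrow> d 0 \<xi> \<tau>) (at_right 0)"
    by (rule Lim_transform_eventually)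
       (use eventually_at_right_less[of "0::real"] in eventually_elim, simp add: at_gm_eq N(2) y_def del: times_divide_eq_right)
  then have ne: "\<forall>\<^sub>F \<epsilon> in at_right 0. y \<epsilon> \<noteq> 0"
    using assms(5) by (rule tendsto_imp_eventually_ne)
  have "y \<in> \<Theta>[at_right 0](\<lambda>_. 1)"
    by (rule bigthetaI_tendsto[OF assms(5)]) (use lim in auto)
  from landau_o.small.mult_cancel_right[OF this,
      of "\<lambda>\<epsilon>. at_gm a k (2 * k) \<epsilon> (H (\<epsilon> powr k)) \<xi> \<tau>" "\<lambda>\<epsilon>. \<epsilon> powr (real m * k)"]
  have "(\<lambda>\<epsilon>. at_gm a k (2 * k) \<epsilon> (H (\<epsilon> powr k)) \<xi> \<tau>) \<in> o[at_right 0](\<lambda>\<epsilon>. \<epsilon> powr (real m * k))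
    \<longleftrightarrow> (\<lambda>\<epsilon>. at_gm a k (2 * k) \<epsilon> (H (\<epsilon> powr k)) \<xi> \<tau> * y \<epsilon>) \<in> o[at_right 0](\<lambda>\<epsilon>. \<epsilon> powr (real m * k))"
    by simp
  also have "\<dots> \<longleftrightarrow> (\<lambda>\<epsilon>. at_gm a k (2 * k) \<epsilon> (F (\<epsilon> powr k)) \<xi> \<tau>) \<in> o[at_right 0](\<lambda>\<epsilon>. \<epsilon> powr (real m * k))"
    by (intro landau_o.small.in_cong; use ne in eventually_elim)
       (simp add: y_def at_gm_def assms(6))
  also have "\<dots> \<longleftrightarrow> (\<forall>i\<le>m. c i \<xi> \<tau> = 0)"
    by (rule at_gm_smallo_iff[OF F assms(3,4)])
  finally show ?thesis .
qed

section \<open>Coefficients of the residuals\<close>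

lemma expands_square:
  assumes "open \<Omega>" and "expands \<Omega> a F c"
  shows "expands \<Omega> a (\<lambda>e x t. (F e x t)\<^sup>2) (cauchy_coeffs c c)"
  using expands_mult[OF assms assms(2)] by (simp add: power2_eq_square)

lemma expands_cube:
  assumes "open \<Omega>" and "expands \<Omega> a F c"
  shows "expands \<Omega> a (\<lambda>e x t. F e x t ^ 3) (cauchy_coeffs c (cauchy_coeffs c c))"
  using expands_mult[OF assms expands_mult[OF assms assms(2)]]
  by (simp add: power3_eq_cube mult.assoc)

definition mass_coeffs where
  "mass_coeffs a r u i = (\<lambda>\<xi> \<tau>. dt_coeffs a r i \<xi> \<tau> + dx_coeffs (cauchy_coeffs r u) i \<xi> \<tau>)"

definition momentum_coeffs where
  "momentum_coeffs a r u p i = (\<lambda>\<xi> \<tau>.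
     dt_coeffs a (cauchy_coeffs r u) i \<xi> \<tau>
       + dx_coeffs (\<lambda>i \<xi> \<tau>. cauchy_coeffs r (cauchy_coeffs u u) i \<xi> \<tau> + p i \<xi> \<tau>) i \<xi> \<tau>
       - dx_coeffs (dx_coeffs u) i \<xi> \<tau>)"

text \<open>The next two are the coefficients of \<open>R\<close> times the residual.\<close>

definition pressure_coeffs where
  "pressure_coeffs a u p g R i = (\<lambda>\<xi> \<tau>.
     cauchy_coeffs R (\<lambda>i \<xi> \<tau>. p i \<xi> \<tau> - g i \<xi> \<tau>
         + (cauchy_coeffs R (mat_coeffs a u (mat_coeffs a u R)) i \<xi> \<tau>
            + 3/2 * cauchy_coeffs (mat_coeffs a u R) (mat_coeffs a u R) i \<xi> \<tau>)) i \<xi> \<tau>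
       + 4/3 * mat_coeffs a u R i \<xi> \<tau>)"

definition gas_coeffs where
  "gas_coeffs a \<gamma> P0 T0 R0 u g R i = (\<lambda>\<xi> \<tau>.
     cauchy_coeffs R (mat_coeffs a u g) i \<xi> \<tau>
       + 3 * \<gamma> * cauchy_coeffs g (mat_coeffs a u R) i \<xi> \<tau>
       + 3 * (\<gamma> - 1) * T0 * (1 / (P0 * R0 ^ 3)
            * cauchy_coeffs g (cauchy_coeffs R (cauchy_coeffs R R)) i \<xi> \<tau> - const_coeffs 1 i \<xi> \<tau>))"

definition density_coeffs where
  "density_coeffs X r R i = (\<lambda>\<xi> \<tau>.
     cauchy_coeffs (\<lambda>i \<xi> \<tau>. const_coeffs (1 - X) i \<xi> \<tau> + cauchy_coeffs R (cauchy_coeffs R R) i \<xi> \<tau>) r i \<xi> \<tau>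
       - const_coeffs 1 i \<xi> \<tau>)"

context
  fixes \<Omega> :: "(real \<times> real) set" and a :: real and \<rho> u P G R r v p g R'
  assumes op: "open \<Omega>"
    and exp: "expands \<Omega> a \<rho> r" "expands \<Omega> a u v" "expands \<Omega> a P p" "expands \<Omega> a G g" "expands \<Omega> a R R'"
begin

lemma expands_mass_residual:
  "expands \<Omega> a (\<lambda>e. mass_residual (\<rho> e) (u e)) (mass_coeffs a r v)"
  unfolding mass_residual_def mass_coeffs_def
  by (intro expands_add expands_mult expands_pd1 expands_pd2 op exp)

lemma expands_momentum_residual:
  "expands \<Omega> a (\<lambda>e. momentum_residual (\<rho> e) (u e) (P e)) (momentum_coeffs a r v p)"
  unfolding momentum_residual_def momentum_coeffs_def
  by (intro expands_add expands_diff expands_mult expands_square expands_pd1 expands_pd2 op exp)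

text \<open>One factor \<open>R\<close> suffices, here and for the gas equation, since
  \<open>R\<close> occurs in denominators only to the first power.\<close>

lemma expands_pressure_residual_mult:
  "expands \<Omega> a (\<lambda>e x t. R e x t * (P e x t - G e x t + (R e x t * mat_deriv (u e) (mat_deriv (u e) (R e)) x t
       + 3/2 * (mat_deriv (u e) (R e) x t)\<^sup>2)) + 4/3 * mat_deriv (u e) (R e) x t)
     (pressure_coeffs a v p g R')"
  unfolding pressure_coeffs_def
  by (intro expands_add expands_diff expands_mult expands_cmult expands_square expands_mat_deriv op exp)

lemma expands_gas_residual_mult:
  "expands \<Omega> a (\<lambda>e x t. R e x t * mat_deriv (u e) (G e) x t + 3 * \<gamma> * (G e x t * mat_deriv (u e) (R e) x t)
       + 3 * (\<gamma> - 1) * T0 * (1 / (P0 * R0 ^ 3) * (G e x t * R e x t ^ 3) - 1))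
     (gas_coeffs a \<gamma> P0 T0 R0 v g R')"
  unfolding gas_coeffs_def
  by (intro expands_add expands_diff expands_mult expands_cmult expands_cube expands_const
      expands_mat_deriv op exp)

lemma expands_density_residual:
  "expands \<Omega> a (\<lambda>e. density_residual X (\<rho> e) (R e)) (density_coeffs X r R')"
  unfolding density_residual_def density_coeffs_def
  by (intro expands_add expands_diff expands_mult expands_cube expands_const op exp)

end

section \<open>The asymptotic conditions as finite systems of equations\<close>

lemma gm_expansion_eq:
  assumes "\<epsilon> > 0"
  shows "gm_expansion a k (2 * k) (2 * k) k N f0 f \<epsilon>
    = (\<lambda>x t. f0 + (\<Sum>j = 1..N. (\<epsilon> powr k) ^ (j + 1)
          * f j (\<epsilon> powr k * (x - a * t)) ((\<epsilon> powr k) ^ 3 * t)))"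
proof -
  have "\<epsilon> powr (2 * k + (real j - 1) * k) = (\<epsilon> powr k) ^ (j + 1)" for j
    using powr_gm[OF assms, of "j + 1" k] by (simp add: algebra_simps)
  moreover have "\<epsilon> powr (k + 2 * k) = (\<epsilon> powr k) ^ 3"
    using powr_gm[OF assms, of 3 k] by simp
  ultimately show ?thesis
    unfolding gm_expansion_def by simp
qed

text \<open>With q = 2k and \<alpha> = k the lowest orders are \<open>e ^ 3\<close> for the
  conservation laws and \<open>e ^ 2\<close> for the other equations, so \<open>n\<close>
  consecutive orders end at \<open>n + 2\<close> and \<open>n + 1\<close>. After this equivalence no
  limits occur.\<close>

lemma lowest_orders_satisfied_iff:
  fixes n :: nat and X P0 R0 \<gamma> T0 k :: real and \<rho> u P G R :: "nat \<Rightarrow> real \<Rightarrow> real \<Rightarrow> real"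
  assumes op: "open \<Omega>" and "k > 0" and "R0 \<noteq> 0"
    and sm: "\<And>j. j \<in> {1..n} \<Longrightarrow> smooth2_on \<Omega> (\<rho> j) \<and> smooth2_on \<Omega> (u j) \<and> smooth2_on \<Omega> (P j)
                             \<and> smooth2_on \<Omega> (G j) \<and> smooth2_on \<Omega> (R j)"
  defines "a \<equiv> wave_speed X P0 R0"
    and "r \<equiv> field_coeffs n (rho0 X R0) \<rho>" and "v \<equiv> field_coeffs n 0 u"
    and "p \<equiv> field_coeffs n P0 P" and "g \<equiv> field_coeffs n P0 G" and "b \<equiv> field_coeffs n R0 R"
  shows "lowest_orders_satisfied \<gamma> X P0 T0 R0 k (2 * k) (2 * k) k n \<Omega> \<rho> u P G R \<longleftrightarrow>
    (\<forall>(\<xi>, \<tau>)\<in>\<Omega>.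
       (\<forall>i\<le>n + 2. mass_coeffs a r v i \<xi> \<tau> = 0) \<and>
       (\<forall>i\<le>n + 2. momentum_coeffs a r v p i \<xi> \<tau> = 0) \<and>
       (\<forall>i\<le>n + 1. pressure_coeffs a v p g b i \<xi> \<tau> = 0) \<and>
       (\<forall>i\<le>n + 1. gas_coeffs a \<gamma> P0 T0 R0 v g b i \<xi> \<tau> = 0) \<and>
       (\<forall>i\<le>n + 1. density_coeffs X r b i \<xi> \<tau> = 0))"
proof -
  define S where "S f0 f = (\<lambda>e x t. f0 + (\<Sum>j = 1..n. e ^ (j + 1) * f j (e * (x - a * t)) (e ^ 3 * t)))"
    for f0 and f :: "nat \<Rightarrow> real \<Rightarrow> real \<Rightarrow> real"
  have gm: "gm_expansion a k (2 * k) (2 * k) k n f0 f \<epsilon> = S f0 f (\<epsilon> powr k)" if "\<epsilon> > 0" for f0 f \<epsilon>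
    unfolding S_def by (rule gm_expansion_eq[OF that])
  have ex: "expands \<Omega> a (S (rho0 X R0) \<rho>) r" "expands \<Omega> a (S 0 u) v" "expands \<Omega> a (S P0 P) p"
    "expands \<Omega> a (S P0 G) g" "expands \<Omega> a (S R0 R) b"
    unfolding S_def r_def v_def p_def g_def b_def by (intro expands_field; use sm in blast)+
  have o2: "2 * k + k + (real n - 1) * k = real (n + 2) * k"
    and o1: "2 * k + (real n - 1) * k = real (n + 1) * k"
    by (simp_all add: algebra_simps)
  have b0: "b 0 \<xi> \<tau> \<noteq> 0" for \<xi> \<tau>
    using assms(3) by (simp add: b_def field_coeffs_def)
  have cong: "(\<lambda>\<epsilon>. at_gm a k (2 * k) \<epsilon> (F \<epsilon>) \<xi> \<tau>) \<in> o[at_right 0](\<lambda>\<epsilon>. \<epsilon> powr (real m * k))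
      \<longleftrightarrow> (\<lambda>\<epsilon>. at_gm a k (2 * k) \<epsilon> (H (\<epsilon> powr k)) \<xi> \<tau>) \<in> o[at_right 0](\<lambda>\<epsilon>. \<epsilon> powr (real m * k))"
    if "\<And>\<epsilon>. \<epsilon> > 0 \<Longrightarrow> F \<epsilon> = H (\<epsilon> powr k)" for F H \<xi> \<tau> m
    by (intro landau_o.small.in_cong; use eventually_at_right_less[of "0::real"] in eventually_elim)
       (simp add: that)
  show ?thesis
    unfolding lowest_orders_satisfied_def Let_def a_def[symmetric] o1 o2
  proof (intro ball_cong refl, clarify, intro arg_cong2[where f = "(\<and>)"])
    fix \<xi> \<tau> assume mem: "(\<xi>, \<tau>) \<in> \<Omega>"
    note iff = trans[OF cong at_gm_smallo_iff[OF _ mem \<open>k > 0\<close>]]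
    \<comment> \<open>The multiplier is the expansion of \<open>R\<close>, whose leading coefficient
      \<open>R0\<close> is nonzero.\<close>
    note iff_mult = trans[OF cong at_gm_smallo_mult_iff[OF _ ex(5) mem \<open>k > 0\<close> b0]]
    show "(\<lambda>\<epsilon>. at_gm a k (2 * k) \<epsilon> (mass_residual
              (gm_expansion a k (2 * k) (2 * k) k n (rho0 X R0) \<rho> \<epsilon>)
              (gm_expansion a k (2 * k) (2 * k) k n 0 u \<epsilon>)) \<xi> \<tau>)
            \<in> o[at_right 0](\<lambda>\<epsilon>. \<epsilon> powr (real (n + 2) * k))
          \<longleftrightarrow> (\<forall>i\<le>n + 2. mass_coeffs a r v i \<xi> \<tau> = 0)"
      by (rule iff[OF _ expands_mass_residual[OF op ex]]) (simp add: gm)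
    show "(\<lambda>\<epsilon>. at_gm a k (2 * k) \<epsilon> (momentum_residual
              (gm_expansion a k (2 * k) (2 * k) k n (rho0 X R0) \<rho> \<epsilon>)
              (gm_expansion a k (2 * k) (2 * k) k n 0 u \<epsilon>)
              (gm_expansion a k (2 * k) (2 * k) k n P0 P \<epsilon>)) \<xi> \<tau>)
            \<in> o[at_right 0](\<lambda>\<epsilon>. \<epsilon> powr (real (n + 2) * k))
          \<longleftrightarrow> (\<forall>i\<le>n + 2. momentum_coeffs a r v p i \<xi> \<tau> = 0)"
      by (rule iff[OF _ expands_momentum_residual[OF op ex]]) (simp add: gm)
    show "(\<lambda>\<epsilon>. at_gm a k (2 * k) \<epsilon> (pressure_residual
              (gm_expansion a k (2 * k) (2 * k) k n 0 u \<epsilon>)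
              (gm_expansion a k (2 * k) (2 * k) k n P0 P \<epsilon>)
              (gm_expansion a k (2 * k) (2 * k) k n P0 G \<epsilon>)
              (gm_expansion a k (2 * k) (2 * k) k n R0 R \<epsilon>)) \<xi> \<tau>)
            \<in> o[at_right 0](\<lambda>\<epsilon>. \<epsilon> powr (real (n + 1) * k))
          \<longleftrightarrow> (\<forall>i\<le>n + 1. pressure_coeffs a v p g b i \<xi> \<tau> = 0)"
      by (rule iff_mult[where H1 = "\<lambda>e. pressure_residual (S 0 u e) (S P0 P e) (S P0 G e) (S R0 R e)",
            OF _ expands_pressure_residual_mult[OF op ex]])
         (simp add: gm, simp add: pressure_residual_def field_simps)
    show "(\<lambda>\<epsilon>. at_gm a k (2 * k) \<epsilon> (gas_residual \<gamma> P0 T0 R0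
              (gm_expansion a k (2 * k) (2 * k) k n 0 u \<epsilon>)
              (gm_expansion a k (2 * k) (2 * k) k n P0 G \<epsilon>)
              (gm_expansion a k (2 * k) (2 * k) k n R0 R \<epsilon>)) \<xi> \<tau>)
            \<in> o[at_right 0](\<lambda>\<epsilon>. \<epsilon> powr (real (n + 1) * k))
          \<longleftrightarrow> (\<forall>i\<le>n + 1. gas_coeffs a \<gamma> P0 T0 R0 v g b i \<xi> \<tau> = 0)"
      by (rule iff_mult[where H1 = "\<lambda>e. gas_residual \<gamma> P0 T0 R0 (S 0 u e) (S P0 G e) (S R0 R e)",
            OF _ expands_gas_residual_mult[OF op ex]])
         (simp add: gm, simp add: gas_residual_def distrib_right)
    show "(\<lambda>\<epsilon>. at_gm a k (2 * k) \<epsilon> (density_residual X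
              (gm_expansion a k (2 * k) (2 * k) k n (rho0 X R0) \<rho> \<epsilon>)
              (gm_expansion a k (2 * k) (2 * k) k n R0 R \<epsilon>)) \<xi> \<tau>)
            \<in> o[at_right 0](\<lambda>\<epsilon>. \<epsilon> powr (real (n + 1) * k))
          \<longleftrightarrow> (\<forall>i\<le>n + 1. density_coeffs X r b i \<xi> \<tau> = 0)"
      by (rule iff[OF _ expands_density_residual[OF op ex]]) (simp add: gm)
  qed
qed

section \<open>Explicit coefficients of low order\<close>

lemma cauchy_coeffs_numeral:
  "cauchy_coeffs c d 0 = (\<lambda>\<xi> \<tau>. c 0 \<xi> \<tau> * d 0 \<xi> \<tau>)"
  "cauchy_coeffs c d (Suc 0) = (\<lambda>\<xi> \<tau>. c 0 \<xi> \<tau> * d 1 \<xi> \<tau> + c 1 \<xi> \<tau> * d 0 \<xi> \<tau>)"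
  "cauchy_coeffs c d 2 = (\<lambda>\<xi> \<tau>. c 0 \<xi> \<tau> * d 2 \<xi> \<tau> + c 1 \<xi> \<tau> * d 1 \<xi> \<tau> + c 2 \<xi> \<tau> * d 0 \<xi> \<tau>)"
  "cauchy_coeffs c d 3 = (\<lambda>\<xi> \<tau>. c 0 \<xi> \<tau> * d 3 \<xi> \<tau> + c 1 \<xi> \<tau> * d 2 \<xi> \<tau> + c 2 \<xi> \<tau> * d 1 \<xi> \<tau>
      + c 3 \<xi> \<tau> * d 0 \<xi> \<tau>)"
  "cauchy_coeffs c d 4 = (\<lambda>\<xi> \<tau>. c 0 \<xi> \<tau> * d 4 \<xi> \<tau> + c 1 \<xi> \<tau> * d 3 \<xi> \<tau> + c 2 \<xi> \<tau> * d 2 \<xi> \<tau>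
      + c 3 \<xi> \<tau> * d 1 \<xi> \<tau> + c 4 \<xi> \<tau> * d 0 \<xi> \<tau>)"
  by (simp_all add: cauchy_coeffs_def eval_nat_numeral)

lemma dx_coeffs_numeral:
  "dx_coeffs c 0 = (\<lambda>_ _. 0)"
  "dx_coeffs c (Suc 0) = pd1 (c 0)"
  "dx_coeffs c 2 = pd1 (c 1)"
  "dx_coeffs c 3 = pd1 (c 2)"
  "dx_coeffs c 4 = pd1 (c 3)"
  "dx_coeffs c 5 = pd1 (c 4)"
  by (simp_all add: dx_coeffs_def shift_coeffs_def eval_nat_numeral)

lemma dt_coeffs_numeral:
  "dt_coeffs a c 0 = (\<lambda>_ _. 0)"
  "dt_coeffs a c (Suc 0) = (\<lambda>\<xi> \<tau>. - a * pd1 (c 0) \<xi> \<tau>)"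
  "dt_coeffs a c 2 = (\<lambda>\<xi> \<tau>. - a * pd1 (c 1) \<xi> \<tau>)"
  "dt_coeffs a c 3 = (\<lambda>\<xi> \<tau>. pd2 (c 0) \<xi> \<tau> - a * pd1 (c 2) \<xi> \<tau>)"
  "dt_coeffs a c 4 = (\<lambda>\<xi> \<tau>. pd2 (c 1) \<xi> \<tau> - a * pd1 (c 3) \<xi> \<tau>)"
  "dt_coeffs a c 5 = (\<lambda>\<xi> \<tau>. pd2 (c 2) \<xi> \<tau> - a * pd1 (c 4) \<xi> \<tau>)"
  by (simp_all add: dt_coeffs_def dx_coeffs_def shift_coeffs_def eval_nat_numeral)

lemmas coeffs_numeral = cauchy_coeffs_numeral dx_coeffs_numeral dt_coeffs_numeral

lemma field_coeffs_simps [simp]: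
  "field_coeffs n f0 f 0 = (\<lambda>_ _. f0)"
  "field_coeffs n f0 f (Suc 0) = (\<lambda>_ _. 0)"
  by (simp_all add: field_coeffs_def)

lemma pd1_mult_at:
  assumes "smooth2_on \<Omega> f" and "smooth2_on \<Omega> g" and "(\<xi>, \<tau>) \<in> \<Omega>"
  shows "pd1 (\<lambda>\<xi> \<tau>. f \<xi> \<tau> * g \<xi> \<tau>) \<xi> \<tau> = pd1 f \<xi> \<tau> * g \<xi> \<tau> + f \<xi> \<tau> * pd1 g \<xi> \<tau>"
  unfolding pd1_def[of "\<lambda>\<xi> \<tau>. f \<xi> \<tau> * g \<xi> \<tau>"]
  using smooth2_on_has_pd1[OF assms(1,3)] smooth2_on_has_pd1[OF assms(2,3)]
  by (auto intro!: DERIV_imp_deriv derivative_eq_intros)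

lemma pd1_add_at:
  assumes "smooth2_on \<Omega> f" and "smooth2_on \<Omega> g" and "(\<xi>, \<tau>) \<in> \<Omega>"
  shows "pd1 (\<lambda>\<xi> \<tau>. f \<xi> \<tau> + g \<xi> \<tau>) \<xi> \<tau> = pd1 f \<xi> \<tau> + pd1 g \<xi> \<tau>"
  unfolding pd1_def[of "\<lambda>\<xi> \<tau>. f \<xi> \<tau> + g \<xi> \<tau>"]
  using smooth2_on_has_pd1[OF assms(1,3)] smooth2_on_has_pd1[OF assms(2,3)]
  by (auto intro!: DERIV_imp_deriv derivative_eq_intros)

lemma pd1_cmult_at:
  assumes "smooth2_on \<Omega> f" and "(\<xi>, \<tau>) \<in> \<Omega>"
  shows "pd1 (\<lambda>\<xi> \<tau>. c * f \<xi> \<tau>) \<xi> \<tau> = c * pd1 f \<xi> \<tau>"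
  using pd1_mult_at[OF smooth2_on_const assms, of c] by simp

lemma pd2_cmult_at:
  assumes "smooth2_on \<Omega> f" and "(\<xi>, \<tau>) \<in> \<Omega>"
  shows "pd2 (\<lambda>\<xi> \<tau>. c * f \<xi> \<tau>) \<xi> \<tau> = c * pd2 f \<xi> \<tau>"
  unfolding pd2_def[of "\<lambda>\<xi> \<tau>. c * f \<xi> \<tau>"]
  using smooth2_on_has_pd2[OF assms]
  by (auto intro!: DERIV_imp_deriv derivative_eq_intros)

lemma all_le_numeral:
  "(\<forall>i\<le>3. Q (i::nat)) \<longleftrightarrow> Q 0 \<and> Q (Suc 0) \<and> Q 2 \<and> Q 3"
  "(\<forall>i\<le>4. Q (i::nat)) \<longleftrightarrow> Q 0 \<and> Q (Suc 0) \<and> Q 2 \<and> Q 3 \<and> Q 4"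
  "(\<forall>i\<le>5. Q (i::nat)) \<longleftrightarrow> Q 0 \<and> Q (Suc 0) \<and> Q 2 \<and> Q 3 \<and> Q 4 \<and> Q 5"
proof -
  have "(\<forall>i\<le>Suc n. Q i) \<longleftrightarrow> (\<forall>i\<le>n. Q i) \<and> Q (Suc n)" for n
    by (auto simp: le_Suc_eq)
  then show
    "(\<forall>i\<le>3. Q (i::nat)) \<longleftrightarrow> Q 0 \<and> Q (Suc 0) \<and> Q 2 \<and> Q 3"
    "(\<forall>i\<le>4. Q (i::nat)) \<longleftrightarrow> Q 0 \<and> Q (Suc 0) \<and> Q 2 \<and> Q 3 \<and> Q 4"
    "(\<forall>i\<le>5. Q (i::nat)) \<longleftrightarrow> Q 0 \<and> Q (Suc 0) \<and> Q 2 \<and> Q 3 \<and> Q 4 \<and> Q 5"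
    by (simp_all add: eval_nat_numeral)
qed

text \<open>Isolates what the coefficient sequences of all fields and all truncation lengths share,
  so that the residual coefficients are computed only once.\<close>

definition perturbs :: "(real \<times> real) set \<Rightarrow> real \<Rightarrow> (nat \<Rightarrow> real \<Rightarrow> real \<Rightarrow> real) \<Rightarrow> bool" where
  "perturbs \<Omega> c0 c \<longleftrightarrow> c 0 = (\<lambda>_ _. c0) \<and> c (Suc 0) = (\<lambda>_ _. 0) \<and> (\<forall>i. smooth2_on \<Omega> (c i))"

context
  fixes \<Omega> :: "(real \<times> real) set" and a r0 p0 g0 b0 \<xi> \<tau> :: real and r v p g b
  assumes op: "open \<Omega>" and mem: "(\<xi>, \<tau>) \<in> \<Omega>"
    and r: "perturbs \<Omega> r0 r" and v: "perturbs \<Omega> 0 v" and p: "perturbs \<Omega> p0 p"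
    and g: "perturbs \<Omega> g0 g" and b: "perturbs \<Omega> b0 b"
begin

lemma smooth_coeffs:
  "smooth2_on \<Omega> (r i)" "smooth2_on \<Omega> (v i)" "smooth2_on \<Omega> (p i)" "smooth2_on \<Omega> (g i)" "smooth2_on \<Omega> (b i)"
  using r v p g b by (auto simp: perturbs_def)

lemma coeffs_01 [simp]:
  "r 0 = (\<lambda>_ _. r0)" "v 0 = (\<lambda>_ _. 0)" "p 0 = (\<lambda>_ _. p0)" "g 0 = (\<lambda>_ _. g0)" "b 0 = (\<lambda>_ _. b0)"
  "r (Suc 0) = (\<lambda>_ _. 0)" "v (Suc 0) = (\<lambda>_ _. 0)" "p (Suc 0) = (\<lambda>_ _. 0)"
  "g (Suc 0) = (\<lambda>_ _. 0)" "b (Suc 0) = (\<lambda>_ _. 0)"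
  using r v p g b by (auto simp: perturbs_def)

lemmas pd_at = pd1_mult_at[OF _ _ mem] pd1_add_at[OF _ _ mem] pd1_cmult_at[OF _ mem] pd2_cmult_at[OF _ mem]

text \<open>A product of two perturbations starts at \<open>e ^ 4\<close> and a space derivative
  adds one power, so quadratic terms first appear at index 5. The \<tau>-derivative of the first
  perturbation also starts there, with \<open>e ^ 3 * e ^ 2\<close>; this coincidence is the KdV
  balance behind \<beta> = q = 2k.\<close>

lemma mass_coeffs_numeral:
  "mass_coeffs a r v 0 \<xi> \<tau> = 0" "mass_coeffs a r v (Suc 0) \<xi> \<tau> = 0" "mass_coeffs a r v 2 \<xi> \<tau> = 0"
  "mass_coeffs a r v 3 \<xi> \<tau> = - a * pd1 (r 2) \<xi> \<tau> + r0 * pd1 (v 2) \<xi> \<tau>"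
  "mass_coeffs a r v 4 \<xi> \<tau> = - a * pd1 (r 3) \<xi> \<tau> + r0 * pd1 (v 3) \<xi> \<tau>"
  "mass_coeffs a r v 5 \<xi> \<tau> = pd2 (r 2) \<xi> \<tau> - a * pd1 (r 4) \<xi> \<tau> + r0 * pd1 (v 4) \<xi> \<tau>
     + pd1 (r 2) \<xi> \<tau> * v 2 \<xi> \<tau> + r 2 \<xi> \<tau> * pd1 (v 2) \<xi> \<tau>"
  by (simp_all add: mass_coeffs_def coeffs_numeral pd_at smooth2_on_intros op smooth_coeffs)

lemma momentum_coeffs_numeral:
  "momentum_coeffs a r v p 0 \<xi> \<tau> = 0" "momentum_coeffs a r v p (Suc 0) \<xi> \<tau> = 0"
  "momentum_coeffs a r v p 2 \<xi> \<tau> = 0"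
  "momentum_coeffs a r v p 3 \<xi> \<tau> = - a * r0 * pd1 (v 2) \<xi> \<tau> + pd1 (p 2) \<xi> \<tau>"
  "momentum_coeffs a r v p 4 \<xi> \<tau> = - a * r0 * pd1 (v 3) \<xi> \<tau> + pd1 (p 3) \<xi> \<tau> - pd1 (pd1 (v 2)) \<xi> \<tau>"
  "momentum_coeffs a r v p 5 \<xi> \<tau> = r0 * pd2 (v 2) \<xi> \<tau>
     - a * (r0 * pd1 (v 4) \<xi> \<tau> + pd1 (r 2) \<xi> \<tau> * v 2 \<xi> \<tau> + r 2 \<xi> \<tau> * pd1 (v 2) \<xi> \<tau>)
     + 2 * r0 * v 2 \<xi> \<tau> * pd1 (v 2) \<xi> \<tau> + pd1 (p 4) \<xi> \<tau> - pd1 (pd1 (v 3)) \<xi> \<tau>"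
  by (simp_all add: momentum_coeffs_def coeffs_numeral pd_at smooth2_on_intros op smooth_coeffs
      distrib_left)

text \<open>Transport by \<open>v\<close> and the slow time derivative both start at
  \<open>e ^ 5\<close>; up to order 4 only the motion of the frame is felt.\<close>

lemma mat_coeffs_numeral:
  assumes "perturbs \<Omega> c0 c"
  shows "mat_coeffs a v c 0 = (\<lambda>_ _. 0)" "mat_coeffs a v c (Suc 0) = (\<lambda>_ _. 0)"
    "mat_coeffs a v c 2 = (\<lambda>_ _. 0)"
    "mat_coeffs a v c 3 = (\<lambda>\<xi> \<tau>. - a * pd1 (c 2) \<xi> \<tau>)"
    "mat_coeffs a v c 4 = (\<lambda>\<xi> \<tau>. - a * pd1 (c 3) \<xi> \<tau>)"
  using assms by (auto simp: mat_coeffs_def coeffs_numeral perturbs_def)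

lemma mat_mat_coeffs_numeral:
  "mat_coeffs a v (mat_coeffs a v b) 0 \<xi> \<tau> = 0" "mat_coeffs a v (mat_coeffs a v b) (Suc 0) \<xi> \<tau> = 0"
  "mat_coeffs a v (mat_coeffs a v b) 2 \<xi> \<tau> = 0" "mat_coeffs a v (mat_coeffs a v b) 3 \<xi> \<tau> = 0"
  "mat_coeffs a v (mat_coeffs a v b) 4 \<xi> \<tau> = a\<^sup>2 * pd1 (pd1 (b 2)) \<xi> \<tau>"
  by (simp_all add: mat_coeffs_def[of _ _ "mat_coeffs a v b"] coeffs_numeral mat_coeffs_numeral[OF b]
      pd1_cmult_at[OF smooth2_on_pd1[OF smooth_coeffs(5)] mem, of "- a", simplified] power2_eq_square)

text \<open>The viscous quotient enters at index 3. The second material derivative of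
  \<open>R\<close>, a source of dispersion, enters at index 4, while the squared first one would
  need index 6.\<close>

lemma pressure_coeffs_numeral:
  assumes "p0 = g0"
  shows "pressure_coeffs a v p g b 0 \<xi> \<tau> = 0" "pressure_coeffs a v p g b (Suc 0) \<xi> \<tau> = 0"
    "pressure_coeffs a v p g b 2 \<xi> \<tau> = b0 * (p 2 \<xi> \<tau> - g 2 \<xi> \<tau>)"
    "pressure_coeffs a v p g b 3 \<xi> \<tau> = b0 * (p 3 \<xi> \<tau> - g 3 \<xi> \<tau>) - 4/3 * a * pd1 (b 2) \<xi> \<tau>"
    "pressure_coeffs a v p g b 4 \<xi> \<tau> = b0 * (p 4 \<xi> \<tau> - g 4 \<xi> \<tau> + b0 * a\<^sup>2 * pd1 (pd1 (b 2)) \<xi> \<tau>)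
       + b 2 \<xi> \<tau> * (p 2 \<xi> \<tau> - g 2 \<xi> \<tau>) - 4/3 * a * pd1 (b 3) \<xi> \<tau>"
  using assms
  by (simp_all add: pressure_coeffs_def coeffs_numeral mat_mat_coeffs_numeral mat_coeffs_numeral[OF b]
      algebra_simps)

text \<open>Heat exchange carries no derivative and so precedes the other terms by one order: at
  lowest order \<open>G * R ^ 3\<close> is constant, as in an isothermal gas. The equilibrium values
  \<open>g0\<close> and \<open>b0\<close> double as \<open>P0\<close> and \<open>R0\<close>, which
  makes index 0 vanish.\<close>

lemma gas_coeffs_numeral:
  assumes "b0 \<noteq> 0" and "g0 \<noteq> 0"
  shows "gas_coeffs a \<gamma> g0 T0 b0 v g b 0 \<xi> \<tau> = 0" "gas_coeffs a \<gamma> g0 T0 b0 v g b (Suc 0) \<xi> \<tau> = 0"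
    "gas_coeffs a \<gamma> g0 T0 b0 v g b 2 \<xi> \<tau>
      = 3 * (\<gamma> - 1) * T0 * (g 2 \<xi> \<tau> / g0 + 3 * b 2 \<xi> \<tau> / b0)"
    "gas_coeffs a \<gamma> g0 T0 b0 v g b 3 \<xi> \<tau>
      = - a * b0 * pd1 (g 2) \<xi> \<tau> - 3 * \<gamma> * g0 * a * pd1 (b 2) \<xi> \<tau>
        + 3 * (\<gamma> - 1) * T0 * (g 3 \<xi> \<tau> / g0 + 3 * b 3 \<xi> \<tau> / b0)"
    "gas_coeffs a \<gamma> g0 T0 b0 v g b 4 \<xi> \<tau>
      = - a * b0 * pd1 (g 3) \<xi> \<tau> - 3 * \<gamma> * g0 * a * pd1 (b 3) \<xi> \<tau>
        + 3 * (\<gamma> - 1) * T0 * (g 4 \<xi> \<tau> / g0 + 3 * b 4 \<xi> \<tau> / b0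
             + 3 * (b 2 \<xi> \<tau>)\<^sup>2 / b0\<^sup>2 + 3 * g 2 \<xi> \<tau> * b 2 \<xi> \<tau> / (g0 * b0))"
  using assms
  by (simp_all add: gas_coeffs_def coeffs_numeral mat_coeffs_numeral[OF b] mat_coeffs_numeral[OF g]
      const_coeffs_def field_simps power2_eq_square power3_eq_cube)

lemma density_coeffs_numeral:
  assumes "(1 - X + b0 ^ 3) * r0 = 1"
  shows "density_coeffs X r b 0 \<xi> \<tau> = 0" "density_coeffs X r b (Suc 0) \<xi> \<tau> = 0"
    "density_coeffs X r b 2 \<xi> \<tau> = (1 - X + b0 ^ 3) * r 2 \<xi> \<tau> + 3 * b0\<^sup>2 * r0 * b 2 \<xi> \<tau>"
    "density_coeffs X r b 3 \<xi> \<tau> = (1 - X + b0 ^ 3) * r 3 \<xi> \<tau> + 3 * b0\<^sup>2 * r0 * b 3 \<xi> \<tau>"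
    "density_coeffs X r b 4 \<xi> \<tau> = (1 - X + b0 ^ 3) * r 4 \<xi> \<tau> + 3 * b0\<^sup>2 * b 2 \<xi> \<tau> * r 2 \<xi> \<tau>
       + (3 * b0\<^sup>2 * b 4 \<xi> \<tau> + 3 * b0 * (b 2 \<xi> \<tau>)\<^sup>2) * r0"
  using assms
  by (simp_all add: density_coeffs_def coeffs_numeral const_coeffs_def algebra_simps
      power2_eq_square power3_eq_cube)

end

section \<open>The equations collected by order\<close>

definition leading_equations where
  "leading_equations \<gamma> P0 T0 R0 a \<Delta> \<rho> u P G R \<xi> \<tau> \<longleftrightarrow>
     - a * pd1 (\<rho> (1::nat)) \<xi> \<tau> + 1 / \<Delta> * pd1 (u (1::nat)) \<xi> \<tau> = 0 \<and>
     - a * pd1 (\<rho> 2) \<xi> \<tau> + 1 / \<Delta> * pd1 (u 2) \<xi> \<tau> = 0 \<and>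
     - a * (1 / \<Delta>) * pd1 (u 1) \<xi> \<tau> + pd1 (P (1::nat)) \<xi> \<tau> = 0 \<and>
     - a * (1 / \<Delta>) * pd1 (u 2) \<xi> \<tau> + pd1 (P 2) \<xi> \<tau> - pd1 (pd1 (u 1)) \<xi> \<tau> = 0 \<and>
     R0 * (P 1 \<xi> \<tau> - G (1::nat) \<xi> \<tau>) = 0 \<and>
     R0 * (P 2 \<xi> \<tau> - G 2 \<xi> \<tau>) - 4/3 * a * pd1 (R (1::nat)) \<xi> \<tau> = 0 \<and>
     3 * (\<gamma> - 1) * T0 * (G 1 \<xi> \<tau> / P0 + 3 * R 1 \<xi> \<tau> / R0) = 0 \<and>
     - a * R0 * pd1 (G 1) \<xi> \<tau> - 3 * \<gamma> * P0 * a * pd1 (R 1) \<xi> \<tau>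
       + 3 * (\<gamma> - 1) * T0 * (G 2 \<xi> \<tau> / P0 + 3 * R 2 \<xi> \<tau> / R0) = 0 \<and>
     \<Delta> * \<rho> 1 \<xi> \<tau> + 3 * R0\<^sup>2 * (1 / \<Delta>) * R 1 \<xi> \<tau> = (0::real) \<and>
     \<Delta> * \<rho> 2 \<xi> \<tau> + 3 * R0\<^sup>2 * (1 / \<Delta>) * R 2 \<xi> \<tau> = 0"

text \<open>The coefficients with number 3 enter exactly as the newest ones do in
  \<open>leading_equations\<close>; everything else is a source term built from numbers 1 and
  2.\<close>

definition third_equations where
  "third_equations \<gamma> P0 T0 R0 a \<Delta> \<rho> u P G R \<xi> \<tau> \<longleftrightarrow>
     pd2 (\<rho> 1) \<xi> \<tau> - a * pd1 (\<rho> 3) \<xi> \<tau> + 1 / \<Delta> * pd1 (u 3) \<xi> \<tau>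
       + pd1 (\<rho> (1::nat)) \<xi> \<tau> * u 1 \<xi> \<tau> + \<rho> 1 \<xi> \<tau> * pd1 (u (1::nat)) \<xi> \<tau> = 0 \<and>
     1 / \<Delta> * pd2 (u 1) \<xi> \<tau>
       - a * (1 / \<Delta> * pd1 (u 3) \<xi> \<tau> + pd1 (\<rho> 1) \<xi> \<tau> * u 1 \<xi> \<tau> + \<rho> 1 \<xi> \<tau> * pd1 (u 1) \<xi> \<tau>)
       + 2 * (1 / \<Delta>) * u 1 \<xi> \<tau> * pd1 (u 1) \<xi> \<tau> + pd1 (P (3::nat)) \<xi> \<tau> - pd1 (pd1 (u 2)) \<xi> \<tau> = 0 \<and>
     R0 * (P 3 \<xi> \<tau> - G (3::nat) \<xi> \<tau> + R0 * a\<^sup>2 * pd1 (pd1 (R (1::nat))) \<xi> \<tau>)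
       + R 1 \<xi> \<tau> * (P 1 \<xi> \<tau> - G 1 \<xi> \<tau>) - 4/3 * a * pd1 (R 2) \<xi> \<tau> = 0 \<and>
     - a * R0 * pd1 (G 2) \<xi> \<tau> - 3 * \<gamma> * P0 * a * pd1 (R 2) \<xi> \<tau>
       + 3 * (\<gamma> - 1) * T0 * (G 3 \<xi> \<tau> / P0 + 3 * R 3 \<xi> \<tau> / R0
            + 3 * (R 1 \<xi> \<tau>)\<^sup>2 / R0\<^sup>2 + 3 * G 1 \<xi> \<tau> * R 1 \<xi> \<tau> / (P0 * R0)) = 0 \<and>
     \<Delta> * \<rho> 3 \<xi> \<tau> + 3 * R0\<^sup>2 * R 1 \<xi> \<tau> * \<rho> 1 \<xi> \<tau>
       + (3 * R0\<^sup>2 * R 3 \<xi> \<tau> + 3 * R0 * (R 1 \<xi> \<tau>)\<^sup>2) * (1 / \<Delta>) = (0::real)"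

lemma perturbs_field_coeffs:
  assumes "\<And>j. j \<in> {1..n} \<Longrightarrow> smooth2_on \<Omega> (f j)"
  shows "perturbs \<Omega> f0 (field_coeffs n f0 f)"
  using expands_smooth[OF expands_field[OF assms]] by (simp add: perturbs_def)

lemma field_coeffs_numeral:
  "field_coeffs 2 f0 f 2 = f 1" "field_coeffs 2 f0 f 3 = f 2"
  "field_coeffs 3 f0 f 2 = f 1" "field_coeffs 3 f0 f 3 = f 2" "field_coeffs 3 f0 f 4 = f 3"
  by (simp_all add: field_coeffs_def)

context
  fixes \<gamma> X P0 T0 R0 a \<Delta> k :: real and \<Omega> :: "(real \<times> real) set"
    and \<rho> u P G R :: "nat \<Rightarrow> real \<Rightarrow> real \<Rightarrow> real" and n :: nat
  assumes op: "open \<Omega>" and k: "k > 0" and pos: "P0 > 0" "R0 > 0" "\<Delta> > 0"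
    and Delta: "\<Delta> = R0 ^ 3 - X + 1" and a: "a = wave_speed X P0 R0"
    and sm: "\<And>j. j \<in> {1..n} \<Longrightarrow> smooth2_on \<Omega> (\<rho> j) \<and> smooth2_on \<Omega> (u j) \<and> smooth2_on \<Omega> (P j)
                             \<and> smooth2_on \<Omega> (G j) \<and> smooth2_on \<Omega> (R j)"
begin

lemma rho0_eq: "rho0 X R0 = 1 / \<Delta>"
  by (simp add: rho0_def Delta)

lemma perturbs_fields:
  "perturbs \<Omega> (1 / \<Delta>) (field_coeffs n (1 / \<Delta>) \<rho>)" "perturbs \<Omega> 0 (field_coeffs n 0 u)"
  "perturbs \<Omega> P0 (field_coeffs n P0 P)" "perturbs \<Omega> P0 (field_coeffs n P0 G)"
  "perturbs \<Omega> R0 (field_coeffs n R0 R)"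
  using sm by (auto intro!: perturbs_field_coeffs)

lemma one_minus: "1 - X + R0 ^ 3 = \<Delta>"
  by (simp add: Delta)

lemmas mass_coeffs_at = mass_coeffs_numeral[OF op _ perturbs_fields]
lemmas momentum_coeffs_at = momentum_coeffs_numeral[OF op _ perturbs_fields]
lemmas pressure_coeffs_at = pressure_coeffs_numeral[OF op _ perturbs_fields refl]
lemmas gas_coeffs_at = gas_coeffs_numeral[OF op _ perturbs_fields]
lemmas density_coeffs_at = density_coeffs_numeral[OF op _ perturbs_fields, of _ _ X, unfolded one_minus]

lemma lowest_orders_2_iff:
  assumes "n = 2"
  shows "lowest_orders_satisfied \<gamma> X P0 T0 R0 k (2 * k) (2 * k) k 2 \<Omega> \<rho> u P G R \<longleftrightarrow>
    (\<forall>(\<xi>, \<tau>)\<in>\<Omega>. leading_equations \<gamma> P0 T0 R0 a \<Delta> \<rho> u P G R \<xi> \<tau>)"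
proof -
  have orders: "n + 2 = 4" "n + 1 = 3"
    using assms by simp_all
  have eqs: "(\<forall>i\<le>n + 2. mass_coeffs a (field_coeffs n (1 / \<Delta>) \<rho>) (field_coeffs n 0 u) i \<xi> \<tau> = 0) \<and>
      (\<forall>i\<le>n + 2. momentum_coeffs a (field_coeffs n (1 / \<Delta>) \<rho>) (field_coeffs n 0 u) (field_coeffs n P0 P) i \<xi> \<tau> = 0) \<and>
      (\<forall>i\<le>n + 1. pressure_coeffs a (field_coeffs n 0 u) (field_coeffs n P0 P) (field_coeffs n P0 G)
                   (field_coeffs n R0 R) i \<xi> \<tau> = 0) \<and>
      (\<forall>i\<le>n + 1. gas_coeffs a \<gamma> P0 T0 R0 (field_coeffs n 0 u) (field_coeffs n P0 G) (field_coeffs n R0 R) i \<xi> \<tau> = 0) \<and>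
      (\<forall>i\<le>n + 1. density_coeffs X (field_coeffs n (1 / \<Delta>) \<rho>) (field_coeffs n R0 R) i \<xi> \<tau> = 0)
    \<longleftrightarrow> leading_equations \<gamma> P0 T0 R0 a \<Delta> \<rho> u P G R \<xi> \<tau>"
    if "(\<xi>, \<tau>) \<in> \<Omega>" for \<xi> \<tau>
  proof -
    have "R0 \<noteq> 0" "P0 \<noteq> 0" "\<Delta> * (1 / \<Delta>) = 1"
      using pos by simp_all
    note vals = mass_coeffs_at[OF that] momentum_coeffs_at[OF that] pressure_coeffs_at[OF that]
      gas_coeffs_at[OF that this(1,2)] density_coeffs_at[OF that this(3)]
    show ?thesis
      unfolding orders all_le_numeral vals unfolding assms field_coeffs_numeral leading_equations_def
      by argo
  qed
  have "R0 \<noteq> 0"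
    using pos by simp
  have "lowest_orders_satisfied \<gamma> X P0 T0 R0 k (2 * k) (2 * k) k n \<Omega> \<rho> u P G R \<longleftrightarrow>
      (\<forall>(\<xi>, \<tau>)\<in>\<Omega>. leading_equations \<gamma> P0 T0 R0 a \<Delta> \<rho> u P G R \<xi> \<tau>)"
    by (rule trans[OF lowest_orders_satisfied_iff[where \<rho> = \<rho> and u = u and P = P and G = G and R = R,
            OF op k \<open>R0 \<noteq> 0\<close> sm]], assumption, unfold a[symmetric] rho0_eq)
       (intro ball_cong refl, clarify, rule eqs)
  then show ?thesis
    by (simp add: assms)
qed

lemma lowest_orders_3_iff:
  assumes "n = 3"
  shows "lowest_orders_satisfied \<gamma> X P0 T0 R0 k (2 * k) (2 * k) k 3 \<Omega> \<rho> u P G R \<longleftrightarrow>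
    (\<forall>(\<xi>, \<tau>)\<in>\<Omega>. leading_equations \<gamma> P0 T0 R0 a \<Delta> \<rho> u P G R \<xi> \<tau>
                     \<and> third_equations \<gamma> P0 T0 R0 a \<Delta> \<rho> u P G R \<xi> \<tau>)"
proof -
  have orders: "n + 2 = 5" "n + 1 = 4"
    using assms by simp_all
  have eqs: "(\<forall>i\<le>n + 2. mass_coeffs a (field_coeffs n (1 / \<Delta>) \<rho>) (field_coeffs n 0 u) i \<xi> \<tau> = 0) \<and>
      (\<forall>i\<le>n + 2. momentum_coeffs a (field_coeffs n (1 / \<Delta>) \<rho>) (field_coeffs n 0 u) (field_coeffs n P0 P) i \<xi> \<tau> = 0) \<and>
      (\<forall>i\<le>n + 1. pressure_coeffs a (field_coeffs n 0 u) (field_coeffs n P0 P) (field_coeffs n P0 G)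
                   (field_coeffs n R0 R) i \<xi> \<tau> = 0) \<and>
      (\<forall>i\<le>n + 1. gas_coeffs a \<gamma> P0 T0 R0 (field_coeffs n 0 u) (field_coeffs n P0 G) (field_coeffs n R0 R) i \<xi> \<tau> = 0) \<and>
      (\<forall>i\<le>n + 1. density_coeffs X (field_coeffs n (1 / \<Delta>) \<rho>) (field_coeffs n R0 R) i \<xi> \<tau> = 0)
    \<longleftrightarrow> leading_equations \<gamma> P0 T0 R0 a \<Delta> \<rho> u P G R \<xi> \<tau> \<and> third_equations \<gamma> P0 T0 R0 a \<Delta> \<rho> u P G R \<xi> \<tau>"
    if "(\<xi>, \<tau>) \<in> \<Omega>" for \<xi> \<tau>
  proof -
    have "R0 \<noteq> 0" "P0 \<noteq> 0" "\<Delta> * (1 / \<Delta>) = 1"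
      using pos by simp_all
    note vals = mass_coeffs_at[OF that] momentum_coeffs_at[OF that] pressure_coeffs_at[OF that]
      gas_coeffs_at[OF that this(1,2)] density_coeffs_at[OF that this(3)]
    show ?thesis
      unfolding orders all_le_numeral vals unfolding assms field_coeffs_numeral leading_equations_def third_equations_def
      by argo
  qed
  have "R0 \<noteq> 0"
    using pos by simp
  have "lowest_orders_satisfied \<gamma> X P0 T0 R0 k (2 * k) (2 * k) k n \<Omega> \<rho> u P G R \<longleftrightarrow>
      (\<forall>(\<xi>, \<tau>)\<in>\<Omega>. leading_equations \<gamma> P0 T0 R0 a \<Delta> \<rho> u P G R \<xi> \<tau>
         \<and> third_equations \<gamma> P0 T0 R0 a \<Delta> \<rho> u P G R \<xi> \<tau>)"
    by (rule trans[OF lowest_orders_satisfied_iff[where \<rho> = \<rho> and u = u and P = P and G = G and R = R,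
            OF op k \<open>R0 \<noteq> 0\<close> sm]], assumption, unfold a[symmetric] rho0_eq)
       (intro ball_cong refl, clarify, rule eqs)
  then show ?thesis
    by (simp add: assms)
qed

end

section \<open>The first three orders\<close>

lemma pd1_scaled:
  assumes "open \<Omega>" and "smooth2_on \<Omega> f" and "\<And>\<xi> \<tau>. (\<xi>, \<tau>) \<in> \<Omega> \<Longrightarrow> h \<xi> \<tau> = c * f \<xi> \<tau>" and "(\<xi>, \<tau>) \<in> \<Omega>"
  shows "pd1 h \<xi> \<tau> = c * pd1 f \<xi> \<tau>"
  using pd1_cong_on[OF assms(1,3,4)] pd1_cmult_at[OF assms(2,4)] by simp

lemma pd1_combination:
  assumes "open \<Omega>" and "smooth2_on \<Omega> f" and "smooth2_on \<Omega> g"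
    and "\<And>\<xi> \<tau>. (\<xi>, \<tau>) \<in> \<Omega> \<Longrightarrow> h \<xi> \<tau> = c * f \<xi> \<tau> + d * g \<xi> \<tau>" and "(\<xi>, \<tau>) \<in> \<Omega>"
  shows "pd1 h \<xi> \<tau> = c * pd1 f \<xi> \<tau> + d * pd1 g \<xi> \<tau>"
proof -
  have "pd1 h \<xi> \<tau> = pd1 (\<lambda>\<xi> \<tau>. c * f \<xi> \<tau> + d * g \<xi> \<tau>) \<xi> \<tau>"
    by (rule pd1_cong_on[OF assms(1,4,5)])
  also have "\<dots> = c * pd1 f \<xi> \<tau> + d * pd1 g \<xi> \<tau>"
    by (simp add: pd1_add_at[OF smooth2_on_mult[OF assms(1) smooth2_on_const assms(2)]
            smooth2_on_mult[OF assms(1) smooth2_on_const assms(3)] assms(5)]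
          pd1_cmult_at[OF assms(2,5)] pd1_cmult_at[OF assms(3,5)])
  finally show ?thesis .
qed

section \<open>The constants and the algebra at a single point\<close>

context
  fixes \<gamma> P0 T0 R0 a \<Delta> \<kappa> :: real
  assumes pos: "P0 > 0" "R0 > 0" "\<Delta> > 0" and \<gamma>: "\<gamma> \<noteq> 1" and \<kappa>: "\<kappa> = \<Delta>\<^sup>2 / (3 * R0\<^sup>2)"
    and a2: "a\<^sup>2 = P0 * \<Delta>\<^sup>2 / R0 ^ 3" and T0: "T0 = - (3 * P0\<^sup>2 * R0 * \<Delta>) / (9 * R0 ^ 3 + 4 * \<Delta>)"
begin

lemma T0_neg: "T0 < 0"
  unfolding T0 using pos by (simp add: divide_neg_pos add_pos_pos)

text \<open>This is the relation that fixes \<open>T\<^sub>0\<close>: the dissipative terms of the pressure and gas equations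
  balance the viscous term of the momentum equation.\<close>

lemma dissipation_balance: "- \<kappa> * (4 * a / (3 * R0) + a * P0\<^sup>2 / T0) = a * \<Delta>"
proof -
  have "P0\<^sup>2 / T0 = - (9 * R0 ^ 3 + 4 * \<Delta>) / (3 * R0 * \<Delta>)"
  proof -
    have "9 * R0 ^ 3 + 4 * \<Delta> > 0"
      using pos by (simp add: add_pos_pos)
    then show ?thesis
      unfolding T0 using pos by (simp add: field_simps)
  qed
  \<comment> \<open>The contribution of the bubble equation cancels, and what remains is
    \<open>- \<Delta> / \<kappa>\<close>.\<close>
  then have "4 / (3 * R0) + P0\<^sup>2 / T0 = - 3 * R0\<^sup>2 / \<Delta>"
    using pos by (simp add: field_simps power2_eq_square power3_eq_cube)
  then have "a * \<kappa> * (4 / (3 * R0) + P0\<^sup>2 / T0) = a * \<kappa> * (- 3 * R0\<^sup>2 / \<Delta>)"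
    by simp
  also have "\<dots> = - (a * \<Delta>)"
    unfolding \<kappa> using pos by (simp add: field_simps power2_eq_square)
  finally show ?thesis
    by (simp add: algebra_simps)
qed

text \<open>Half the second derivative, at equilibrium, of the isothermal pressure
  \<open>P0 * R0 ^ 3 / R ^ 3\<close> as a function of the density, where
  \<open>R ^ 3 = 1 / \<rho> - 1 + X\<close>. The first derivative there is
  \<open>a\<^sup>2\<close>.\<close>

definition quad where "quad = P0 * \<Delta> ^ 3 / R0 ^ 3 * (\<Delta> / R0 ^ 3 - 1)"
text \<open>The summand 1 is the inertia of the bubble wall. The other one is the thermal lag of the
  gas applied twice, hence the square of \<open>T0\<close>.\<close>

definition disp where "disp = a\<^sup>2 * \<kappa> * R0 * (1 - P0 ^ 3 / (3 * (\<gamma> - 1) * T0\<^sup>2))"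

text \<open>Pure algebra at one point: \<open>y\<close>, \<open>y2\<close>, \<open>z1\<close>,
  \<open>r3\<close> are the values of \<open>\<rho> 1\<close>, its second \<xi>-derivative, the
  \<xi>-derivative of \<open>\<rho> 2\<close>, and \<open>\<rho> 3\<close>. The density equation
  yields \<open>R3\<close>, the gas equation \<open>G3\<close>, the pressure equation
  \<open>P3\<close>.\<close>

lemma third_pressure:
  fixes y y2 z1 r3 R1 R1' R1'' R2' R3 G1 G2' G3 P1 P3 :: real
  assumes "R1 = - \<kappa> * y" "R1'' = - \<kappa> * y2" "R2' = - \<kappa> * z1" "G1 = - (3 * P0 / R0) * R1" "P1 = G1"
    and G2': "G2' = - (3 * P0 / R0) * R2' + a * P0\<^sup>2 / T0 * R1''"
    and s: "R0 * (P3 - G3 + R0 * a\<^sup>2 * R1'') + R1 * (P1 - G1) - 4/3 * a * R2' = 0"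
    and g: "- a * R0 * G2' - 3 * \<gamma> * P0 * a * R2'
       + 3 * (\<gamma> - 1) * T0 * (G3 / P0 + 3 * R3 / R0 + 3 * R1\<^sup>2 / R0\<^sup>2 + 3 * G1 * R1 / (P0 * R0)) = 0"
    and d: "\<Delta> * r3 + 3 * R0\<^sup>2 * R1 * y + (3 * R0\<^sup>2 * R3 + 3 * R0 * R1\<^sup>2) * (1 / \<Delta>) = 0"
  shows "P3 = a\<^sup>2 * r3 + quad * y\<^sup>2 + a * \<Delta> * z1 + disp * y2"
proof -
  have nz: "T0 \<noteq> 0" "\<gamma> - 1 \<noteq> 0" "P0 \<noteq> 0" "R0 \<noteq> 0" "\<Delta> \<noteq> 0"
    using T0_neg \<gamma> pos by auto
  have R3: "R3 = - \<kappa> * r3 + \<Delta> * \<kappa> * y\<^sup>2 - \<kappa>\<^sup>2 / R0 * y\<^sup>2"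
  proof -
    have "3 * R0\<^sup>2 * R3 = - (\<Delta>\<^sup>2 * r3) - 3 * R0\<^sup>2 * \<Delta> * R1 * y - 3 * R0 * R1\<^sup>2"
      using d nz by (simp add: field_simps power2_eq_square)
    also have "\<Delta>\<^sup>2 = 3 * R0\<^sup>2 * \<kappa>"
      using nz by (simp add: \<kappa>)
    also have "- (3 * R0\<^sup>2 * \<kappa> * r3) - 3 * R0\<^sup>2 * \<Delta> * R1 * y - 3 * R0 * R1\<^sup>2
        = 3 * R0\<^sup>2 * (- \<kappa> * r3 + \<Delta> * \<kappa> * y\<^sup>2 - \<kappa>\<^sup>2 / R0 * y\<^sup>2)"
      unfolding assms(1) using nz by (simp add: field_simps power2_eq_square)
    finally show ?thesis
      using nz by simp
  qed
  have G3: "G3 = - (3 * P0 / R0) * R3 - 3 * P0 * R1\<^sup>2 / R0\<^sup>2 - 3 * G1 * R1 / R0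
      + P0 / (3 * (\<gamma> - 1) * T0) * (a * R0 * G2' + 3 * \<gamma> * P0 * a * R2')"
  proof -
    define K where "K = 3 * (\<gamma> - 1) * T0"
    have K: "K \<noteq> 0"
      using nz by (simp add: K_def)
    have "K * (G3 / P0 + 3 * R3 / R0 + 3 * R1\<^sup>2 / R0\<^sup>2 + 3 * G1 * R1 / (P0 * R0)) = a * R0 * G2' + 3 * \<gamma> * P0 * a * R2'"
      using g unfolding K_def by simp
    then have "G3 / P0 + 3 * R3 / R0 + 3 * R1\<^sup>2 / R0\<^sup>2 + 3 * G1 * R1 / (P0 * R0) = (a * R0 * G2' + 3 * \<gamma> * P0 * a * R2') / K"
      using K by (simp add: field_simps)
    then have G3: "G3 / P0 = (a * R0 * G2' + 3 * \<gamma> * P0 * a * R2') / K - 3 * R3 / R0 - 3 * R1\<^sup>2 / R0\<^sup>2 - 3 * G1 * R1 / (P0 * R0)"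
      by simp
    have "G3 = P0 * (G3 / P0)"
      using nz by simp
    then show ?thesis
      unfolding G3 K_def[symmetric] using nz by (simp add: algebra_simps add_divide_distrib)
  qed
  have P3: "P3 = G3 - R0 * a\<^sup>2 * R1'' + 4 * a / (3 * R0) * R2'"
    using s nz assms(5) by (simp add: field_simps)
  \<comment> \<open>The Taylor expansion of the isothermal law to second order; this is where
    \<open>a\<^sup>2\<close> and \<open>quad\<close> come from.\<close>
  have nonlinear: "- (3 * P0 / R0) * R3 - 3 * P0 * R1\<^sup>2 / R0\<^sup>2 - 3 * G1 * R1 / R0 = a\<^sup>2 * r3 + quad * y\<^sup>2"
    unfolding R3 assms(1,4) \<kappa> a2 quad_def using nz
    by (simp add: field_simps power2_eq_square power3_eq_cube)
  \<comment> \<open>Inserting \<open>G2'\<close> turns the adiabatic factor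
    \<open>3 * \<gamma>\<close> into \<open>3 * (\<gamma> - 1)\<close>, which cancels against the
    heat term; only the \<open>R1''\<close> part keeps \<gamma>.\<close>
  have thermal: "P0 / (3 * (\<gamma> - 1) * T0) * (a * R0 * G2' + 3 * \<gamma> * P0 * a * R2')
      = a * P0\<^sup>2 / T0 * R2' + a\<^sup>2 * R0 * P0 ^ 3 / (3 * (\<gamma> - 1) * T0\<^sup>2) * R1''"
  proof -
    have "a * R0 * G2' + 3 * \<gamma> * P0 * a * R2' = (\<gamma> - 1) * (3 * P0 * a * R2') + a\<^sup>2 * R0 * P0\<^sup>2 / T0 * R1''"
      unfolding G2' using nz by (simp add: field_simps power2_eq_square)
    then show ?thesis
      using nz by (simp add: divide_simps power2_eq_square power3_eq_cube) (simp add: algebra_simps)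
  qed
  have "P3 = a\<^sup>2 * r3 + quad * y\<^sup>2 + (4 * a / (3 * R0) + a * P0\<^sup>2 / T0) * R2'
      + (a\<^sup>2 * R0 * P0 ^ 3 / (3 * (\<gamma> - 1) * T0\<^sup>2) - R0 * a\<^sup>2) * R1''"
    unfolding P3 G3 nonlinear thermal by (simp add: algebra_simps)
  \<comment> \<open>The dissipative coefficient of the second order recurs. It gives
    \<open>z1\<close> the weight \<open>a * \<Delta>\<close>, which matches the viscous term, so
    \<open>\<rho> 2\<close> will cancel from the momentum equation.\<close>
  also have "(4 * a / (3 * R0) + a * P0\<^sup>2 / T0) * R2' = a * \<Delta> * z1"
    unfolding assms(3) dissipation_balance[symmetric] by simp
  also have "(a\<^sup>2 * R0 * P0 ^ 3 / (3 * (\<gamma> - 1) * T0\<^sup>2) - R0 * a\<^sup>2) * R1'' = disp * y2"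
    unfolding assms(2) disp_def by (simp add: algebra_simps)
  finally show ?thesis .
qed

text \<open>The elimination produces the coefficients \<open>2 * a\<close>, \<open>disp\<close> and
  \<open>2 * a\<^sup>2 * \<Delta> + 2 * quad\<close>; the prescribed ones are a rescaling of them. A
  nonzero factor lets the equation be used in both directions.\<close>

lemma kdv_coefficients:
  fixes A B C :: real
  assumes "a = R0 powr (-3/2) * P0 powr (1/2) * \<Delta>"
    and A: "A = P0 powr (1/2) * R0 ^ 5 * (\<gamma> - 1)"
    and B: "B = 1/6 * R0 powr (1/2) * \<Delta>
               * (P0 * R0\<^sup>2 * \<Delta>\<^sup>2 * (\<gamma> - 1) - 16/27 * (9/4 * R0 ^ 3 + \<Delta>)\<^sup>2)"
    and C: "C = P0 * R0 powr (1/2) * \<Delta> ^ 3 * (\<gamma> - 1)"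
  obtains f where "f \<noteq> 0" and "A = f * (2 * a)" and "B = f * disp" and "C = f * (2 * a\<^sup>2 * \<Delta> + 2 * quad)"
proof -
  define s where "s = R0 powr (1/2)"
  have s: "s > 0" "s\<^sup>2 = R0"
    using pos by (simp_all add: s_def powr_half_sqrt)
  have s3: "R0 powr (-3/2) = 1 / s ^ 3"
    using pos by (simp add: s_def powr_minus_divide powr_powr flip: powr_numeral)
  \<comment> \<open>Forced by \<open>A = f * (2 * a)\<close>; it is nonzero because \<gamma> differs
    from 1.\<close>
  define f where "f = s * R0 ^ 6 * (\<gamma> - 1) / (2 * \<Delta>)"
  \<comment> \<open>Expresses the bracket of \<open>B\<close> through \<open>T0\<close>. Squaring
    brings the factor 9/16, and 16/27 times 9/16 is the 1/3 in \<open>disp\<close>.\<close>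
  have sq: "9/4 * R0 ^ 3 + \<Delta> = - (3 * P0\<^sup>2 * R0 * \<Delta>) / (4 * T0)"
    unfolding T0 using pos by (simp add: field_simps add_pos_pos)
  show ?thesis
  proof (rule that[of f])
    show "f \<noteq> 0"
      using s \<gamma> pos by (simp add: f_def)
    show "A = f * (2 * a)"
      unfolding f_def assms(1) A s3 using s(1) pos
      by (simp add: field_simps flip: s(2))
         (simp add: eval_nat_numeral)
    show "C = f * (2 * a\<^sup>2 * \<Delta> + 2 * quad)"
      unfolding f_def a2 C quad_def s_def[symmetric] using s(1) pos
      by (simp add: field_simps eval_nat_numeral)
    have disp_eq: "disp = \<Delta> / (3 * P0 * R0 ^ 4) * (P0\<^sup>2 * \<Delta> ^ 3 - P0 ^ 5 * \<Delta> ^ 3 / (3 * (\<gamma> - 1) * T0\<^sup>2))"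
      unfolding disp_def unfolding a2 \<kappa> using pos \<gamma> T0_neg
      by (simp add: divide_simps) (simp add: algebra_simps eval_nat_numeral)
    show "B = f * disp"
      unfolding f_def B sq disp_eq s_def[symmetric] using s(1) pos \<gamma> T0_neg
      by (simp add: divide_simps) (simp add: algebra_simps eval_nat_numeral)
  qed
qed

text \<open>The flux terms \<open>y1 * U1 + y * U1'\<close> cancel along with \<open>U3'\<close>,
  \<open>w1\<close> and \<open>z2\<close>. The surviving nonlinearity combines convection,
  \<open>2 * a\<^sup>2 * \<Delta>\<close>, with the curvature \<open>2 * quad\<close> of the
  pressure law; both equations contribute \<open>a * yt\<close>.\<close>

lemma third_order_sum:
  fixes y y1 y3 yt z2 w1 U1 U1' U1t U2'' U3' P3' :: real
  assumes "U1 = a * \<Delta> * y" "U1' = a * \<Delta> * y1" "U1t = a * \<Delta> * yt" "U2'' = a * \<Delta> * z2"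
    and "P3' = a\<^sup>2 * w1 + 2 * quad * y * y1 + a * \<Delta> * z2 + disp * y3"
  shows "a * (yt - a * w1 + 1 / \<Delta> * U3' + y1 * U1 + y * U1')
      + (1 / \<Delta> * U1t - a * (1 / \<Delta> * U3' + y1 * U1 + y * U1') + 2 * (1 / \<Delta>) * U1 * U1' + P3' - U2'')
    = 2 * a * yt + (2 * a\<^sup>2 * \<Delta> + 2 * quad) * y * y1 + disp * y3"
  unfolding assms using pos by (simp add: field_simps power2_eq_square)

end

section \<open>Relations, order equations and the KdV equation\<close>

context
  fixes \<gamma> X P0 T0 R0 a \<Delta> \<kappa> :: real and \<Omega> :: "(real \<times> real) set"
    and \<rho> u P G R :: "nat \<Rightarrow> real \<Rightarrow> real \<Rightarrow> real"
  assumes op: "open \<Omega>" and pos: "P0 > 0" "R0 > 0" "\<Delta> > 0" and \<gamma>: "\<gamma> \<noteq> 1"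
    and \<kappa>: "\<kappa> = \<Delta>\<^sup>2 / (3 * R0\<^sup>2)"
    and a2: "a\<^sup>2 = P0 * \<Delta>\<^sup>2 / R0 ^ 3" and T0: "T0 = - (3 * P0\<^sup>2 * R0 * \<Delta>) / (9 * R0 ^ 3 + 4 * \<Delta>)"
    and Delta: "\<Delta> = R0 ^ 3 - X + 1" and a: "a = wave_speed X P0 R0"
    and sm: "\<forall>j\<in>{1, 2}. smooth2_on \<Omega> (\<rho> j) \<and> smooth2_on \<Omega> (u j) \<and> smooth2_on \<Omega> (P j)
                             \<and> smooth2_on \<Omega> (G j) \<and> smooth2_on \<Omega> (R j)"
begin

lemma smooth_fields:
  "smooth2_on \<Omega> (\<rho> (Suc 0))" "smooth2_on \<Omega> (u (Suc 0))" "smooth2_on \<Omega> (P (Suc 0))" "smooth2_on \<Omega> (G (Suc 0))"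
  "smooth2_on \<Omega> (R (Suc 0))" "smooth2_on \<Omega> (\<rho> 2)" "smooth2_on \<Omega> (u 2)" "smooth2_on \<Omega> (P 2)" "smooth2_on \<Omega> (G 2)"
  "smooth2_on \<Omega> (R 2)"
  using sm by simp_all

lemma first_order_relations_iff:
  "first_order_relations X P0 R0 \<Omega> \<rho> u P G R \<longleftrightarrow> (\<forall>(\<xi>, \<tau>)\<in>\<Omega>.
     pd1 (u 1) \<xi> \<tau> = a * \<Delta> * pd1 (\<rho> 1) \<xi> \<tau> \<and> P 1 \<xi> \<tau> = G 1 \<xi> \<tau> \<and>
     G 1 \<xi> \<tau> = - (3 * P0 / R0) * R 1 \<xi> \<tau> \<and> R 1 \<xi> \<tau> = - \<kappa> * \<rho> 1 \<xi> \<tau> \<and>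
     pd1 (P 1) \<xi> \<tau> = a / \<Delta> * pd1 (u 1) \<xi> \<tau>)"
  unfolding first_order_relations_def rho0_def Delta[symmetric] a[symmetric] \<kappa>[symmetric] Let_def
  by simp

text \<open>The factor 1 in front of \<open>G 2\<close> gives the right-hand side the shape
  \<open>c * f + d * g\<close> in which it is differentiated later.\<close>

lemma second_order_relations_iff:
  "second_order_relations X P0 T0 R0 \<Omega> \<rho> u P G R \<longleftrightarrow> (\<forall>(\<xi>, \<tau>)\<in>\<Omega>.
     pd1 (u 2) \<xi> \<tau> = a * \<Delta> * pd1 (\<rho> 2) \<xi> \<tau> \<and>
     P 2 \<xi> \<tau> = 1 * G 2 \<xi> \<tau> + 4 * a / (3 * R0) * pd1 (R 1) \<xi> \<tau> \<and>
     G 2 \<xi> \<tau> = - (3 * P0 / R0) * R 2 \<xi> \<tau> + a * P0\<^sup>2 / T0 * pd1 (R 1) \<xi> \<tau> \<and>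
     R 2 \<xi> \<tau> = - \<kappa> * \<rho> 2 \<xi> \<tau>)"
  unfolding second_order_relations_def rho0_def Delta[symmetric] a[symmetric] \<kappa>[symmetric] Let_def
  by simp

lemma nonzero: "T0 \<noteq> 0" "\<gamma> - 1 \<noteq> 0" "P0 \<noteq> 0" "R0 \<noteq> 0" "\<Delta> \<noteq> 0"
  using T0_neg[OF pos \<gamma> \<kappa> a2 T0] \<gamma> pos by auto

lemma relations_of_leading:
  assumes l: "\<And>\<xi> \<tau>. (\<xi>, \<tau>) \<in> \<Omega> \<Longrightarrow> leading_equations \<gamma> P0 T0 R0 a \<Delta> \<rho> u P G R \<xi> \<tau>"
  shows "first_order_relations X P0 R0 \<Omega> \<rho> u P G R \<and> second_order_relations X P0 T0 R0 \<Omega> \<rho> u P G R"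
proof -
  have G1: "G 1 \<xi> \<tau> = - (3 * P0 / R0) * R 1 \<xi> \<tau>" if "(\<xi>, \<tau>) \<in> \<Omega>" for \<xi> \<tau>
  proof -
    have "G 1 \<xi> \<tau> / P0 + 3 * R 1 \<xi> \<tau> / R0 = 0"
      using l[OF that] nonzero unfolding leading_equations_def by simp
    then show ?thesis
      using nonzero by (simp add: field_simps)
  qed
  \<comment> \<open>The second gas equation contains this derivative; the isothermal relation may be
    differentiated because it holds throughout the open \<Omega>.\<close>
  have dG1: "pd1 (G 1) \<xi> \<tau> = - (3 * P0 / R0) * pd1 (R 1) \<xi> \<tau>" if "(\<xi>, \<tau>) \<in> \<Omega>" for \<xi> \<tau>
    using pd1_scaled[OF op _ G1 that] smooth_fields by simp
  have density: "r = - \<kappa> * y" if "\<Delta> * y + 3 * R0\<^sup>2 * (1 / \<Delta>) * r = 0" for r y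
    using that nonzero unfolding \<kappa> by (simp add: field_simps power2_eq_square)
  have G2: "G 2 \<xi> \<tau> = - (3 * P0 / R0) * R 2 \<xi> \<tau> + a * P0\<^sup>2 / T0 * pd1 (R 1) \<xi> \<tau>"
    if "(\<xi>, \<tau>) \<in> \<Omega>" for \<xi> \<tau>
  proof -
    have "- a * R0 * pd1 (G 1) \<xi> \<tau> - 3 * \<gamma> * P0 * a * pd1 (R 1) \<xi> \<tau>
       + 3 * (\<gamma> - 1) * T0 * (G 2 \<xi> \<tau> / P0 + 3 * R 2 \<xi> \<tau> / R0) = 0"
      using l[OF that] unfolding leading_equations_def by blast
    then have "3 * (\<gamma> - 1) * T0 * (G 2 \<xi> \<tau> / P0 + 3 * R 2 \<xi> \<tau> / R0)
        = a * R0 * pd1 (G 1) \<xi> \<tau> + 3 * \<gamma> * P0 * a * pd1 (R 1) \<xi> \<tau>"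
      by linarith
    \<comment> \<open>The isothermal first order reduces \<open>3 * \<gamma>\<close> to
      \<open>3 * (\<gamma> - 1)\<close>, the factor of the heat term, so \<gamma> drops out of the
      relation.\<close>
    also have "\<dots> = 3 * (\<gamma> - 1) * (P0 * a * pd1 (R 1) \<xi> \<tau>)"
      unfolding dG1[OF that] using nonzero(3,4) by (simp add: algebra_simps)
    finally have "3 * (\<gamma> - 1) * (T0 * (G 2 \<xi> \<tau> / P0 + 3 * R 2 \<xi> \<tau> / R0)) = 3 * (\<gamma> - 1) * (P0 * a * pd1 (R 1) \<xi> \<tau>)"
      by (simp only: mult.assoc)
    then have "T0 * (G 2 \<xi> \<tau> / P0 + 3 * R 2 \<xi> \<tau> / R0) = P0 * a * pd1 (R 1) \<xi> \<tau>"
      using nonzero(2) by (simp add: mult.assoc)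
    then have E: "G 2 \<xi> \<tau> / P0 = P0 * a * pd1 (R 1) \<xi> \<tau> / T0 - 3 * R 2 \<xi> \<tau> / R0"
      using nonzero(1) by (simp add: field_simps)
    have "G 2 \<xi> \<tau> = P0 * (G 2 \<xi> \<tau> / P0)"
      using nonzero(3) by simp
    then show ?thesis
      unfolding E by (simp add: algebra_simps power2_eq_square)
  qed
  have "first_order_relations X P0 R0 \<Omega> \<rho> u P G R"
    unfolding first_order_relations_iff
  proof (clarify, intro conjI)
    fix \<xi> \<tau> assume mem: "(\<xi>, \<tau>) \<in> \<Omega>"
    show "R 1 \<xi> \<tau> = - \<kappa> * \<rho> 1 \<xi> \<tau>"
      using l[OF mem] density unfolding leading_equations_def by blast
    have "- a * (1 / \<Delta>) * pd1 (u 1) \<xi> \<tau> + pd1 (P 1) \<xi> \<tau> = 0"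
      using l[OF mem] unfolding leading_equations_def by blast
    then show "pd1 (P 1) \<xi> \<tau> = a / \<Delta> * pd1 (u 1) \<xi> \<tau>"
      by simp
    show "pd1 (u 1) \<xi> \<tau> = a * \<Delta> * pd1 (\<rho> 1) \<xi> \<tau>" "P 1 \<xi> \<tau> = G 1 \<xi> \<tau>"
      using l[OF mem] nonzero unfolding leading_equations_def by (simp_all add: field_simps)
  qed (rule G1)
  moreover have "second_order_relations X P0 T0 R0 \<Omega> \<rho> u P G R"
    unfolding second_order_relations_iff
  proof (clarify, intro conjI)
    fix \<xi> \<tau> assume mem: "(\<xi>, \<tau>) \<in> \<Omega>"
    show "R 2 \<xi> \<tau> = - \<kappa> * \<rho> 2 \<xi> \<tau>"
      using l[OF mem] density unfolding leading_equations_def by blast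
    show "pd1 (u 2) \<xi> \<tau> = a * \<Delta> * pd1 (\<rho> 2) \<xi> \<tau>"
      "P 2 \<xi> \<tau> = 1 * G 2 \<xi> \<tau> + 4 * a / (3 * R0) * pd1 (R 1) \<xi> \<tau>"
      using l[OF mem] nonzero unfolding leading_equations_def by (simp_all add: field_simps)
  qed (rule G2)
  ultimately show ?thesis ..
qed

context
  assumes first: "first_order_relations X P0 R0 \<Omega> \<rho> u P G R"
    and second: "second_order_relations X P0 T0 R0 \<Omega> \<rho> u P G R"
begin

lemma relations:
  assumes "(\<xi>, \<tau>) \<in> \<Omega>"
  shows "pd1 (u 1) \<xi> \<tau> = a * \<Delta> * pd1 (\<rho> 1) \<xi> \<tau>" "P 1 \<xi> \<tau> = G 1 \<xi> \<tau>"
    "G 1 \<xi> \<tau> = - (3 * P0 / R0) * R 1 \<xi> \<tau>" "R 1 \<xi> \<tau> = - \<kappa> * \<rho> 1 \<xi> \<tau>"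
    "pd1 (P 1) \<xi> \<tau> = a / \<Delta> * pd1 (u 1) \<xi> \<tau>"
    "pd1 (u 2) \<xi> \<tau> = a * \<Delta> * pd1 (\<rho> 2) \<xi> \<tau>"
    "P 2 \<xi> \<tau> = 1 * G 2 \<xi> \<tau> + 4 * a / (3 * R0) * pd1 (R 1) \<xi> \<tau>"
    "G 2 \<xi> \<tau> = - (3 * P0 / R0) * R 2 \<xi> \<tau> + a * P0\<^sup>2 / T0 * pd1 (R 1) \<xi> \<tau>"
    "R 2 \<xi> \<tau> = - \<kappa> * \<rho> 2 \<xi> \<tau>"
  using first second assms unfolding first_order_relations_iff second_order_relations_iff by auto

lemma relations_pd1:
  assumes "(\<xi>, \<tau>) \<in> \<Omega>"
  shows "pd1 (R 1) \<xi> \<tau> = - \<kappa> * pd1 (\<rho> 1) \<xi> \<tau>"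
    and "pd1 (pd1 (R 1)) \<xi> \<tau> = - \<kappa> * pd1 (pd1 (\<rho> 1)) \<xi> \<tau>"
    and "pd1 (G 1) \<xi> \<tau> = - (3 * P0 / R0) * pd1 (R 1) \<xi> \<tau>"
    and "pd1 (pd1 (u 1)) \<xi> \<tau> = a * \<Delta> * pd1 (pd1 (\<rho> 1)) \<xi> \<tau>"
    and "pd1 (R 2) \<xi> \<tau> = - \<kappa> * pd1 (\<rho> 2) \<xi> \<tau>"
    and "pd1 (pd1 (u 2)) \<xi> \<tau> = a * \<Delta> * pd1 (pd1 (\<rho> 2)) \<xi> \<tau>"
    and "pd1 (G 2) \<xi> \<tau> = - (3 * P0 / R0) * pd1 (R 2) \<xi> \<tau> + a * P0\<^sup>2 / T0 * pd1 (pd1 (R 1)) \<xi> \<tau>"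
    and "pd1 (P 2) \<xi> \<tau> = 1 * pd1 (G 2) \<xi> \<tau> + 4 * a / (3 * R0) * pd1 (pd1 (R 1)) \<xi> \<tau>"
proof -
  have dR1: "pd1 (R 1) \<xi> \<tau> = - \<kappa> * pd1 (\<rho> 1) \<xi> \<tau>" if "(\<xi>, \<tau>) \<in> \<Omega>" for \<xi> \<tau>
    by (rule pd1_scaled[OF op _ relations(4) that]) (simp_all add: smooth_fields)
  from dR1[OF assms] show "pd1 (R 1) \<xi> \<tau> = - \<kappa> * pd1 (\<rho> 1) \<xi> \<tau>" .
  show "pd1 (pd1 (R 1)) \<xi> \<tau> = - \<kappa> * pd1 (pd1 (\<rho> 1)) \<xi> \<tau>"
    by (rule pd1_scaled[OF op _ dR1 assms]) (simp_all add: smooth_fields smooth2_on_pd1)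
  show "pd1 (G 1) \<xi> \<tau> = - (3 * P0 / R0) * pd1 (R 1) \<xi> \<tau>"
    by (rule pd1_scaled[OF op _ relations(3) assms]) (simp_all add: smooth_fields)
  show "pd1 (pd1 (u 1)) \<xi> \<tau> = a * \<Delta> * pd1 (pd1 (\<rho> 1)) \<xi> \<tau>"
    by (rule pd1_scaled[OF op _ relations(1) assms]) (simp_all add: smooth_fields smooth2_on_pd1)
  show "pd1 (R 2) \<xi> \<tau> = - \<kappa> * pd1 (\<rho> 2) \<xi> \<tau>"
    by (rule pd1_scaled[OF op _ relations(9) assms]) (simp_all add: smooth_fields)
  show "pd1 (pd1 (u 2)) \<xi> \<tau> = a * \<Delta> * pd1 (pd1 (\<rho> 2)) \<xi> \<tau>"
    by (rule pd1_scaled[OF op _ relations(6) assms]) (simp_all add: smooth_fields smooth2_on_pd1)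
  show "pd1 (G 2) \<xi> \<tau> = - (3 * P0 / R0) * pd1 (R 2) \<xi> \<tau> + a * P0\<^sup>2 / T0 * pd1 (pd1 (R 1)) \<xi> \<tau>"
    by (rule pd1_combination[OF op _ _ relations(8) assms]) (simp_all add: smooth_fields smooth2_on_pd1)
  show "pd1 (P 2) \<xi> \<tau> = 1 * pd1 (G 2) \<xi> \<tau> + 4 * a / (3 * R0) * pd1 (pd1 (R 1)) \<xi> \<tau>"
    by (rule pd1_combination[OF op _ _ relations(7) assms]) (simp_all add: smooth_fields smooth2_on_pd1)
qed

text \<open>There are ten equations against nine relations, and the surplus one is the second
  momentum equation. Its \<open>pd1 (\<rho> 2)\<close> part vanishes because \<open>a\<close> is the
  linear wave speed, its \<open>pd1 (pd1 (\<rho> 1))\<close> part by the choice of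
  \<open>T0\<close>.\<close>

lemma leading_of_relations:
  assumes "(\<xi>, \<tau>) \<in> \<Omega>"
  shows "leading_equations \<gamma> P0 T0 R0 a \<Delta> \<rho> u P G R \<xi> \<tau>"
  unfolding leading_equations_def
proof (intro conjI)
  note rel = relations[OF assms] and drel = relations_pd1[OF assms]
  have density: "\<Delta> * y + 3 * R0\<^sup>2 * (1 / \<Delta>) * (- \<kappa> * y) = 0" for y
    using nonzero by (simp add: \<kappa> field_simps power2_eq_square)
  show "\<Delta> * \<rho> 1 \<xi> \<tau> + 3 * R0\<^sup>2 * (1 / \<Delta>) * R 1 \<xi> \<tau> = 0" "\<Delta> * \<rho> 2 \<xi> \<tau> + 3 * R0\<^sup>2 * (1 / \<Delta>) * R 2 \<xi> \<tau> = 0"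
    unfolding rel(4,9) by (rule density)+
  show "- a * pd1 (\<rho> 1) \<xi> \<tau> + 1 / \<Delta> * pd1 (u 1) \<xi> \<tau> = 0" "- a * pd1 (\<rho> 2) \<xi> \<tau> + 1 / \<Delta> * pd1 (u 2) \<xi> \<tau> = 0"
    using nonzero by (simp_all add: rel(1,6)[simplified])
  show "- a * (1 / \<Delta>) * pd1 (u 1) \<xi> \<tau> + pd1 (P 1) \<xi> \<tau> = 0"
    unfolding rel(5) by simp
  show "R0 * (P 1 \<xi> \<tau> - G 1 \<xi> \<tau>) = 0" "R0 * (P 2 \<xi> \<tau> - G 2 \<xi> \<tau>) - 4/3 * a * pd1 (R 1) \<xi> \<tau> = 0"
    unfolding rel(2,7) using nonzero by simp_all
  show "3 * (\<gamma> - 1) * T0 * (G 1 \<xi> \<tau> / P0 + 3 * R 1 \<xi> \<tau> / R0) = 0"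
    unfolding rel(3) using nonzero by simp
  show "- a * R0 * pd1 (G 1) \<xi> \<tau> - 3 * \<gamma> * P0 * a * pd1 (R 1) \<xi> \<tau>
       + 3 * (\<gamma> - 1) * T0 * (G 2 \<xi> \<tau> / P0 + 3 * R 2 \<xi> \<tau> / R0) = 0"
    unfolding rel(8) drel(3) using nonzero by (simp add: field_simps power2_eq_square)
  have "- a * (1 / \<Delta>) * pd1 (u 2) \<xi> \<tau> + pd1 (P 2) \<xi> \<tau> - pd1 (pd1 (u 1)) \<xi> \<tau>
      = (3 * P0 / R0 * \<kappa> - a\<^sup>2) * pd1 (\<rho> 2) \<xi> \<tau>
        + (- \<kappa> * (4 * a / (3 * R0) + a * P0\<^sup>2 / T0) - a * \<Delta>) * pd1 (pd1 (\<rho> 1)) \<xi> \<tau>"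
    unfolding rel(6) drel(8) drel(7) drel(2,4,5) using nonzero(5)
    by (simp add: algebra_simps power2_eq_square)
  also have "3 * P0 / R0 * \<kappa> - a\<^sup>2 = 0"
    unfolding a2 \<kappa> by (simp add: power2_eq_square power3_eq_cube)
  also note dissipation_balance[OF pos \<gamma> \<kappa> a2 T0]
  finally show "- a * (1 / \<Delta>) * pd1 (u 2) \<xi> \<tau> + pd1 (P 2) \<xi> \<tau> - pd1 (pd1 (u 1)) \<xi> \<tau> = 0"
    by simp
qed

context
  assumes u1: "\<forall>(\<xi>, \<tau>)\<in>\<Omega>. u 1 \<xi> \<tau> = a * \<Delta> * \<rho> 1 \<xi> \<tau>"
begin

lemma u1_eq: "(\<xi>, \<tau>) \<in> \<Omega> \<Longrightarrow> u 1 \<xi> \<tau> = a * \<Delta> * \<rho> 1 \<xi> \<tau>"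
  using u1 by auto

text \<open>The third order involves \<open>u 1\<close> itself and its \<tau>-derivative, which a
  relation between \<xi>-derivatives leaves open: an extra summand c(\<tau>) in \<open>u 1\<close>
  would add \<open>2 * a * c * pd1 (\<rho> 1)\<close> and c'(\<tau>) / \<Delta> to the final
  equation.\<close>

lemma pd2_u1: "(\<xi>, \<tau>) \<in> \<Omega> \<Longrightarrow> pd2 (u 1) \<xi> \<tau> = a * \<Delta> * pd2 (\<rho> 1) \<xi> \<tau>"
  using pd2_cong_on[OF op u1_eq] pd2_cmult_at[OF smooth_fields(1)] by simp

text \<open>An identity rather than an implication, so that it serves both directions: two vanishing
  brackets yield the KdV equation, and the KdV equation with a vanishing first bracket yields the
  second. \<open>u3\<close> enters only through \<open>pd1 u3\<close>, which cancels.\<close>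

lemma conservation_laws_third_order:
  assumes mem: "(\<xi>, \<tau>) \<in> \<Omega>" and "smooth2_on \<Omega> \<rho>3"
    and P3: "\<And>\<xi> \<tau>. (\<xi>, \<tau>) \<in> \<Omega> \<Longrightarrow> P3 \<xi> \<tau> = a\<^sup>2 * \<rho>3 \<xi> \<tau> + quad P0 R0 \<Delta> * (\<rho> 1 \<xi> \<tau>)\<^sup>2
       + a * \<Delta> * pd1 (\<rho> 2) \<xi> \<tau> + disp \<gamma> P0 T0 R0 a \<kappa> * pd1 (pd1 (\<rho> 1)) \<xi> \<tau>"
  shows "a * (pd2 (\<rho> 1) \<xi> \<tau> - a * pd1 \<rho>3 \<xi> \<tau> + 1 / \<Delta> * pd1 u3 \<xi> \<tau>
       + pd1 (\<rho> 1) \<xi> \<tau> * u 1 \<xi> \<tau> + \<rho> 1 \<xi> \<tau> * pd1 (u 1) \<xi> \<tau>)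
     + (1 / \<Delta> * pd2 (u 1) \<xi> \<tau>
       - a * (1 / \<Delta> * pd1 u3 \<xi> \<tau> + pd1 (\<rho> 1) \<xi> \<tau> * u 1 \<xi> \<tau> + \<rho> 1 \<xi> \<tau> * pd1 (u 1) \<xi> \<tau>)
       + 2 * (1 / \<Delta>) * u 1 \<xi> \<tau> * pd1 (u 1) \<xi> \<tau> + pd1 P3 \<xi> \<tau> - pd1 (pd1 (u 2)) \<xi> \<tau>)
     = 2 * a * pd2 (\<rho> 1) \<xi> \<tau> + (2 * a\<^sup>2 * \<Delta> + 2 * quad P0 R0 \<Delta>) * \<rho> 1 \<xi> \<tau> * pd1 (\<rho> 1) \<xi> \<tau>
       + disp \<gamma> P0 T0 R0 a \<kappa> * pd1 (pd1 (pd1 (\<rho> 1))) \<xi> \<tau>"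
proof (rule third_order_sum[OF pos \<gamma> \<kappa> a2 T0 u1_eq[OF mem] relations(1)[OF mem] pd2_u1[OF mem] relations_pd1(6)[OF mem]])
  let ?Q = "\<lambda>\<xi> \<tau>. a\<^sup>2 * \<rho>3 \<xi> \<tau> + quad P0 R0 \<Delta> * (\<rho> 1 \<xi> \<tau>)\<^sup>2
       + a * \<Delta> * pd1 (\<rho> 2) \<xi> \<tau> + disp \<gamma> P0 T0 R0 a \<kappa> * pd1 (pd1 (\<rho> 1)) \<xi> \<tau>"
  note has_pd1 = smooth2_on_has_pd1[OF smooth_fields(1) mem] smooth2_on_has_pd1[OF smooth_fields(2) mem]
    smooth2_on_has_pd1[OF smooth2_on_pd1[OF smooth_fields(6)] mem]
    smooth2_on_has_pd1[OF smooth2_on_pd1[OF smooth2_on_pd1[OF smooth_fields(1)]] mem] smooth2_on_has_pd1[OF assms(2) mem]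
  have "pd1 P3 \<xi> \<tau> = pd1 ?Q \<xi> \<tau>"
    by (rule pd1_cong_on[OF op P3 mem])
  also have "\<dots> = a\<^sup>2 * pd1 \<rho>3 \<xi> \<tau> + 2 * quad P0 R0 \<Delta> * \<rho> 1 \<xi> \<tau> * pd1 (\<rho> 1) \<xi> \<tau>
      + a * \<Delta> * pd1 (pd1 (\<rho> 2)) \<xi> \<tau> + disp \<gamma> P0 T0 R0 a \<kappa> * pd1 (pd1 (pd1 (\<rho> 1))) \<xi> \<tau>"
    unfolding pd1_def[of ?Q]
    by (rule DERIV_imp_deriv)
       (auto intro!: derivative_eq_intros has_pd1)
  finally show "pd1 P3 \<xi> \<tau> = a\<^sup>2 * pd1 \<rho>3 \<xi> \<tau> + 2 * quad P0 R0 \<Delta> * \<rho> 1 \<xi> \<tau> * pd1 (\<rho> 1) \<xi> \<tau>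
      + a * \<Delta> * pd1 (pd1 (\<rho> 2)) \<xi> \<tau> + disp \<gamma> P0 T0 R0 a \<kappa> * pd1 (pd1 (pd1 (\<rho> 1))) \<xi> \<tau>" .
qed

context
  fixes A B C f :: real
  assumes f: "f \<noteq> 0" and A: "A = f * (2 * a)" and B: "B = f * disp \<gamma> P0 T0 R0 a \<kappa>"
    and C: "C = f * (2 * a\<^sup>2 * \<Delta> + 2 * quad P0 R0 \<Delta>)"
begin

lemma kdv_of_third:
  assumes sm3: "smooth2_on \<Omega> \<rho>3"
    and third: "\<And>\<xi> \<tau>. (\<xi>, \<tau>) \<in> \<Omega> \<Longrightarrow> third_equations \<gamma> P0 T0 R0 a \<Delta> (\<rho>(3 := \<rho>3)) (u(3 := u3)) (P(3 := P3))
        (G(3 := G3)) (R(3 := R3)) \<xi> \<tau>"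
  shows "kdv_solution (- A) B C \<Omega> (\<rho> 1)"
proof -
  have P3: "P3 \<xi> \<tau> = a\<^sup>2 * \<rho>3 \<xi> \<tau> + quad P0 R0 \<Delta> * (\<rho> 1 \<xi> \<tau>)\<^sup>2
       + a * \<Delta> * pd1 (\<rho> 2) \<xi> \<tau> + disp \<gamma> P0 T0 R0 a \<kappa> * pd1 (pd1 (\<rho> 1)) \<xi> \<tau>"
    if mem: "(\<xi>, \<tau>) \<in> \<Omega>" for \<xi> \<tau>
    by (rule third_pressure[OF pos \<gamma> \<kappa> a2 T0 relations(4)[OF mem] relations_pd1(2,5)[OF mem] relations(3,2)[OF mem]
          relations_pd1(7)[OF mem], where ?R3.0 = "R3 \<xi> \<tau>" and ?G3.0 = "G3 \<xi> \<tau>"])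
       (use third[OF mem] in \<open>simp_all add: third_equations_def\<close>)
  show ?thesis
    unfolding kdv_solution_def
  proof clarify
    fix \<xi> \<tau> assume mem: "(\<xi>, \<tau>) \<in> \<Omega>"
    have mass: "pd2 (\<rho> 1) \<xi> \<tau> - a * pd1 \<rho>3 \<xi> \<tau> + 1 / \<Delta> * pd1 u3 \<xi> \<tau>
        + pd1 (\<rho> 1) \<xi> \<tau> * u 1 \<xi> \<tau> + \<rho> 1 \<xi> \<tau> * pd1 (u 1) \<xi> \<tau> = 0"
      and momentum: "1 / \<Delta> * pd2 (u 1) \<xi> \<tau>
       - a * (1 / \<Delta> * pd1 u3 \<xi> \<tau> + pd1 (\<rho> 1) \<xi> \<tau> * u 1 \<xi> \<tau> + \<rho> 1 \<xi> \<tau> * pd1 (u 1) \<xi> \<tau>)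
       + 2 * (1 / \<Delta>) * u 1 \<xi> \<tau> * pd1 (u 1) \<xi> \<tau> + pd1 P3 \<xi> \<tau> - pd1 (pd1 (u 2)) \<xi> \<tau> = 0"
      using third[OF mem] by (simp_all add: third_equations_def)
    have "2 * a * pd2 (\<rho> 1) \<xi> \<tau> + (2 * a\<^sup>2 * \<Delta> + 2 * quad P0 R0 \<Delta>) * \<rho> 1 \<xi> \<tau> * pd1 (\<rho> 1) \<xi> \<tau>
       + disp \<gamma> P0 T0 R0 a \<kappa> * pd1 (pd1 (pd1 (\<rho> 1))) \<xi> \<tau> = 0"
      using conservation_laws_third_order[OF mem sm3 P3, of u3] unfolding mass momentum by simp
    then have "f * (2 * a * pd2 (\<rho> 1) \<xi> \<tau> + (2 * a\<^sup>2 * \<Delta> + 2 * quad P0 R0 \<Delta>) * \<rho> 1 \<xi> \<tau> * pd1 (\<rho> 1) \<xi> \<tau>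
       + disp \<gamma> P0 T0 R0 a \<kappa> * pd1 (pd1 (pd1 (\<rho> 1))) \<xi> \<tau>) = 0"
      by simp
    then show "- A * pd2 (\<rho> 1) \<xi> \<tau> = B * pd1 (pd1 (pd1 (\<rho> 1))) \<xi> \<tau> + C * \<rho> 1 \<xi> \<tau> * pd1 (\<rho> 1) \<xi> \<tau>"
      unfolding A B C by (simp add: algebra_simps)
  qed
qed

text \<open>The KdV equation is what makes the \<open>\<xi>\<close>-derivative prescribed for \<open>u\<^sup>(\<^sup>3\<^sup>)\<close> exact: \<open>\<rho>\<^sup>(\<^sup>1\<^sup>)\<^sub>\<tau>\<close> is the
  \<open>\<xi>\<close>-derivative of a polynomial in \<open>\<rho>\<^sup>(\<^sup>1\<^sup>)\<close> and \<open>\<rho>\<^sup>(\<^sup>1\<^sup>)\<^sub>\<xi>\<^sub>\<xi>\<close>. So no integration over \<open>\<Omega>\<close>, whose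
  \<open>\<xi>\<close>-sections may be disconnected, is needed.\<close>

lemma third_of_kdv:
  assumes kdv: "kdv_solution (- A) B C \<Omega> (\<rho> 1)"
  shows "\<exists>\<rho>3 u3 P3 G3 R3. smooth2_on \<Omega> \<rho>3 \<and> smooth2_on \<Omega> u3 \<and> smooth2_on \<Omega> P3 \<and>
      smooth2_on \<Omega> G3 \<and> smooth2_on \<Omega> R3 \<and>
      (\<forall>(\<xi>, \<tau>)\<in>\<Omega>. third_equations \<gamma> P0 T0 R0 a \<Delta> (\<rho>(3 := \<rho>3)) (u(3 := u3)) (P(3 := P3))
        (G(3 := G3)) (R(3 := R3)) \<xi> \<tau>)"
proof -
  have "a \<noteq> 0"
  proof
    assume "a = 0"
    with a2 have "P0 * \<Delta>\<^sup>2 / R0 ^ 3 = 0"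
      by simp
    then show False
      using nonzero by simp
  qed
  then have A0: "A \<noteq> 0"
    using f by (simp add: A)
  \<comment> \<open>With \<open>\<rho>3\<close> equal to zero, the density, gas and pressure
    equations are solved in turn for \<open>R3\<close>, \<open>G3\<close> and
    \<open>P3\<close>.\<close>
  define R3 where "R3 = (\<lambda>\<xi> \<tau>. - (\<Delta> / (3 * R0\<^sup>2)) *
      (3 * R0\<^sup>2 * R 1 \<xi> \<tau> * \<rho> 1 \<xi> \<tau> + 3 * R0 / \<Delta> * (R 1 \<xi> \<tau>)\<^sup>2))"
  define G3 where "G3 = (\<lambda>\<xi> \<tau>. P0 / (3 * (\<gamma> - 1) * T0) * (a * R0 * pd1 (G 2) \<xi> \<tau> + 3 * \<gamma> * P0 * a * pd1 (R 2) \<xi> \<tau>)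
      - 3 * P0 / R0 * R3 \<xi> \<tau> - 3 * P0 / R0\<^sup>2 * (R 1 \<xi> \<tau>)\<^sup>2 - 3 / R0 * G 1 \<xi> \<tau> * R 1 \<xi> \<tau>)"
  define P3 where "P3 = (\<lambda>\<xi> \<tau>. G3 \<xi> \<tau> - R0 * a\<^sup>2 * pd1 (pd1 (R 1)) \<xi> \<tau> + 4/3 * a / R0 * pd1 (R 2) \<xi> \<tau>)"
  \<comment> \<open>The first two terms are a \<xi>-primitive of \<open>- pd2 (\<rho> 1)\<close>
    under the KdV equation; the last one compensates the flux \<open>\<rho> 1 * u 1\<close> in the
    mass equation.\<close>
  define u3 where "u3 = (\<lambda>\<xi> \<tau>. \<Delta> * (B / A * pd1 (pd1 (\<rho> 1)) \<xi> \<tau> + C / (2 * A) * (\<rho> 1 \<xi> \<tau>)\<^sup>2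
      - \<rho> 1 \<xi> \<tau> * u 1 \<xi> \<tau>))"
  \<comment> \<open>The third density coefficient is free: it parametrises the kernel of the
    singular linear part.\<close>
  define \<rho>3 :: "real \<Rightarrow> real \<Rightarrow> real" where "\<rho>3 = (\<lambda>_ _. 0)"
  note intros = smooth2_on_mult[OF op] smooth2_on_add[OF op] smooth2_on_diff[OF op] smooth2_on_power[OF op]
    smooth2_on_const smooth2_on_pd1 smooth_fields[folded One_nat_def]
  have smR: "smooth2_on \<Omega> R3"
    unfolding R3_def by (intro intros)
  have smG: "smooth2_on \<Omega> G3"
    unfolding G3_def by (intro intros smR)
  have smP: "smooth2_on \<Omega> P3"
    unfolding P3_def by (intro intros smG)
  have smu: "smooth2_on \<Omega> u3"
    unfolding u3_def by (intro intros)
  have sm\<rho>: "smooth2_on \<Omega> \<rho>3"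
    unfolding \<rho>3_def by (rule smooth2_on_const)
  have s: "R0 * (P3 \<xi> \<tau> - G3 \<xi> \<tau> + R0 * a\<^sup>2 * pd1 (pd1 (R 1)) \<xi> \<tau>)
       + R 1 \<xi> \<tau> * (P 1 \<xi> \<tau> - G 1 \<xi> \<tau>) - 4/3 * a * pd1 (R 2) \<xi> \<tau> = 0" if "(\<xi>, \<tau>) \<in> \<Omega>" for \<xi> \<tau>
    unfolding P3_def relations(2)[OF that] using nonzero by (simp add: algebra_simps)
  have g: "- a * R0 * pd1 (G 2) \<xi> \<tau> - 3 * \<gamma> * P0 * a * pd1 (R 2) \<xi> \<tau>
       + 3 * (\<gamma> - 1) * T0 * (G3 \<xi> \<tau> / P0 + 3 * R3 \<xi> \<tau> / R0
            + 3 * (R 1 \<xi> \<tau>)\<^sup>2 / R0\<^sup>2 + 3 * G 1 \<xi> \<tau> * R 1 \<xi> \<tau> / (P0 * R0)) = 0" for \<xi> \<tau>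
  proof -
    define K where "K = 3 * (\<gamma> - 1) * T0"
    have K: "K \<noteq> 0"
      using nonzero by (simp add: K_def)
    have "G3 \<xi> \<tau> / P0 + 3 * R3 \<xi> \<tau> / R0 + 3 * (R 1 \<xi> \<tau>)\<^sup>2 / R0\<^sup>2 + 3 * G 1 \<xi> \<tau> * R 1 \<xi> \<tau> / (P0 * R0)
        = (a * R0 * pd1 (G 2) \<xi> \<tau> + 3 * \<gamma> * P0 * a * pd1 (R 2) \<xi> \<tau>) / K"
      unfolding G3_def K_def[symmetric] using nonzero by (simp add: diff_divide_distrib add_divide_distrib)
    then show ?thesis
      unfolding K_def[symmetric] using K by simp
  qed
  have d: "\<Delta> * \<rho>3 \<xi> \<tau> + 3 * R0\<^sup>2 * R 1 \<xi> \<tau> * \<rho> 1 \<xi> \<tau>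
       + (3 * R0\<^sup>2 * R3 \<xi> \<tau> + 3 * R0 * (R 1 \<xi> \<tau>)\<^sup>2) * (1 / \<Delta>) = 0" for \<xi> \<tau>
    unfolding \<rho>3_def R3_def using nonzero by (simp add: field_simps)
  have P3: "P3 \<xi> \<tau> = a\<^sup>2 * \<rho>3 \<xi> \<tau> + quad P0 R0 \<Delta> * (\<rho> 1 \<xi> \<tau>)\<^sup>2
       + a * \<Delta> * pd1 (\<rho> 2) \<xi> \<tau> + disp \<gamma> P0 T0 R0 a \<kappa> * pd1 (pd1 (\<rho> 1)) \<xi> \<tau>"
    if mem: "(\<xi>, \<tau>) \<in> \<Omega>" for \<xi> \<tau>
    by (rule third_pressure[OF pos \<gamma> \<kappa> a2 T0 relations(4)[OF mem] relations_pd1(2,5)[OF mem] relations(3,2)[OF mem]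
          relations_pd1(7)[OF mem] s[OF mem] g d])
  have "third_equations \<gamma> P0 T0 R0 a \<Delta> (\<rho>(3 := \<rho>3)) (u(3 := u3)) (P(3 := P3)) (G(3 := G3)) (R(3 := R3)) \<xi> \<tau>"
    if mem: "(\<xi>, \<tau>) \<in> \<Omega>" for \<xi> \<tau>
  proof -
    have eq: "- A * pd2 (\<rho> 1) \<xi> \<tau> = B * pd1 (pd1 (pd1 (\<rho> 1))) \<xi> \<tau> + C * \<rho> 1 \<xi> \<tau> * pd1 (\<rho> 1) \<xi> \<tau>"
      using kdv mem unfolding kdv_solution_def by auto
    note has_pd1 = smooth2_on_has_pd1[OF smooth_fields(1) mem] smooth2_on_has_pd1[OF smooth_fields(2) mem]
      smooth2_on_has_pd1[OF smooth2_on_pd1[OF smooth_fields(6)] mem]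
      smooth2_on_has_pd1[OF smooth2_on_pd1[OF smooth2_on_pd1[OF smooth_fields(1)]] mem]
    have "pd1 u3 \<xi> \<tau> = \<Delta> * (B / A * pd1 (pd1 (pd1 (\<rho> 1))) \<xi> \<tau> + C / A * \<rho> 1 \<xi> \<tau> * pd1 (\<rho> 1) \<xi> \<tau>
        - (pd1 (\<rho> 1) \<xi> \<tau> * u 1 \<xi> \<tau> + \<rho> 1 \<xi> \<tau> * pd1 (u 1) \<xi> \<tau>))"
      unfolding pd1_def[of u3] unfolding u3_def
      using nonzero(5)
      by (intro DERIV_imp_deriv)
         (auto intro!: derivative_eq_intros has_pd1 simp: A0, simp add: field_simps A0)
    also have "B / A * pd1 (pd1 (pd1 (\<rho> 1))) \<xi> \<tau> + C / A * \<rho> 1 \<xi> \<tau> * pd1 (\<rho> 1) \<xi> \<tau> = - pd2 (\<rho> 1) \<xi> \<tau>"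
      using eq A0 by (simp add: field_simps)
    finally have mass: "pd2 (\<rho> 1) \<xi> \<tau> - a * pd1 \<rho>3 \<xi> \<tau> + 1 / \<Delta> * pd1 u3 \<xi> \<tau>
        + pd1 (\<rho> 1) \<xi> \<tau> * u 1 \<xi> \<tau> + \<rho> 1 \<xi> \<tau> * pd1 (u 1) \<xi> \<tau> = 0"
      using nonzero(5) by (simp add: \<rho>3_def)
    \<comment> \<open>The mass equation holds by the choice of \<open>u3\<close>, so the weighted
      sum reduces to the momentum equation, and the KdV equation makes that sum zero.\<close>
    have "f * (2 * a * pd2 (\<rho> 1) \<xi> \<tau> + (2 * a\<^sup>2 * \<Delta> + 2 * quad P0 R0 \<Delta>) * \<rho> 1 \<xi> \<tau> * pd1 (\<rho> 1) \<xi> \<tau>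
       + disp \<gamma> P0 T0 R0 a \<kappa> * pd1 (pd1 (pd1 (\<rho> 1))) \<xi> \<tau>) = 0"
      using eq unfolding A B C by (simp add: algebra_simps)
    then have "2 * a * pd2 (\<rho> 1) \<xi> \<tau> + (2 * a\<^sup>2 * \<Delta> + 2 * quad P0 R0 \<Delta>) * \<rho> 1 \<xi> \<tau> * pd1 (\<rho> 1) \<xi> \<tau>
       + disp \<gamma> P0 T0 R0 a \<kappa> * pd1 (pd1 (pd1 (\<rho> 1))) \<xi> \<tau> = 0"
      using f by simp
    then have momentum: "1 / \<Delta> * pd2 (u 1) \<xi> \<tau>
       - a * (1 / \<Delta> * pd1 u3 \<xi> \<tau> + pd1 (\<rho> 1) \<xi> \<tau> * u 1 \<xi> \<tau> + \<rho> 1 \<xi> \<tau> * pd1 (u 1) \<xi> \<tau>)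
       + 2 * (1 / \<Delta>) * u 1 \<xi> \<tau> * pd1 (u 1) \<xi> \<tau> + pd1 P3 \<xi> \<tau> - pd1 (pd1 (u 2)) \<xi> \<tau> = 0"
      using conservation_laws_third_order[OF mem sm\<rho> P3, of u3] unfolding mass by simp
    show ?thesis
      unfolding third_equations_def using mass momentum s[OF mem] g d by simp
  qed
  then show ?thesis
    using smR smG smP smu sm\<rho> by blast
qed

end

end

end

end

text \<open>The second part identifies the equation imposed by the third order, in the orientation
  of a right-going wave. It asks for some third coefficients because solvability is what the KdV
  equation characterises. Its premise on \<open>u 1\<close> fixes the function of \<tau> left open
  by the relation for \<open>pd1 (u 1)\<close>.\<close>

theorem proposition3p3:
  fixes \<gamma> X P0 T0 R0 \<alpha> \<beta> q k A B C :: real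
    and \<Omega> :: "(real \<times> real) set"
    and \<rho> u P G R :: "nat \<Rightarrow> real \<Rightarrow> real \<Rightarrow> real"
  assumes "P0 > 0" and "R0 > 0" and "0 < X" and "X < 1" and "\<gamma> \<noteq> 1"
    and "\<alpha> > 0" and "\<beta> > 0" and "q > 0" and "k > 0"
    and "\<alpha> = k" and "k = \<beta> / 2" and "\<beta> / 2 = q / 2"
    and "T0 = - (3 * P0\<^sup>2 * R0 * (R0 ^ 3 - X + 1)) / (13 * R0 ^ 3 - 4 * X + 4)"
    and "A = P0 powr (1/2) * R0 ^ 5 * (\<gamma> - 1)"
    and "B = 1/6 * R0 powr (1/2) * (R0 ^ 3 - X + 1)
               * (P0 * R0\<^sup>2 * (R0 ^ 3 - X + 1)\<^sup>2 * (\<gamma> - 1)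
                    - 16/27 * (13/4 * R0 ^ 3 - X + 1)\<^sup>2)"
    and "C = P0 * R0 powr (1/2) * (R0 ^ 3 - X + 1) ^ 3 * (\<gamma> - 1)"
    and "open \<Omega>"
    and "\<And>j. j \<in> {1, 2} \<Longrightarrow> smooth2_on \<Omega> (\<rho> j) \<and> smooth2_on \<Omega> (u j) \<and> smooth2_on \<Omega> (P j)
                             \<and> smooth2_on \<Omega> (G j) \<and> smooth2_on \<Omega> (R j)"
  shows "(kdv_solution A B C \<Omega> (\<rho> 1) \<longrightarrow>
            (lowest_orders_satisfied \<gamma> X P0 T0 R0 \<alpha> \<beta> q k 2 \<Omega> \<rho> u P G R \<longleftrightarrow>
               first_order_relations X P0 R0 \<Omega> \<rho> u P G R \<and>
               second_order_relations X P0 T0 R0 \<Omega> \<rho> u P G R))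
         \<and>
         (first_order_relations X P0 R0 \<Omega> \<rho> u P G R \<and>
          second_order_relations X P0 T0 R0 \<Omega> \<rho> u P G R \<and>
          (\<forall>(\<xi>, \<tau>)\<in>\<Omega>. u 1 \<xi> \<tau> = wave_speed X P0 R0 / rho0 X R0 * \<rho> 1 \<xi> \<tau>) \<longrightarrow>
            ((\<exists>\<rho>3 u3 P3 G3 R3.
                smooth2_on \<Omega> \<rho>3 \<and> smooth2_on \<Omega> u3 \<and> smooth2_on \<Omega> P3 \<and>
                smooth2_on \<Omega> G3 \<and> smooth2_on \<Omega> R3 \<and>
                lowest_orders_satisfied \<gamma> X P0 T0 R0 \<alpha> \<beta> q k 3 \<Omega>
                  (\<rho>(3 := \<rho>3)) (u(3 := u3)) (P(3 := P3)) (G(3 := G3)) (R(3 := R3)))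
             \<longleftrightarrow> kdv_solution (- A) B C \<Omega> (\<rho> 1)))"
proof -
  define \<Delta> where "\<Delta> = R0 ^ 3 - X + 1"
  define a where "a = wave_speed X P0 R0"
  define \<kappa> where "\<kappa> = \<Delta>\<^sup>2 / (3 * R0\<^sup>2)"
  have "R0 ^ 3 > 0"
    using assms(2) by simp
  with assms(4) have "\<Delta> > 0"
    unfolding \<Delta>_def by linarith
  with assms(1,2) have pos: "P0 > 0" "R0 > 0" "\<Delta> > 0" .
  have exponents: "\<alpha> = k" "\<beta> = 2 * k" "q = 2 * k"
    using assms(10-12) by auto
  have a_eq: "a = R0 powr (-3/2) * P0 powr (1/2) * \<Delta>"
    by (simp add: a_def wave_speed_def \<Delta>_def)
  have a2: "a\<^sup>2 = P0 * \<Delta>\<^sup>2 / R0 ^ 3"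
  proof -
    have "(R0 powr (-3/2))\<^sup>2 = 1 / R0 ^ 3" "(P0 powr (1/2))\<^sup>2 = P0"
      using pos by (simp_all add: power2_eq_square powr_minus_divide flip: powr_add powr_numeral)
    then show ?thesis
      by (simp add: a_eq power_mult_distrib)
  qed
  \<comment> \<open>13 is 9 + 4: the 4 stems from the viscous quotient in the bubble equation, the 9
    from the viscous term of the momentum equation.\<close>
  have T0: "T0 = - (3 * P0\<^sup>2 * R0 * \<Delta>) / (9 * R0 ^ 3 + 4 * \<Delta>)"
    unfolding assms(13) \<Delta>_def by (simp add: algebra_simps)
  have B: "B = 1/6 * R0 powr (1/2) * \<Delta> * (P0 * R0\<^sup>2 * \<Delta>\<^sup>2 * (\<gamma> - 1) - 16/27 * (9/4 * R0 ^ 3 + \<Delta>)\<^sup>2)"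
  proof -
    have "13/4 * R0 ^ 3 - X + 1 = 9/4 * R0 ^ 3 + \<Delta>"
      by (simp add: \<Delta>_def)
    then show ?thesis
      unfolding assms(15) \<Delta>_def[symmetric] by simp
  qed
  have C: "C = P0 * R0 powr (1/2) * \<Delta> ^ 3 * (\<gamma> - 1)"
    unfolding assms(16) \<Delta>_def ..
  obtain f where f: "f \<noteq> 0" "A = f * (2 * a)" "B = f * disp \<gamma> P0 T0 R0 a \<kappa>"
    "C = f * (2 * a\<^sup>2 * \<Delta> + 2 * quad P0 R0 \<Delta>)"
    using kdv_coefficients[OF pos assms(5) \<kappa>_def a2 T0 a_eq assms(14) B C] by blast
  have "\<forall>j\<in>{1, 2}. smooth2_on \<Omega> (\<rho> j) \<and> smooth2_on \<Omega> (u j) \<and> smooth2_on \<Omega> (P j)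
      \<and> smooth2_on \<Omega> (G j) \<and> smooth2_on \<Omega> (R j)"
    using assms(18) by blast
  note ctx = assms(17) pos assms(5) \<kappa>_def a2 T0 \<Delta>_def a_def this
  note lowest = lowest_orders_2_iff[OF assms(17,9) pos \<Delta>_def a_def _ refl]
    lowest_orders_3_iff[OF assms(17,9) pos \<Delta>_def a_def _ refl]
  have two: "lowest_orders_satisfied \<gamma> X P0 T0 R0 \<alpha> \<beta> q k 2 \<Omega> \<rho> u P G R \<longleftrightarrow>
      first_order_relations X P0 R0 \<Omega> \<rho> u P G R \<and> second_order_relations X P0 T0 R0 \<Omega> \<rho> u P G R"
  proof -
    have "lowest_orders_satisfied \<gamma> X P0 T0 R0 \<alpha> \<beta> q k 2 \<Omega> \<rho> u P G R \<longleftrightarrow>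
        (\<forall>(\<xi>, \<tau>)\<in>\<Omega>. leading_equations \<gamma> P0 T0 R0 a \<Delta> \<rho> u P G R \<xi> \<tau>)"
      unfolding exponents
    proof (rule lowest(1))
      show "smooth2_on \<Omega> (\<rho> j) \<and> smooth2_on \<Omega> (u j) \<and> smooth2_on \<Omega> (P j)
          \<and> smooth2_on \<Omega> (G j) \<and> smooth2_on \<Omega> (R j)" if "j \<in> {1..2}" for j
      proof -
        have "j \<in> {1, 2}"
          using that by auto
        then show ?thesis
          by (rule assms(18))
      qed
    qed
    moreover have "(\<forall>(\<xi>, \<tau>)\<in>\<Omega>. leading_equations \<gamma> P0 T0 R0 a \<Delta> \<rho> u P G R \<xi> \<tau>) \<longleftrightarrow>
        first_order_relations X P0 R0 \<Omega> \<rho> u P G R \<and> second_order_relations X P0 T0 R0 \<Omega> \<rho> u P G R"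
    proof
      assume "\<forall>(\<xi>, \<tau>)\<in>\<Omega>. leading_equations \<gamma> P0 T0 R0 a \<Delta> \<rho> u P G R \<xi> \<tau>"
      then show "first_order_relations X P0 R0 \<Omega> \<rho> u P G R \<and> second_order_relations X P0 T0 R0 \<Omega> \<rho> u P G R"
        by (intro relations_of_leading[OF ctx]) (drule (1) bspec, simp)
    next
      assume rel: "first_order_relations X P0 R0 \<Omega> \<rho> u P G R \<and> second_order_relations X P0 T0 R0 \<Omega> \<rho> u P G R"
      show "\<forall>(\<xi>, \<tau>)\<in>\<Omega>. leading_equations \<gamma> P0 T0 R0 a \<Delta> \<rho> u P G R \<xi> \<tau>"
        by (clarify, rule leading_of_relations[OF ctx rel[THEN conjunct1] rel[THEN conjunct2]])
    qed
    ultimately show ?thesis by simp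
  qed
  have three: "(\<exists>\<rho>3 u3 P3 G3 R3.
                smooth2_on \<Omega> \<rho>3 \<and> smooth2_on \<Omega> u3 \<and> smooth2_on \<Omega> P3 \<and>
                smooth2_on \<Omega> G3 \<and> smooth2_on \<Omega> R3 \<and>
                lowest_orders_satisfied \<gamma> X P0 T0 R0 \<alpha> \<beta> q k 3 \<Omega>
                  (\<rho>(3 := \<rho>3)) (u(3 := u3)) (P(3 := P3)) (G(3 := G3)) (R(3 := R3)))
             \<longleftrightarrow> kdv_solution (- A) B C \<Omega> (\<rho> 1)"
    if first: "first_order_relations X P0 R0 \<Omega> \<rho> u P G R"
      and second: "second_order_relations X P0 T0 R0 \<Omega> \<rho> u P G R"
      and u1: "\<forall>(\<xi>, \<tau>)\<in>\<Omega>. u 1 \<xi> \<tau> = wave_speed X P0 R0 / rho0 X R0 * \<rho> 1 \<xi> \<tau>"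
  proof -
    have u1': "\<forall>(\<xi>, \<tau>)\<in>\<Omega>. u 1 \<xi> \<tau> = a * \<Delta> * \<rho> 1 \<xi> \<tau>"
      using u1 by (simp add: a_def rho0_def \<Delta>_def)
    \<comment> \<open>Only coefficients with numbers 1 and 2 occur here, so any choice of third ones
      leaves these equations intact and the condition for three orders reduces to
      \<open>third_equations\<close>.\<close>
    have leading: "leading_equations \<gamma> P0 T0 R0 a \<Delta> (\<rho>(3 := \<rho>3)) (u(3 := u3)) (P(3 := P3)) (G(3 := G3)) (R(3 := R3)) \<xi> \<tau>"
      if "(\<xi>, \<tau>) \<in> \<Omega>" for \<xi> \<tau> \<rho>3 u3 P3 G3 R3
      using leading_of_relations[OF ctx first second that] unfolding leading_equations_def by simp
    have "lowest_orders_satisfied \<gamma> X P0 T0 R0 \<alpha> \<beta> q k 3 \<Omega>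
          (\<rho>(3 := \<rho>3)) (u(3 := u3)) (P(3 := P3)) (G(3 := G3)) (R(3 := R3)) \<longleftrightarrow>
        (\<forall>(\<xi>, \<tau>)\<in>\<Omega>. third_equations \<gamma> P0 T0 R0 a \<Delta> (\<rho>(3 := \<rho>3)) (u(3 := u3)) (P(3 := P3)) (G(3 := G3)) (R(3 := R3)) \<xi> \<tau>)"
      if "smooth2_on \<Omega> \<rho>3" "smooth2_on \<Omega> u3" "smooth2_on \<Omega> P3" "smooth2_on \<Omega> G3" "smooth2_on \<Omega> R3"
      for \<rho>3 u3 P3 G3 R3
    proof -
      have "lowest_orders_satisfied \<gamma> X P0 T0 R0 \<alpha> \<beta> q k 3 \<Omega>
          (\<rho>(3 := \<rho>3)) (u(3 := u3)) (P(3 := P3)) (G(3 := G3)) (R(3 := R3)) \<longleftrightarrow>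
        (\<forall>(\<xi>, \<tau>)\<in>\<Omega>. leading_equations \<gamma> P0 T0 R0 a \<Delta> (\<rho>(3 := \<rho>3)) (u(3 := u3)) (P(3 := P3)) (G(3 := G3)) (R(3 := R3)) \<xi> \<tau> \<and>
          third_equations \<gamma> P0 T0 R0 a \<Delta> (\<rho>(3 := \<rho>3)) (u(3 := u3)) (P(3 := P3)) (G(3 := G3)) (R(3 := R3)) \<xi> \<tau>)"
        unfolding exponents
      proof (rule lowest(2))
        show "smooth2_on \<Omega> ((\<rho>(3 := \<rho>3)) j) \<and> smooth2_on \<Omega> ((u(3 := u3)) j) \<and> smooth2_on \<Omega> ((P(3 := P3)) j)
            \<and> smooth2_on \<Omega> ((G(3 := G3)) j) \<and> smooth2_on \<Omega> ((R(3 := R3)) j)" if "j \<in> {1..3}" for j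
        proof (cases "j = 3")
          case False
          with that have "j \<in> {1, 2}" by auto
          from assms(18)[OF this] False show ?thesis by simp
        qed (use \<open>smooth2_on \<Omega> \<rho>3\<close> \<open>smooth2_on \<Omega> u3\<close> \<open>smooth2_on \<Omega> P3\<close> \<open>smooth2_on \<Omega> G3\<close> \<open>smooth2_on \<Omega> R3\<close> in simp)
      qed
      also have "\<dots> \<longleftrightarrow> (\<forall>(\<xi>, \<tau>)\<in>\<Omega>. third_equations \<gamma> P0 T0 R0 a \<Delta> (\<rho>(3 := \<rho>3)) (u(3 := u3)) (P(3 := P3))
          (G(3 := G3)) (R(3 := R3)) \<xi> \<tau>)"
        by (intro ball_cong refl, clarify, simp only: leading simp_thms)
      finally show ?thesis .
    qed
    note iff = this
    show ?thesis
    proof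
      assume "kdv_solution (- A) B C \<Omega> (\<rho> 1)"
      from third_of_kdv[OF ctx first second u1' f this]
      obtain \<rho>3 u3 P3 G3 R3 where "smooth2_on \<Omega> \<rho>3" "smooth2_on \<Omega> u3" "smooth2_on \<Omega> P3"
        "smooth2_on \<Omega> G3" "smooth2_on \<Omega> R3"
        "\<forall>(\<xi>, \<tau>)\<in>\<Omega>. third_equations \<gamma> P0 T0 R0 a \<Delta> (\<rho>(3 := \<rho>3)) (u(3 := u3)) (P(3 := P3)) (G(3 := G3)) (R(3 := R3)) \<xi> \<tau>"
        by (elim exE conjE)
      with iff[of \<rho>3 u3 P3 G3 R3] show "\<exists>\<rho>3 u3 P3 G3 R3.
                smooth2_on \<Omega> \<rho>3 \<and> smooth2_on \<Omega> u3 \<and> smooth2_on \<Omega> P3 \<and>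
                smooth2_on \<Omega> G3 \<and> smooth2_on \<Omega> R3 \<and>
                lowest_orders_satisfied \<gamma> X P0 T0 R0 \<alpha> \<beta> q k 3 \<Omega>
                  (\<rho>(3 := \<rho>3)) (u(3 := u3)) (P(3 := P3)) (G(3 := G3)) (R(3 := R3))"
        by blast
    next
      assume "\<exists>\<rho>3 u3 P3 G3 R3.
                smooth2_on \<Omega> \<rho>3 \<and> smooth2_on \<Omega> u3 \<and> smooth2_on \<Omega> P3 \<and>
                smooth2_on \<Omega> G3 \<and> smooth2_on \<Omega> R3 \<and>
                lowest_orders_satisfied \<gamma> X P0 T0 R0 \<alpha> \<beta> q k 3 \<Omega>
                  (\<rho>(3 := \<rho>3)) (u(3 := u3)) (P(3 := P3)) (G(3 := G3)) (R(3 := R3))"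
      then obtain \<rho>3 u3 P3 G3 R3 where sm: "smooth2_on \<Omega> \<rho>3" "smooth2_on \<Omega> u3" "smooth2_on \<Omega> P3"
        "smooth2_on \<Omega> G3" "smooth2_on \<Omega> R3"
        and "lowest_orders_satisfied \<gamma> X P0 T0 R0 \<alpha> \<beta> q k 3 \<Omega>
                  (\<rho>(3 := \<rho>3)) (u(3 := u3)) (P(3 := P3)) (G(3 := G3)) (R(3 := R3))"
        by (elim exE conjE)
      with iff[OF sm] have "\<forall>(\<xi>, \<tau>)\<in>\<Omega>. third_equations \<gamma> P0 T0 R0 a \<Delta> (\<rho>(3 := \<rho>3)) (u(3 := u3)) (P(3 := P3)) (G(3 := G3)) (R(3 := R3)) \<xi> \<tau>"
        by simp
      then show "kdv_solution (- A) B C \<Omega> (\<rho> 1)"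
        by (intro kdv_of_third[OF ctx first second u1' f sm(1)]) (drule (1) bspec, simp only: case_prod_conv)
    qed
  qed
  show ?thesis
    using two three by simp
qed

end
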